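(* Let $d > 5$ be a constant and $\epsilon > 0$. There is a randomized adaptive algorithm that, for every undirected graph $G$ on $[n]$ with non-negative real edge weights (arbitrary, with no bound on the ratio between the largest and smallest nonzero weight), makes $O(n \log^3 n (\log n + \frac{1}{\epsilon^2}))$ cut queries and, with probability $1 - O(n^{5-d})$, outputs a weighted graph $H$ on $[n]$ with $\tilde{O}_\epsilon(n)$ edges of nonzero weight such that $(1-2\epsilon) F(S; G) \le F(S; H) \le (1+2\epsilon) F(S; G)$ for every $S \subseteq [n]$.
   Context: For a weighted undirected graph $G$ on $[n]$ with non-negative weights $w_{i,j}$, $F(S; G) = \sum_{i \in S, j \notin S} w_{i,j}$ is its cut function. Cut query model: the algorithm accesses $G$ only by submitting sets $S \subseteq [n]$ and receiving $F(S; G)$, with unlimited computation and internal randomness. $\tilde{O}_\epsilon(n)$ denotes $n$ times a factor polylogarithmic in $n$ and depending on $\epsilon$. *)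

theory Defs
  imports "HOL-Probability.Probability"
begin

text \<open>A weighted graph on \<open>{1..n}\<close> is given by its weight matrix; weight zero means that the
  edge is absent. Entries outside the vertex set are fixed to zero.\<close>

type_synonym wgraph = "nat \<Rightarrow> nat \<Rightarrow> real"

definition wgraph_on :: "nat \<Rightarrow> wgraph \<Rightarrow> bool" where
  "wgraph_on n w \<longleftrightarrow>
     (\<forall>i j. w i j = w j i) \<and>
     (\<forall>i j. 0 \<le> w i j) \<and>
     (\<forall>i. w i i = 0) \<and>
     (\<forall>i j. w i j \<noteq> 0 \<longrightarrow> i \<in> {1..n} \<and> j \<in> {1..n})"

definition edges :: "wgraph \<Rightarrow> nat set set" where
  "edges w = {{i, j} | i j. w i j \<noteq> 0}"

definition cut_fun :: "nat \<Rightarrow> wgraph \<Rightarrow> nat set \<Rightarrow> real" where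
  "cut_fun n w S = (\<Sum>i\<in>S. \<Sum>j\<in>{1..n} - S. w i j)"

text \<open>A randomized adaptive query algorithm is a decision tree. A \<open>Query\<close> node submits a set and
  continues according to the real number it receives; a \<open>Sample\<close> node draws from an arbitrary
  discrete distribution, which may depend on everything seen so far. Local computation is free,
  hence not represented. Every execution is finite, since datatype values are well-founded.\<close>

datatype 'r query_alg =
    Return 'r
  | Query "nat set" "real \<Rightarrow> 'r query_alg"
  | Sample "nat pmf" "nat \<Rightarrow> 'r query_alg"

primrec queries_within :: "nat set \<Rightarrow> 'r query_alg \<Rightarrow> bool" where
  "queries_within V (Return r) \<longleftrightarrow> True"
| "queries_within V (Query S k) \<longleftrightarrow> S \<subseteq> V \<and> (\<forall>x. queries_within V (k x))"
| "queries_within V (Sample p k) \<longleftrightarrow> (\<forall>x. queries_within V (k x))"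

text \<open>The joint distribution of the output and the number of queries made (repeated queries are
  counted each time), when queries are answered by \<open>F\<close>.\<close>

primrec run :: "(nat set \<Rightarrow> real) \<Rightarrow> 'r query_alg \<Rightarrow> ('r \<times> nat) pmf" where
  "run F (Return r) = return_pmf (r, 0)"
| "run F (Query S k) = map_pmf (\<lambda>(r, q). (r, Suc q)) (run F (k (F S)))"
| "run F (Sample p k) = bind_pmf p (\<lambda>x. run F (k x))"

end

theory Submission
  imports Defs
begin

text \<open>Differences of cut queries give the weight between two disjoint sets, so an edge can be drawn with
  probability proportional to its weight by descending along the binary digits of its endpoints, at
  logarithmic cost. The first stage contracts the graph in rounds. Among the vertices whose degree is
  at least a \<open>1/(4n)\<close> fraction of the total, it samples \<open>O(m ln n)\<close> edges and contracts the strong parts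
  of the sampled multigraph. A union bound over all partitions shows that a constant fraction of the
  weight disappears; a union bound over the fewer than \<open>n\<close> cuts obtained by splitting the graph
  recursively along light cuts shows that only well connected vertices are merged. Since a vertex of
  fixed degree is active during \<open>O(ln n)\<close> rounds only, the ratio of the weights plays no role. Each
  edge receives the average degree at its contraction as a lower bound for its strength.

  The second stage samples edges with probability inversely proportional to these bounds and reweights
  them. Dividing all weights by the strengths makes every nonempty cut of a level class have weight at
  least 1, so Karger's bound on the number of small cuts and a Chernoff bound control all cuts of
  all level classes at once, and summing over the levels recovers the cuts of the graph
  (Benczur and Karger).\<close>

section \<open>Cut weights and strong sets\<close>

text \<open>The query bound has to hold in every run, whereas the strength bounds hold only with
  high probability. So a round that leaves more than 3/4 of the total weight \<open>D\<close> stops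
  the recursion; outside the bad event this stop does not occur, and the cost is governed by a
  potential alone. The constants fit as follows. Vertices below the activity threshold carry at most
  \<open>D / 4\<close>, so the weight \<open>Y\<close> among active vertices is at least
  \<open>D / 2\<close>, and contracting half of \<open>Y\<close> leaves at most 3/4 of
  \<open>D\<close>. With \<open>N\<close> samples on \<open>m\<close> vertices the threshold is
  \<open>tau = N / (4 * m)\<close>. A partition that cuts more than \<open>Y / 2\<close> expects
  more than \<open>N / 2\<close> samples across it, while one obtained by splitting below
  \<open>tau\<close> is crossed by fewer than \<open>N / 4\<close>; a cut lighter than
  \<open>Y / (32 * m)\<close> expects at most \<open>tau / 4\<close>. The partition depends on the
  sample, hence the union bound over all maps, whose entropy \<open>m * ln m\<close> is paid for by
  \<open>N\<close> of at least \<open>32 * m * ln n\<close>. The second stage asks that the scales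
  stay below the strengths and that the sum of weight over scale be O(n ln n). The latter
  telescopes: \<open>D / kap\<close> grows by at most \<open>64 * m\<close> per round, and these
  \<open>m\<close> add up to O(n ln n).\<close>

definition cw :: "('a \<Rightarrow> 'a \<Rightarrow> real) \<Rightarrow> 'a set \<Rightarrow> 'a set \<Rightarrow> real" where
  "cw w A B = (\<Sum>i\<in>A. \<Sum>j\<in>B. w i j)"

text \<open>This is \<open>t\<close>-edge-connectivity of the subgraph induced on \<open>X\<close>,
  the strong components of Benczur and Karger being its maximal instances. The empty set and
  singletons qualify for every \<open>t\<close>.\<close>

definition strong :: "('a \<Rightarrow> 'a \<Rightarrow> real) \<Rightarrow> real \<Rightarrow> 'a set \<Rightarrow> bool" where
  "strong w t X \<longleftrightarrow> (\<forall>A. A \<subseteq> X \<and> A \<noteq> {} \<and> A \<noteq> X \<longrightarrow> t \<le> cw w A (X - A))"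

lemma cw_empty [simp]: "cw w {} B = 0" "cw w A {} = 0"
  by (simp_all add: cw_def)

lemma cw_nonneg: "(\<And>i j. 0 \<le> w i j) \<Longrightarrow> 0 \<le> cw w A B"
  by (simp add: cw_def sum_nonneg)

lemma cw_commute: "(\<And>i j. w i j = w j i) \<Longrightarrow> cw w A B = cw w B A"
  unfolding cw_def by (subst sum.swap) simp

lemma cw_Un_left: "finite A \<Longrightarrow> finite A' \<Longrightarrow> A \<inter> A' = {} \<Longrightarrow> cw w (A \<union> A') B = cw w A B + cw w A' B"
  by (simp add: cw_def sum.union_disjoint)

lemma cw_Un_right: "finite B \<Longrightarrow> finite B' \<Longrightarrow> B \<inter> B' = {} \<Longrightarrow> cw w A (B \<union> B') = cw w A B + cw w A B'"
  by (simp add: cw_def sum.union_disjoint sum.distrib)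

lemma cw_mono:
  assumes "\<And>i j. 0 \<le> w i j" "A \<subseteq> A'" "B \<subseteq> B'" "finite A'" "finite B'"
  shows "cw w A B \<le> cw w A' B'"
proof -
  have "cw w A B \<le> cw w A B'"
    unfolding cw_def using assms by (intro sum_mono sum_mono2) auto
  also have "\<dots> \<le> cw w A' B'"
    unfolding cw_def using assms by (intro sum_mono2) (auto intro: sum_nonneg)
  finally show ?thesis .
qed

lemma strong_singleton [simp]: "strong w t {x}"
  by (auto simp: strong_def)

lemma strong_cut:
  assumes "strong w t X" "x \<in> X \<inter> A" "y \<in> X - A"
  shows "t \<le> cw w (X \<inter> A) (X - A)"
proof -
  have "X - X \<inter> A = X - A" by auto
  with assms show ?thesis unfolding strong_def by (metis DiffE Int_lower1 Int_iff empty_iff)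
qed

text \<open>A proper cut of the union separates the common vertex \<open>v\<close> from some other
  vertex. That vertex lies in \<open>X\<close> or in \<open>Y\<close>, so the cut restricts to a
  proper cut of this set, which already has weight \<open>t\<close>.\<close>

lemma strong_Un:
  assumes w: "\<And>i j. 0 \<le> w i j" and X: "strong w t X" and Y: "strong w t Y"
    and v: "v \<in> X" "v \<in> Y" and fin: "finite X" "finite Y"
  shows "strong w t (X \<union> Y)"
  unfolding strong_def
proof (intro allI impI)
  fix A assume A: "A \<subseteq> X \<union> Y \<and> A \<noteq> {} \<and> A \<noteq> X \<union> Y"
  have *: "t \<le> cw w A (X \<union> Y - A)" if Z: "strong w t Z" "Z \<subseteq> X \<union> Y" "x \<in> Z \<inter> A" "y \<in> Z - A" for Z x y
  proof -
    have "t \<le> cw w (Z \<inter> A) (Z - A)" using strong_cut[OF Z(1,3,4)] .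
    also have "\<dots> \<le> cw w A (X \<union> Y - A)"
      using w fin Z(2) A finite_subset[of A "X \<union> Y"] by (intro cw_mono) auto
    finally show ?thesis .
  qed
  from A obtain x y where xy: "x \<in> A" "x \<in> X \<union> Y" "y \<in> X \<union> Y" "y \<notin> A" by blast
  show "t \<le> cw w A (X \<union> Y - A)"
  proof (cases "v \<in> A")
    case True
    show ?thesis
    proof (cases "y \<in> X")
      case True
      then show ?thesis using *[OF X, of v y] \<open>v \<in> A\<close> v xy by auto
    next
      case False
      then show ?thesis using *[OF Y, of v y] \<open>v \<in> A\<close> v xy by auto
    qed
  next
    case False
    show ?thesis
    proof (cases "x \<in> X")
      case True
      then show ?thesis using *[OF X, of x v] \<open>v \<notin> A\<close> v xy by auto
    next
      case False
      then show ?thesis using *[OF Y, of x v] \<open>v \<notin> A\<close> v xy by auto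
    qed
  qed
qed

lemma cut_weights_sum:
  assumes sym: "\<And>i j. w i j = w j i" and fin: "finite M" and A: "A \<subseteq> M"
  shows "(\<Sum>u\<in>M. \<Sum>v\<in>M. if (u \<in> A) \<noteq> (v \<in> A) then w u v else 0) = 2 * cw w A (M - A)"
proof -
  have eq: "(\<Sum>u\<in>M. \<Sum>v\<in>M. if (u \<in> A) \<noteq> (v \<in> A) then w u v else 0)
     = (\<Sum>u\<in>M. if u \<in> A then (\<Sum>v\<in>M - A. w u v) else (\<Sum>v\<in>A. w u v))"
  proof (rule sum.cong[OF refl])
    fix u assume "u \<in> M"
    have "(\<Sum>v\<in>M. if (u \<in> A) \<noteq> (v \<in> A) then w u v else 0) = (\<Sum>v\<in>{v\<in>M. (u \<in> A) \<noteq> (v \<in> A)}. w u v)"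
      using fin by (simp add: sum.inter_filter)
    also have "{v\<in>M. (u \<in> A) \<noteq> (v \<in> A)} = (if u \<in> A then M - A else A)"
      using A by auto
    finally show "(\<Sum>v\<in>M. if (u \<in> A) \<noteq> (v \<in> A) then w u v else 0)
        = (if u \<in> A then (\<Sum>v\<in>M - A. w u v) else (\<Sum>v\<in>A. w u v))" by (simp split: if_splits)
  qed
  have M: "M = A \<union> (M - A)" using A by auto
  have "(\<Sum>u\<in>M. if u \<in> A then (\<Sum>v\<in>M - A. w u v) else (\<Sum>v\<in>A. w u v))
      = (\<Sum>u\<in>A. if u \<in> A then (\<Sum>v\<in>M - A. w u v) else (\<Sum>v\<in>A. w u v))
      + (\<Sum>u\<in>M - A. if u \<in> A then (\<Sum>v\<in>M - A. w u v) else (\<Sum>v\<in>A. w u v))"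
    by (subst M, rule sum.union_disjoint) (use fin A finite_subset in auto)
  also have "\<dots> = cw w A (M - A) + cw w (M - A) A"
    by (simp add: cw_def)
  also have "cw w (M - A) A = cw w A (M - A)" using sym by (rule cw_commute)
  finally show ?thesis using eq by simp
qed

text \<open>Contraction of \<open>v\<close> into \<open>u\<close>. The rows of \<open>v\<close> stay
  in place and \<open>v\<close> is dropped from the vertex set instead; the weight of the contracted
  pair ends up on the diagonal, which no cut sees.\<close>

definition merge :: "('a \<Rightarrow> 'a \<Rightarrow> real) \<Rightarrow> 'a \<Rightarrow> 'a \<Rightarrow> 'a \<Rightarrow> 'a \<Rightarrow> real" where
  "merge w u v x y = w x y + (if x = u then w v y else 0) + (if y = u then w x v else 0)"

text \<open>The cuts of the contracted graph are the old cuts with \<open>u\<close> and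
  \<open>v\<close> on the same side, at their old weight. This one identity transfers both
  connectivity and the counting of small cuts.\<close>

lemma cw_merge:
  assumes fin: "finite M" and uv: "u \<in> M" "v \<in> M" "u \<noteq> v" and A: "A \<subseteq> M - {v}"
  shows "cw (merge w u v) A (M - {v} - A) =
    cw w (if u \<in> A then insert v A else A) (M - (if u \<in> A then insert v A else A))"
proof (cases "u \<in> A")
  case True
  have finA: "finite A" using A fin finite_subset by blast
  have vA: "v \<notin> A" using A by auto
  have "cw (merge w u v) A (M - {v} - A)
      = (\<Sum>x\<in>A. \<Sum>y\<in>M - {v} - A. w x y + (if x = u then w v y else 0))"
    unfolding cw_def merge_def using True by (intro sum.cong refl) auto
  also have "\<dots> = (\<Sum>x\<in>A. (\<Sum>y\<in>M - {v} - A. w x y) + (if x = u then (\<Sum>y\<in>M - {v} - A. w v y) else 0))"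
    by (intro sum.cong refl) (auto simp: sum.distrib)
  also have "\<dots> = (\<Sum>x\<in>A. \<Sum>y\<in>M - {v} - A. w x y) + (\<Sum>y\<in>M - {v} - A. w v y)"
    using True finA by (simp add: sum.distrib)
  also have "\<dots> = cw w (insert v A) (M - insert v A)"
    unfolding cw_def using finA vA by (simp add: Diff_insert2 [symmetric] insert_commute)
  finally show ?thesis using True by simp
next
  case False
  have finA: "finite A" using A fin finite_subset by blast
  have "cw (merge w u v) A (M - {v} - A)
      = (\<Sum>x\<in>A. \<Sum>y\<in>M - {v} - A. w x y + (if y = u then w x v else 0))"
    unfolding cw_def merge_def using False by (intro sum.cong refl) auto
  also have "\<dots> = (\<Sum>x\<in>A. (\<Sum>y\<in>M - {v} - A. w x y) + w x v)"
    using False fin uv by (simp add: sum.distrib)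
  also have "\<dots> = (\<Sum>x\<in>A. \<Sum>y\<in>insert v (M - {v} - A). w x y)"
    using fin by (intro sum.cong refl) (simp add: add.commute)
  also have "insert v (M - {v} - A) = M - A" using A uv by auto
  finally show ?thesis using False by (simp add: cw_def)
qed

section \<open>Counting small cuts\<close>

text \<open>The bound is \<open>k / 2\<close> because in a graph of minimum cut 1 a cut of weight at
  most \<open>k / 2\<close> is tracked by contraction down to \<open>k\<close> vertices. A cut and
  its complement are counted separately.\<close>

definition small_cuts :: "('a \<Rightarrow> 'a \<Rightarrow> real) \<Rightarrow> 'a set \<Rightarrow> nat \<Rightarrow> 'a set set" where
  "small_cuts w M k = {A. A \<subseteq> M \<and> A \<noteq> {} \<and> A \<noteq> M \<and> cw w A (M - A) \<le> real k / 2}"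

lemma card_small_cuts_le_power:
  assumes "finite M"
  shows "real (card (small_cuts w M k)) \<le> 2 ^ card M"
proof -
  have "card (small_cuts w M k) \<le> card (Pow M)"
    unfolding small_cuts_def using assms by (intro card_mono) auto
  then have "card (small_cuts w M k) \<le> 2 ^ card M"
    using assms by (simp add: card_Pow)
  then have "real (card (small_cuts w M k)) \<le> real (2 ^ card M)"
    by (rule of_nat_mono)
  then show ?thesis by simp
qed

lemma two_power_le_fact: "(2::real) ^ k \<le> 2 * fact k"
proof (induction k)
  case (Suc k)
  show ?case
  proof (cases "k = 0")
    case False
    have "(2::real) ^ Suc k \<le> 2 * (2 * fact k)" using Suc by simp
    also have "\<dots> \<le> (real k + 1) * (2 * fact k)" using False by (intro mult_right_mono) auto
    finally show ?thesis by (simp add: algebra_simps)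
  qed simp
qed simp

lemma strongD: "strong w t X \<Longrightarrow> A \<subseteq> X \<Longrightarrow> A \<noteq> {} \<Longrightarrow> A \<noteq> X \<Longrightarrow> t \<le> cw w A (X - A)"
  by (simp add: strong_def)

lemma finite_small_cuts: "finite M \<Longrightarrow> finite (small_cuts w M k)"
  by (rule finite_subset[of _ "Pow M"]) (auto simp: small_cuts_def)

text \<open>Karger's contraction argument without probability: the claim for \<open>m\<close> vertices, averaged over the
  contractions of all pairs with their weights, gives the claim for \<open>m + 1\<close> vertices.\<close>

lemma karger_count_choose:
  assumes "k \<le> m" "1 \<le> k" "finite M" "card M = m"
    and "\<And>i j. w i j = w j i" "\<And>i j. 0 \<le> w i j" "strong w 1 M"
  shows "real (card (small_cuts w M k)) \<le> real (m choose k) * 2 ^ k"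
  using assms
proof (induction m arbitrary: M w rule: dec_induct)
  case (base M w)
  have "real (card (small_cuts w M k)) \<le> 2 ^ card M"
    using base(2) by (rule card_small_cuts_le_power)
  then show ?case by (simp only: base(3) binomial_n_n of_nat_1 mult_1)
next
  case (step m M w)
  note fin = step.prems(2) and cardM = step.prems(3) and str = step.prems(6)
  note sym = step.prems(4) and nn = step.prems(5)
  define N where "N = (small_cuts w M k)"
  define B where "B = real (m choose k) * 2 ^ k"
  define T where "T = (\<Sum>u\<in>M. \<Sum>v\<in>M. if u \<noteq> v then w u v else 0)"
  have finN: "finite N" unfolding N_def using fin by (rule finite_small_cuts)
  have contract: "real (card {A\<in>N. (u \<in> A) = (v \<in> A)}) \<le> B" if uv: "u \<in> M" "v \<in> M" "u \<noteq> v" for u v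
  proof -
    define M' where "M' = M - {v}"
    define w' where "w' = merge w u v"
    have 1: "finite M'" "card M' = m" using fin cardM uv by (auto simp: M'_def)
    have 2: "w' i j = w' j i" for i j
      unfolding w'_def merge_def using sym[of i j] sym[of v j] sym[of v i] by auto
    have 3: "0 \<le> w' i j" for i j unfolding w'_def merge_def using nn by auto
    have 4: "strong w' 1 M'"
      unfolding strong_def
    proof (intro allI impI)
      fix A assume A: "A \<subseteq> M' \<and> A \<noteq> {} \<and> A \<noteq> M'"
      let ?A = "if u \<in> A then insert v A else A"
      have "?A \<subseteq> M" "?A \<noteq> {}" "?A \<noteq> M" using A uv by (auto simp: M'_def split: if_splits)
      then have "1 \<le> cw w ?A (M - ?A)" by (rule strongD[OF str])
      also have "\<dots> = cw w' A (M' - A)"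
        unfolding w'_def M'_def using A by (subst cw_merge[OF fin uv]) (auto simp: M'_def)
      finally show "1 \<le> cw w' A (M' - A)" .
    qed
    let ?R = "small_cuts w' M' k"
    have "inj_on (\<lambda>A. A - {v}) {A\<in>N. (u \<in> A) = (v \<in> A)}"
    proof (rule inj_onI)
      fix A A' assume A: "A \<in> {A\<in>N. (u \<in> A) = (v \<in> A)}" "A' \<in> {A\<in>N. (u \<in> A) = (v \<in> A)}"
        and eq: "A - {v} = A' - {v}"
      have "u \<in> A \<longleftrightarrow> u \<in> A'" using eq uv by blast
      then show "A = A'" using A eq by blast
    qed
    moreover have "(\<lambda>A. A - {v}) ` {A\<in>N. (u \<in> A) = (v \<in> A)} \<subseteq> ?R"
    proof (rule image_subsetI)
      fix A assume "A \<in> {A\<in>N. (u \<in> A) = (v \<in> A)}"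
      then have A: "A \<in> N" "(u \<in> A) = (v \<in> A)" by auto
      then have AM: "A \<subseteq> M" "A \<noteq> {}" "A \<noteq> M" "cw w A (M - A) \<le> real k / 2"
        by (auto simp: N_def small_cuts_def)
      have A': "A = (if u \<in> A - {v} then insert v (A - {v}) else A - {v})" using A(2) uv by auto
      have "cw w' (A - {v}) (M' - (A - {v})) = cw w A (M - A)"
        unfolding w'_def M'_def
        by (subst cw_merge[OF fin uv]) (use AM A' in auto)
      moreover have "A - {v} \<noteq> {}" using AM(2) A(2) uv by blast
      moreover have "A - {v} \<noteq> M'"
      proof
        assume *: "A - {v} = M'"
        then have "u \<in> A" using uv by (auto simp: M'_def)
        then have "v \<in> A" using A(2) by simp
        with * AM(1,3) show False by (auto simp: M'_def)
      qed
      ultimately show "A - {v} \<in> ?R" using AM by (auto simp: small_cuts_def M'_def)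
    qed
    moreover have "finite ?R" using 1(1) by (rule finite_small_cuts)
    ultimately have "card {A\<in>N. (u \<in> A) = (v \<in> A)} \<le> card ?R" by (rule card_inj_on_le)
    then show ?thesis using step.IH[OF step.prems(1) 1 2 3 4] by (simp add: B_def)
  qed
  \<comment> \<open>\<open>T\<close> sums all degrees, and each degree is a cut of weight at least
    1.\<close>
  have T: "T \<ge> real (Suc m)"
  proof -
    have "1 \<le> (\<Sum>v\<in>M. if u \<noteq> v then w u v else 0)" if u: "u \<in> M" for u
    proof (cases "M = {u}")
      case True
      then have "m = 0" using cardM by simp
      with step.hyps step.prems(1) have "False" by simp
      then show ?thesis ..
    next
      case False
      then have "1 \<le> cw w {u} (M - {u})" using u by (intro strongD[OF str]) auto
      also have "\<dots> = (\<Sum>v\<in>{v\<in>M. u \<noteq> v}. w u v)"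
        unfolding cw_def by (auto intro!: sum.cong)
      also have "\<dots> = (\<Sum>v\<in>M. if u \<noteq> v then w u v else 0)" using fin by (subst sum.inter_filter) auto
      finally show ?thesis .
    qed
    then have "(\<Sum>u\<in>M. 1) \<le> T" unfolding T_def by (rule sum_mono)
    then show ?thesis using cardM by simp
  qed
  \<comment> \<open>Double counting of cuts and uncut pairs. A small cut separates ordered pairs of
    total weight at most \<open>k\<close>, so pairs of weight at least \<open>T - k\<close> have a
    contraction that preserves it; each pair is in turn charged by at most \<open>B\<close>
    cuts.\<close>
  have "real (card N) * (T - real k) \<le> (\<Sum>A\<in>N. T - 2 * cw w A (M - A))"
  proof -
    have "(\<Sum>A\<in>N. T - real k) \<le> (\<Sum>A\<in>N. T - 2 * cw w A (M - A))"
      by (rule sum_mono) (auto simp: N_def small_cuts_def)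
    then show ?thesis by simp
  qed
  also have "\<dots> = (\<Sum>A\<in>N. \<Sum>u\<in>M. \<Sum>v\<in>M. if u \<noteq> v \<and> (u \<in> A) = (v \<in> A) then w u v else 0)"
  proof (rule sum.cong[OF refl])
    fix A assume "A \<in> N"
    then have A: "A \<subseteq> M" by (auto simp: N_def small_cuts_def)
    show "T - 2 * cw w A (M - A) = (\<Sum>u\<in>M. \<Sum>v\<in>M. if u \<noteq> v \<and> (u \<in> A) = (v \<in> A) then w u v else 0)"
      unfolding T_def cut_weights_sum[OF sym fin A, symmetric] sum_subtractf[symmetric]
      by (intro sum.cong refl) auto
  qed
  also have "\<dots> = (\<Sum>u\<in>M. \<Sum>v\<in>M. \<Sum>A\<in>N. if u \<noteq> v \<and> (u \<in> A) = (v \<in> A) then w u v else 0)"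
    by (subst sum.swap, rule sum.cong[OF refl], subst sum.swap) simp
  also have "\<dots> \<le> (\<Sum>u\<in>M. \<Sum>v\<in>M. (if u \<noteq> v then w u v else 0) * B)"
  proof (intro sum_mono)
    fix u v assume uv: "u \<in> M" "v \<in> M"
    show "(\<Sum>A\<in>N. if u \<noteq> v \<and> (u \<in> A) = (v \<in> A) then w u v else 0) \<le> (if u \<noteq> v then w u v else 0) * B"
    proof (cases "u = v")
      case False
      have "(\<Sum>A\<in>N. if u \<noteq> v \<and> (u \<in> A) = (v \<in> A) then w u v else 0)
          = (\<Sum>A\<in>{A\<in>N. (u \<in> A) = (v \<in> A)}. w u v)"
        using finN False by (subst sum.inter_filter) auto
      also have "\<dots> = w u v * real (card {A\<in>N. (u \<in> A) = (v \<in> A)})" by simp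
      also have "\<dots> \<le> w u v * B" using contract[OF uv False] nn by (intro mult_left_mono) auto
      finally show ?thesis using False by simp
    qed simp
  qed
  also have "\<dots> = T * B" by (simp add: T_def sum_distrib_right)
  finally have main: "real (card N) * (T - real k) \<le> T * B" .
  have km: "k \<le> m" using step.hyps by simp
  have Bnn: "B \<ge> 0" by (simp add: B_def)
  have Tk: "T > real k" using T km by linarith
  have "real (card N) \<le> T * B / (T - real k)" using main Tk by (simp add: pos_le_divide_eq)
  \<comment> \<open>\<open>T / (T - k)\<close> decreases in \<open>T\<close>, so the lower bound on
    \<open>T\<close> may be inserted. The resulting factor is exactly the quotient of the binomial
    coefficients for \<open>Suc m\<close> and \<open>m\<close>.\<close>
  also have "\<dots> \<le> real (Suc m) * B / (real (Suc m) - real k)"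
  proof -
    have "T / (T - real k) \<le> real (Suc m) / (real (Suc m) - real k)"
    proof -
      have "T * (real (Suc m) - real k) \<le> real (Suc m) * (T - real k)"
        using mult_right_mono[OF T, of "real k"] by (simp add: algebra_simps)
      then show ?thesis using Tk km by (simp add: divide_le_eq pos_le_divide_eq mult.commute)
    qed
    from mult_right_mono[OF this Bnn] show ?thesis by simp
  qed
  also have "\<dots> = real (Suc m choose k) * 2 ^ k"
  proof -
    have "(Suc m - k) * (Suc m choose k) = Suc m * (m choose k)"
      using binomial_absorb_comp[of "Suc m" k] by simp
    then have "real (Suc m - k) * real (Suc m choose k) = real (Suc m) * real (m choose k)"
      by (metis of_nat_mult)
    then have "(real (Suc m) - real k) * real (Suc m choose k) = real (Suc m) * real (m choose k)"
      using km by (simp add: of_nat_diff)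
    then have "real (Suc m choose k) = real (Suc m) * real (m choose k) / (real (Suc m) - real k)"
      using km by (simp add: nonzero_eq_divide_eq mult.commute)
    then show ?thesis by (simp add: B_def)
  qed
  finally show ?case by (simp add: N_def small_cuts_def)
qed

text \<open>The factor \<open>2 ^ k\<close> is absorbed by the \<open>fact k\<close> in the
  denominator of the binomial coefficient. When \<open>k\<close> exceeds the number of vertices, all
  subsets together are few enough, as \<open>n\<close> is at least 2.\<close>

lemma karger_count:
  assumes fin: "finite M" and M: "card M \<ge> 2" "card M \<le> n" and k: "1 \<le> k"
    and w: "\<And>i j. w i j = w j i" "\<And>i j. 0 \<le> w i j" "strong w 1 M"
  shows "real (card (small_cuts w M k)) \<le> 2 * real n ^ k"
proof (cases "k \<le> card M")
  case True
  have "real (card (small_cuts w M k))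
      \<le> real (card M choose k) * 2 ^ k"
    by (rule karger_count_choose[OF True k fin refl w])
  also have "\<dots> \<le> real (card M ^ k) / fact k * (2 * fact k)"
  proof (intro mult_mono two_power_le_fact)
    have "(card M choose k) * fact k \<le> card M ^ k"
      using binomial_fact_pow by blast
    then have "real (card M choose k) * fact k \<le> real (card M ^ k)"
      by (metis of_nat_fact of_nat_le_iff of_nat_mult)
    then show "real (card M choose k) \<le> real (card M ^ k) / fact k"
      by (simp add: pos_le_divide_eq)
  qed auto
  also have "\<dots> = 2 * real (card M) ^ k" by simp
  also have "\<dots> \<le> 2 * real n ^ k" using M by (simp add: power_mono)
  finally show ?thesis .
next
  case False
  have "real (card (small_cuts w M k)) \<le> 2 ^ card M"
    using card_small_cuts_le_power[OF fin] .
  also have "\<dots> \<le> 2 ^ k" using False by (intro power_increasing) auto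
  also have "\<dots> \<le> real n ^ k" using M by (intro power_mono) auto
  also have "\<dots> \<le> 2 * real n ^ k" by simp
  finally show ?thesis .
qed

lemma sum_geometric_tail_le:
  fixes r :: real
  assumes r: "0 \<le> r" "r \<le> 1/2" and I: "finite I" "\<And>k. k \<in> I \<Longrightarrow> 2 \<le> k"
  shows "(\<Sum>k\<in>I. r ^ k) \<le> 2 * r\<^sup>2"
proof -
  define K where "K = Suc (Max (insert 0 I))"
  have "(\<Sum>k\<in>I. r ^ k) \<le> (\<Sum>k\<in>(\<lambda>j. j + 2) ` {..<K}. r ^ k)"
  proof (intro sum_mono2)
    show "I \<subseteq> (\<lambda>j. j + 2) ` {..<K}"
    proof
      fix k assume k: "k \<in> I"
      then have "k \<le> Max (insert 0 I)" using I(1) by (intro Max_ge) auto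
      then have "k - 2 < K" by (simp add: K_def)
      moreover have "k = (k - 2) + 2" using I(2)[OF k] by simp
      ultimately show "k \<in> (\<lambda>j. j + 2) ` {..<K}" by blast
    qed
  qed (use r in auto)
  also have "\<dots> = (\<Sum>j<K. r ^ (j + 2))" by (subst sum.reindex) (auto simp: inj_on_def)
  also have "\<dots> = r\<^sup>2 * (\<Sum>j<K. r ^ j)" by (simp add: sum_distrib_left power_add power2_eq_square mult_ac)
  also have "\<dots> \<le> r\<^sup>2 * 2"
  proof (rule mult_left_mono)
    have "(\<Sum>j<K. r ^ j) = (1 - r ^ K) / (1 - r)" using r by (subst sum_gp_strict) auto
    also have "\<dots> \<le> 1 / (1 - r)" using r by (intro divide_right_mono) auto
    also have "\<dots> \<le> 2" using r by (simp add: field_simps)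
    finally show "(\<Sum>j<K. r ^ j) \<le> 2" .
  qed auto
  finally show ?thesis by simp
qed

definition cuts :: "'a set \<Rightarrow> 'a set set" where
  "cuts C = {A. A \<subseteq> C \<and> A \<noteq> {} \<and> A \<noteq> C}"

lemma finite_cuts [simp]: "finite C \<Longrightarrow> finite (cuts C)"
  by (rule finite_subset[of _ "Pow C"]) (auto simp: cuts_def)

text \<open>This is the union bound over the cuts of one class. Cuts are grouped by twice their
  weight, rounded down to \<open>k\<close>: there are at most \<open>2 * n ^ (k + 1)\<close> of
  them, each contributing at most \<open>exp (- t / 2) ^ k\<close>. The hypothesis on
  \<open>t\<close> makes the series geometric with ratio at most 1/2, so its first term
  \<open>k = 2\<close>, the cuts near the minimum, dominates.\<close>

lemma sum_exp_cuts_le: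
  assumes fin: "finite C" and C: "card C \<le> n"
    and w: "\<And>i j. w i j = w j i" "\<And>i j. 0 \<le> w i j" "strong w 1 C"
    and t: "0 \<le> t" "real n * exp (- t / 2) \<le> 1 / 2"
  shows "(\<Sum>A\<in>cuts C. exp (- t * cw w A (C - A))) \<le> 4 * real n ^ 3 * exp (- t)"
proof (cases "card C \<ge> 2")
  case False
  have "cuts C = {}"
  proof (rule ccontr)
    assume "cuts C \<noteq> {}"
    then obtain A where A: "A \<subseteq> C" "A \<noteq> {}" "A \<noteq> C" by (auto simp: cuts_def)
    then have "0 < card A" "card A < card C"
      using fin by (auto simp: card_gt_0_iff finite_subset psubset_card_mono)
    then show False using False by simp
  qed
  then show ?thesis by simp
next
  case True
  define y where "y = exp (- t / 2)"
  define l where "l A = nat \<lfloor>2 * cw w A (C - A)\<rfloor>" for A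
  have y: "0 < y" "y \<le> 1" using t by (auto simp: y_def)
  have F: "1 \<le> cw w A (C - A)" if "A \<in> cuts C" for A
    using that w(3) by (auto simp: cuts_def strong_def)
  have l2: "2 \<le> l A" if "A \<in> cuts C" for A
    using F[OF that] by (simp add: l_def le_nat_iff le_floor_iff)
  have "(\<Sum>A\<in>cuts C. exp (- t * cw w A (C - A))) \<le> (\<Sum>A\<in>cuts C. y ^ l A)"
  proof (rule sum_mono)
    fix A assume A: "A \<in> cuts C"
    have "real (l A) \<le> 2 * cw w A (C - A)" using F[OF A] by (simp add: l_def)
    then have "- t * cw w A (C - A) \<le> real (l A) * (- t / 2)"
      using mult_right_mono[of "real (l A)" "2 * cw w A (C - A)" "t / 2"] t by (simp add: mult_ac)
    then show "exp (- t * cw w A (C - A)) \<le> y ^ l A"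
      by (simp add: y_def flip: exp_of_nat_mult)
  qed
  also have "\<dots> = (\<Sum>k\<in>l ` cuts C. \<Sum>A\<in>{A\<in>cuts C. l A = k}. y ^ l A)"
    using fin by (subst sum.group[symmetric, of _ "l ` cuts C" l]) auto
  also have "\<dots> \<le> (\<Sum>k\<in>l ` cuts C. (2 * real n) * (real n * y) ^ k)"
  proof (rule sum_mono)
    fix k assume "k \<in> l ` cuts C"
    \<comment> \<open>Rounding down only gives a weight below \<open>(k + 1) / 2\<close>, hence the
      shift to \<open>k + 1\<close>.\<close>
    have "{A\<in>cuts C. l A = k} \<subseteq> small_cuts w C (k + 1)"
    proof
      fix A assume "A \<in> {A\<in>cuts C. l A = k}"
      then have A: "A \<in> cuts C" "l A = k" by auto
      have "2 * cw w A (C - A) \<le> real k + 1"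
        using A(2) F[OF A(1)] unfolding l_def by linarith
      then show "A \<in> small_cuts w C (k + 1)" using A by (auto simp: cuts_def small_cuts_def)
    qed
    then have "card {A\<in>cuts C. l A = k} \<le> card (small_cuts w C (k + 1))"
      using fin by (intro card_mono finite_small_cuts)
    then have "real (card {A\<in>cuts C. l A = k}) \<le> 2 * real n ^ (k + 1)"
      using karger_count[OF fin True C _ w, of "k + 1"] by linarith
    then have "real (card {A\<in>cuts C. l A = k}) * y ^ k \<le> 2 * real n ^ (k + 1) * y ^ k"
      using y by (intro mult_right_mono) auto
    then show "(\<Sum>A\<in>{A\<in>cuts C. l A = k}. y ^ l A) \<le> (2 * real n) * (real n * y) ^ k"
      by (simp add: power_mult_distrib)
  qed
  also have "\<dots> = 2 * real n * (\<Sum>k\<in>l ` cuts C. (real n * y) ^ k)"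
    by (simp add: sum_distrib_left)
  also have "\<dots> \<le> 2 * real n * (2 * (real n * y)\<^sup>2)"
    using t y l2 fin by (intro mult_left_mono sum_geometric_tail_le) (auto simp: y_def)
  also have "y\<^sup>2 = exp (- t)" by (simp add: y_def power2_eq_square flip: exp_add)
  then have "2 * real n * (2 * (real n * y)\<^sup>2) = 4 * real n ^ 3 * exp (- t)"
    by (simp add: power_mult_distrib power2_eq_square power3_eq_cube)
  finally show ?thesis .
qed

text \<open>A certificate that replaces the exponentially many cuts in a union bound: fewer than
  \<open>card Z\<close> light pairs suffice to expose every set that is not inside a strong one. The
  two sides of a pair need not cover \<open>Z\<close>, only the piece that is split.
  \<open>V\<close> stays fixed while the recursion shrinks \<open>Z\<close>, so that strong sets of
  the whole graph remain the reference.\<close>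

definition cut_system :: "('a \<Rightarrow> 'a \<Rightarrow> real) \<Rightarrow> real \<Rightarrow> 'a set \<Rightarrow> 'a set \<Rightarrow> ('a set \<times> 'a set) set \<Rightarrow> bool" where
  "cut_system w t V Z D \<longleftrightarrow> finite D \<and> card D < card Z \<and>
    (\<forall>A B. (A, B) \<in> D \<longrightarrow> A \<subseteq> Z \<and> B \<subseteq> Z \<and> cw w A B < t) \<and>
    (\<forall>A B X. (A, B) \<in> D \<longrightarrow> strong w t X \<longrightarrow> X \<subseteq> V \<longrightarrow> X \<inter> A = {} \<or> X \<inter> B = {}) \<and>
    (\<forall>Y. Y \<subseteq> Z \<longrightarrow> Y \<noteq> {} \<longrightarrow> (\<exists>X\<subseteq>Z. strong w t X \<and> Y \<subseteq> X) \<or>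
       (\<exists>A B. (A, B) \<in> D \<and> Y \<subseteq> A \<union> B \<and> Y \<inter> A \<noteq> {} \<and> Y \<inter> B \<noteq> {}))"

lemma cut_system_card: "cut_system w t V Z D \<Longrightarrow> finite D" "cut_system w t V Z D \<Longrightarrow> card D < card Z"
  by (simp_all only: cut_system_def)

lemma cut_systemD:
  assumes "cut_system w t V Z D" "(A, B) \<in> D"
  shows "A \<subseteq> Z" "B \<subseteq> Z" "cw w A B < t"
  using assms by (simp_all add: cut_system_def)

lemma cut_system_strong:
  assumes "cut_system w t V Z D" "(A, B) \<in> D" "strong w t X" "X \<subseteq> V"
  shows "X \<inter> A = {} \<or> X \<inter> B = {}"
  using assms by (simp add: cut_system_def)

lemma cut_system_cover:
  assumes "cut_system w t V Z D" "Y \<subseteq> Z" "Y \<noteq> {}"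
  obtains (strong) X where "X \<subseteq> Z" "strong w t X" "Y \<subseteq> X"
  | (cut) A B where "(A, B) \<in> D" "Y \<subseteq> A \<union> B" "Y \<inter> A \<noteq> {}" "Y \<inter> B \<noteq> {}"
proof -
  have "(\<exists>X\<subseteq>Z. strong w t X \<and> Y \<subseteq> X) \<or> (\<exists>A B. (A, B) \<in> D \<and> Y \<subseteq> A \<union> B \<and> Y \<inter> A \<noteq> {} \<and> Y \<inter> B \<noteq> {})"
    using assms by (simp add: cut_system_def)
  then show thesis using strong cut by metis
qed

text \<open>The cuts are obtained by splitting a set along cuts of weight less than \<open>t\<close> until all
  parts are strong. A fixed strong set is never split.\<close>

lemma cut_system_exists:
  assumes "finite Z" "Z \<noteq> {}" "\<And>X. strong w t X \<Longrightarrow> X \<subseteq> V \<Longrightarrow> X \<subseteq> Z \<or> X \<inter> Z = {}"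
    and w: "\<And>i j. 0 \<le> w i j"
  shows "\<exists>D. cut_system w t V Z D"
  using assms(1-3)
proof (induction "card Z" arbitrary: Z rule: less_induct)
  case (less Z)
  show ?case
  proof (cases "strong w t Z")
    case True
    then have "cut_system w t V Z {}" using less.prems by (auto simp: card_gt_0_iff cut_system_def)
    then show ?thesis by blast
  next
    case False
    then obtain A where A: "A \<subseteq> Z" "A \<noteq> {}" "A \<noteq> Z" "cw w A (Z - A) < t"
      unfolding strong_def by (auto simp: not_le)
    define B where "B = Z - A"
    have AB: "A \<union> B = Z" "A \<inter> B = {}" "B \<noteq> {}" "B \<subseteq> Z" using A by (auto simp: B_def)
    have fin: "finite A" "finite B" using less.prems(1) A AB by (auto intro: finite_subset)
    have card: "card Z = card A + card B" using card_Un_disjoint[OF fin AB(2)] AB(1) by simp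
    have pos: "card A > 0" "card B > 0" using fin A AB by (auto simp: card_gt_0_iff)
    \<comment> \<open>A strong set meeting both sides would lie inside \<open>Z\<close> and be cut
      by weight less than \<open>t\<close>, against its connectivity.\<close>
    have sep: "X \<inter> A = {} \<or> X \<inter> B = {}" if X: "strong w t X" "X \<subseteq> V" for X
    proof (rule ccontr)
      assume "\<not> (X \<inter> A = {} \<or> X \<inter> B = {})"
      then obtain x y where xy: "x \<in> X \<inter> A" "y \<in> X \<inter> B" by blast
      then have XZ: "X \<subseteq> Z" using less.prems(3)[OF X] A by blast
      have "t \<le> cw w (X \<inter> A) (X - A)"
        using X xy by (intro strong_cut[where x = x and y = y]) (auto simp: B_def)
      also have "\<dots> \<le> cw w A B" using XZ fin w by (intro cw_mono) (auto simp: B_def)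
      finally show False using A(4) by (simp add: B_def)
    qed
    have "\<exists>D. cut_system w t V A D"
    proof (rule less.hyps)
      show "X \<subseteq> A \<or> X \<inter> A = {}" if "strong w t X" "X \<subseteq> V" for X
        using less.prems(3)[OF that] sep[OF that] AB by blast
    qed (use card pos fin A in auto)
    then obtain DA where DA: "cut_system w t V A DA" ..
    have "\<exists>D. cut_system w t V B D"
    proof (rule less.hyps)
      show "X \<subseteq> B \<or> X \<inter> B = {}" if "strong w t X" "X \<subseteq> V" for X
        using less.prems(3)[OF that] sep[OF that] AB by blast
    qed (use card pos fin AB in auto)
    then obtain DB where DB: "cut_system w t V B DB" ..
    let ?D = "insert (A, B) (DA \<union> DB)"
    have "cut_system w t V Z ?D"
      unfolding cut_system_def
    proof (intro conjI allI impI)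
      show "finite ?D" using DA DB by (simp add: cut_system_card)
      have "card ?D \<le> Suc (card (DA \<union> DB))" by (rule card_insert_le_m1) auto
      also have "card (DA \<union> DB) \<le> card DA + card DB" by (rule card_Un_le)
      finally show "card ?D < card Z" using DA DB[THEN cut_system_card(2)] DA[THEN cut_system_card(2)] card by linarith
    next
      fix A' B' assume "(A', B') \<in> ?D"
      then consider "A' = A \<and> B' = B" | "(A', B') \<in> DA" | "(A', B') \<in> DB" by auto
      note cases = this
      show "A' \<subseteq> Z" using cases cut_systemD[OF DA, of A' B'] cut_systemD[OF DB, of A' B'] A(1) AB(4)
        by cases auto
      show "B' \<subseteq> Z" using cases cut_systemD[OF DA, of A' B'] cut_systemD[OF DB, of A' B'] A(1) AB(4)
        by cases auto
      show "cw w A' B' < t" using cases cut_systemD[OF DA, of A' B'] cut_systemD[OF DB, of A' B'] A(4)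
        by cases (auto simp: B_def)
      fix X assume X: "strong w t X" "X \<subseteq> V"
      show "X \<inter> A' = {} \<or> X \<inter> B' = {}"
        using cases cut_system_strong[OF DA _ X, of A' B'] cut_system_strong[OF DB _ X, of A' B'] sep[OF X]
        by cases auto
    next
      fix Y assume Y: "Y \<subseteq> Z" "Y \<noteq> {}"
      consider "Y \<inter> A \<noteq> {} \<and> Y \<inter> B \<noteq> {}" | "Y \<subseteq> A" | "Y \<subseteq> B" using Y AB by blast
      then show "(\<exists>X\<subseteq>Z. strong w t X \<and> Y \<subseteq> X) \<or>
         (\<exists>A B. (A, B) \<in> ?D \<and> Y \<subseteq> A \<union> B \<and> Y \<inter> A \<noteq> {} \<and> Y \<inter> B \<noteq> {})"
      proof cases
        case 1
        have "(A, B) \<in> ?D" "Y \<subseteq> A \<union> B" using Y AB by auto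
        with 1 show ?thesis by blast
      next
        case 2
        from DA this Y(2) show ?thesis
        proof (cases rule: cut_system_cover)
          case (strong X)
          then show ?thesis using A(1) by (meson subset_trans)
        next
          case (cut A' B')
          then have "(A', B') \<in> ?D" by simp
          with cut show ?thesis by blast
        qed
      next
        case 3
        from DB this Y(2) show ?thesis
        proof (cases rule: cut_system_cover)
          case (strong X)
          then show ?thesis using AB(4) by (meson subset_trans)
        next
          case (cut A' B')
          then have "(A', B') \<in> ?D" by simp
          with cut show ?thesis by blast
        qed
      qed
    qed
    then show ?thesis ..
  qed
qed

text \<open>Every crossing pair is counted in both orders.\<close>

definition crossing :: "('a \<Rightarrow> 'a \<Rightarrow> real) \<Rightarrow> 'a set \<Rightarrow> ('a \<Rightarrow> 'b) \<Rightarrow> real" where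
  "crossing h M Q = (\<Sum>a\<in>M. \<Sum>b\<in>M. if Q a \<noteq> Q b then h a b else 0)"

text \<open>Splitting along cuts lighter than \<open>t\<close> ends after at most
  \<open>card M - 1\<close> splits, and each split adds less than \<open>2 * t\<close> to the
  crossing weight, both orders counted. Parts are named by elements of \<open>M\<close>, so the
  names can serve again as labels of contracted vertices; that labels of \<open>A\<close> stay in
  \<open>A\<close> keeps the two halves apart.\<close>

lemma strong_partition_exists:
  assumes "finite M" "M \<noteq> {}" and h: "\<And>a b. h a b = h b a" and t: "0 \<le> t"
  shows "\<exists>Q. Q ` M \<subseteq> M \<and> (\<forall>b. strong h t {a\<in>M. Q a = b}) \<and> crossing h M Q \<le> 2 * t * (real (card M) - 1)"
  using assms(1,2)
proof (induction "card M" arbitrary: M rule: less_induct)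
  case (less M)
  show ?case
  proof (cases "strong h t M")
    case True
    obtain c where c: "c \<in> M" using less.prems by auto
    have "{a\<in>M. c = b} = (if c = b then M else {})" for b by auto
    moreover have "strong h t {}" by (simp add: strong_def)
    moreover have "crossing h M (\<lambda>_. c) \<le> 2 * t * (real (card M) - 1)"
      using t less.prems by (auto simp: crossing_def Suc_le_eq card_gt_0_iff)
    ultimately show ?thesis using c True by (intro exI[of _ "\<lambda>_. c"]) auto
  next
    case False
    then obtain A where A: "A \<subseteq> M" "A \<noteq> {}" "A \<noteq> M" "cw h A (M - A) < t"
      unfolding strong_def by (auto simp: not_le)
    define B where "B = M - A"
    have AB: "A \<union> B = M" "A \<inter> B = {}" "B \<noteq> {}" "B \<subseteq> M" using A by (auto simp: B_def)
    have fin: "finite A" "finite B" using less.prems(1) A AB by (auto intro: finite_subset)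
    have card: "card M = card A + card B" using card_Un_disjoint[OF fin AB(2)] AB(1) by simp
    have pos: "card A > 0" "card B > 0" using fin A AB by (auto simp: card_gt_0_iff)
    obtain QA where QA: "QA ` A \<subseteq> A" "\<And>b. strong h t {a\<in>A. QA a = b}"
        "crossing h A QA \<le> 2 * t * (real (card A) - 1)"
      using less.hyps[of A] card pos fin A by auto
    obtain QB where QB: "QB ` B \<subseteq> B" "\<And>b. strong h t {a\<in>B. QB a = b}"
        "crossing h B QB \<le> 2 * t * (real (card B) - 1)"
      using less.hyps[of B] card pos fin AB by auto
    define Q where "Q a = (if a \<in> A then QA a else QB a)" for a
    have Q: "Q a = QA a" "QA a \<in> A" if "a \<in> A" for a using that QA(1) unfolding Q_def by auto
    have Q': "Q a = QB a" "QB a \<in> B" if "a \<in> B" for a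
    proof -
      have "a \<notin> A" using that by (simp add: B_def)
      then show "Q a = QB a" by (simp add: Q_def)
      show "QB a \<in> B" using that QB(1) by (rule_tac subsetD) auto
    qed
    have QM: "Q a \<in> M \<and> (Q a \<in> A \<longleftrightarrow> a \<in> A)" if "a \<in> M" for a
    proof (cases "a \<in> A")
      case True
      then show ?thesis using Q[OF True] A(1) by auto
    next
      case False
      then have "a \<in> B" using that by (simp add: B_def)
      then show ?thesis using Q'[of a] False by (auto simp: B_def)
    qed
    then have "Q ` M \<subseteq> M" by blast
    moreover have "strong h t {a\<in>M. Q a = b}" for b
    proof (cases "b \<in> A")
      case True
      then have "{a\<in>M. Q a = b} = {a\<in>A. QA a = b}" using Q(1) QM A(1) by force
      then show ?thesis using QA by simp
    next
      case False
      then have "{a\<in>M. Q a = b} = {a\<in>B. QB a = b}" using Q'(1) QM AB(4) by (force simp: B_def)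
      then show ?thesis using QB by simp
    qed
    moreover have "crossing h M Q \<le> 2 * t * (real (card M) - 1)"
    proof -
      have "crossing h M Q = (\<Sum>a\<in>A. \<Sum>b\<in>A. if Q a \<noteq> Q b then h a b else 0)
          + (\<Sum>a\<in>A. \<Sum>b\<in>B. if Q a \<noteq> Q b then h a b else 0)
          + ((\<Sum>a\<in>B. \<Sum>b\<in>A. if Q a \<noteq> Q b then h a b else 0)
          + (\<Sum>a\<in>B. \<Sum>b\<in>B. if Q a \<noteq> Q b then h a b else 0))"
        unfolding crossing_def AB(1)[symmetric]
        using fin AB(2) by (simp add: sum.union_disjoint sum.distrib)
      also have "(\<Sum>a\<in>A. \<Sum>b\<in>A. if Q a \<noteq> Q b then h a b else 0) = crossing h A QA"
        unfolding crossing_def by (intro sum.cong refl) (simp add: Q)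
      also have "(\<Sum>a\<in>B. \<Sum>b\<in>B. if Q a \<noteq> Q b then h a b else 0) = crossing h B QB"
        unfolding crossing_def by (intro sum.cong refl) (simp add: Q')
      also have "(\<Sum>a\<in>A. \<Sum>b\<in>B. if Q a \<noteq> Q b then h a b else 0) = cw h A B"
      proof -
        have "Q a \<noteq> Q b" if "a \<in> A" "b \<in> B" for a b
          using Q[OF that(1)] Q'[OF that(2)] AB(2) by auto
        then show ?thesis unfolding cw_def by (intro sum.cong refl) simp
      qed
      also have "(\<Sum>a\<in>B. \<Sum>b\<in>A. if Q a \<noteq> Q b then h a b else 0) = cw h B A"
      proof -
        have "Q a \<noteq> Q b" if "a \<in> B" "b \<in> A" for a b
          using Q[OF that(2)] Q'[OF that(1)] AB(2) by auto
        then show ?thesis unfolding cw_def by (intro sum.cong refl) simp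
      qed
      also have "cw h B A = cw h A B" using h by (rule cw_commute)
      finally show ?thesis using QA(3) QB(3) A(4) unfolding B_def[symmetric]
        by (simp add: card algebra_simps)
    qed
    ultimately show ?thesis by blast
  qed
qed

text \<open>\<open>k e\<close> is the integral over \<open>t > 0\<close> of the indicator of
  \<open>t \<le> k e\<close>, so it suffices to compare the sums over superlevel sets, which change
  only at values of \<open>k\<close>. The induction peels off the smallest value: it contributes a
  multiple of the full sum, and the remainder \<open>k - m\<close> takes fewer values.\<close>

lemma layer_cake_le:
  fixes k a b :: "'e \<Rightarrow> real"
  assumes "finite E" "\<And>e. e \<in> E \<Longrightarrow> 0 \<le> k e"
    and "\<And>t. t \<in> k ` E \<Longrightarrow> 0 < t \<Longrightarrow> (\<Sum>e\<in>{e\<in>E. t \<le> k e}. a e) \<le> (\<Sum>e\<in>{e\<in>E. t \<le> k e}. b e)"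
  shows "(\<Sum>e\<in>E. k e * a e) \<le> (\<Sum>e\<in>E. k e * b e)"
  using assms
proof (induction "card (k ` E)" arbitrary: E k rule: less_induct)
  case (less E k)
  show ?case
  proof (cases "E = {}")
    case False
    define m where "m = Min (k ` E)"
    have mk: "m \<le> k e" if "e \<in> E" for e using that less.prems(1) by (simp add: m_def)
    have mE: "m \<in> k ` E" unfolding m_def using less.prems(1) False by (intro Min_in) auto
    define E' where "E' = {e\<in>E. m < k e}"
    have E'E: "E' \<subseteq> E" by (auto simp: E'_def)
    have "m \<ge> 0" using mE less.prems(2) by auto
    have inner: "(\<Sum>e\<in>E'. (k e - m) * a e) \<le> (\<Sum>e\<in>E'. (k e - m) * b e)"
    proof (rule less.hyps)
      have "(\<lambda>e. k e - m) ` E' = (\<lambda>x. x - m) ` (k ` E')" by auto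
      also have "card \<dots> \<le> card (k ` E')" using less.prems(1) by (intro card_image_le) (auto simp: E'_def)
      also have "\<dots> < card (k ` E)"
      proof (rule psubset_card_mono)
        have "m \<notin> k ` E'" by (auto simp: E'_def)
        then show "k ` E' \<subset> k ` E" using mE E'E by blast
      qed (use less.prems(1) in simp)
      finally show "card ((\<lambda>e. k e - m) ` E') < card (k ` E)" .
      show "finite E'" using less.prems(1) by (simp add: E'_def)
      show "0 \<le> k e - m" if "e \<in> E'" for e using that by (simp add: E'_def)
      show "(\<Sum>e\<in>{e\<in>E'. t \<le> k e - m}. a e) \<le> (\<Sum>e\<in>{e\<in>E'. t \<le> k e - m}. b e)"
        if "t \<in> (\<lambda>e. k e - m) ` E'" "0 < t" for t
      proof -
        have "{e\<in>E'. t \<le> k e - m} = {e\<in>E. t + m \<le> k e}" using that(2) by (auto simp: E'_def)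
        moreover have "t + m \<in> k ` E" using that(1) E'E by auto
        ultimately show ?thesis using less.prems(3)[of "t + m"] that(2) \<open>m \<ge> 0\<close> by simp
      qed
    qed
    have outer: "m * (\<Sum>e\<in>E. a e) \<le> m * (\<Sum>e\<in>E. b e)"
    proof (cases "m = 0")
      case False
      have "{e\<in>E. m \<le> k e} = E" using mk by auto
      then show ?thesis using less.prems(3)[OF mE] \<open>m \<ge> 0\<close> False by (simp add: mult_left_mono)
    qed simp
    have split: "(\<Sum>e\<in>E. k e * x e) = m * (\<Sum>e\<in>E. x e) + (\<Sum>e\<in>E'. (k e - m) * x e)" for x :: "'e \<Rightarrow> real"
    proof -
      have "(\<Sum>e\<in>E'. (k e - m) * x e) = (\<Sum>e\<in>E. (k e - m) * x e)"
        using less.prems(1) mk by (intro sum.mono_neutral_left) (auto simp: E'_def less_le)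
      then show ?thesis by (simp add: sum_distrib_left algebra_simps flip: sum.distrib)
    qed
    show ?thesis unfolding split using inner outer by simp
  qed simp
qed

section \<open>Strength of edges\<close>

definition mincut :: "('a \<Rightarrow> 'a \<Rightarrow> real) \<Rightarrow> 'a set \<Rightarrow> real" where
  "mincut w X = Min ((\<lambda>A. cw w A (X - A)) ` cuts X)"

text \<open>The edge strength of Benczur and Karger: the best connectivity of an induced subgraph
  that contains both endpoints. It is meaningful for distinct \<open>u\<close>, \<open>v\<close> in
  \<open>V\<close>; on the diagonal the singleton brings in the minimum of an empty set.\<close>

definition strength :: "('a \<Rightarrow> 'a \<Rightarrow> real) \<Rightarrow> 'a set \<Rightarrow> 'a \<Rightarrow> 'a \<Rightarrow> real" where
  "strength w V u v = Max (mincut w ` {X. X \<subseteq> V \<and> u \<in> X \<and> v \<in> X})"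

lemma strong_iff_mincut:
  assumes "finite X" "u \<in> X" "v \<in> X" "u \<noteq> v"
  shows "strong w t X \<longleftrightarrow> t \<le> mincut w X"
proof -
  have "cuts X \<noteq> {}" using assms by (auto simp: cuts_def intro!: exI[of _ "{u}"])
  then have "t \<le> mincut w X \<longleftrightarrow> (\<forall>A\<in>cuts X. t \<le> cw w A (X - A))"
    unfolding mincut_def using assms(1) by (subst Min_ge_iff) auto
  then show ?thesis by (simp add: strong_def cuts_def)
qed

lemma le_strength_iff:
  assumes V: "finite V" and uv: "u \<in> V" "v \<in> V" "u \<noteq> v"
  shows "t \<le> strength w V u v \<longleftrightarrow> (\<exists>X\<subseteq>V. u \<in> X \<and> v \<in> X \<and> strong w t X)"
proof -
  have fin: "finite {X. X \<subseteq> V \<and> u \<in> X \<and> v \<in> X}"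
    by (rule finite_subset[of _ "Pow V"]) (use V in auto)
  have ne: "{X. X \<subseteq> V \<and> u \<in> X \<and> v \<in> X} \<noteq> {}" using uv by auto
  have "t \<le> strength w V u v \<longleftrightarrow> (\<exists>X. X \<subseteq> V \<and> u \<in> X \<and> v \<in> X \<and> t \<le> mincut w X)"
    unfolding strength_def using fin ne by (subst Max_ge_iff) auto
  also have "\<dots> \<longleftrightarrow> (\<exists>X\<subseteq>V. u \<in> X \<and> v \<in> X \<and> strong w t X)"
    using strong_iff_mincut[OF _ _ _ uv(3)] finite_subset[OF _ V] by metis
  finally show ?thesis .
qed

lemma strength_commute: "strength w V u v = strength w V v u"
proof -
  have "{X. X \<subseteq> V \<and> u \<in> X \<and> v \<in> X} = {X. X \<subseteq> V \<and> v \<in> X \<and> u \<in> X}" by auto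
  then show ?thesis by (simp add: strength_def)
qed

text \<open>Two strong sets that share \<open>y\<close> have a strong union. Hence the pairs of
  strength at least \<open>t\<close> form an equivalence relation on \<open>V\<close>, up to the
  diagonal.\<close>

lemma strength_trans:
  assumes V: "finite V" and w: "\<And>i j. 0 \<le> w i j"
    and x: "x \<in> V" "y \<in> V" "z \<in> V" "x \<noteq> y" "y \<noteq> z" "x \<noteq> z"
    and t: "t \<le> strength w V x y" "t \<le> strength w V y z"
  shows "t \<le> strength w V x z"
proof -
  obtain X where X: "X \<subseteq> V" "x \<in> X" "y \<in> X" "strong w t X"
    using t(1) le_strength_iff[OF V x(1,2,4)] by metis
  obtain Y where Y: "Y \<subseteq> V" "y \<in> Y" "z \<in> Y" "strong w t Y"
    using t(2) le_strength_iff[OF V x(2,3,5)] by metis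
  have "strong w t (X \<union> Y)"
    by (rule strong_Un[where w = w, OF w X(4) Y(4) X(3) Y(2)]) (use V X Y finite_subset in blast)+
  moreover have "X \<union> Y \<subseteq> V" "x \<in> X \<union> Y" "z \<in> X \<union> Y" using X Y by auto
  ultimately show ?thesis using le_strength_iff[OF V x(1,3,6)] by metis
qed

text \<open>The two endpoints alone form a set of this connectivity. In particular, strengths of
  pairs in \<open>V\<close> are nonnegative for nonnegative weights, and a pair of strength zero
  carries no weight.\<close>

lemma strength_ge_weight:
  assumes V: "finite V" and sym: "\<And>i j. w i j = w j i" and uv: "u \<in> V" "v \<in> V" "u \<noteq> v"
  shows "w u v \<le> strength w V u v"
proof -
  have "strong w (w u v) {u, v}"
    unfolding strong_def
  proof (intro allI impI)
    fix A assume "A \<subseteq> {u, v} \<and> A \<noteq> {} \<and> A \<noteq> {u, v}"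
    then have "A = {u} \<or> A = {v}" by auto
    then show "w u v \<le> cw w A ({u, v} - A)"
    proof
      assume "A = {u}"
      moreover have "{u, v} - {u} = {v}" using uv(3) by auto
      ultimately show ?thesis by (simp add: cw_def)
    next
      assume "A = {v}"
      moreover have "{u, v} - {v} = {u}" using uv(3) by auto
      ultimately show ?thesis using sym[of u v] by (simp add: cw_def)
    qed
  qed
  then show ?thesis unfolding le_strength_iff[OF V uv] using uv by (intro exI[of _ "{u, v}"]) simp
qed

text \<open>The \<open>t\<close>-strong component of \<open>v\<close>. The disjunct
  \<open>x = v\<close> stands in for the diagonal, where strength has no meaning.\<close>

definition level_class :: "('a \<Rightarrow> 'a \<Rightarrow> real) \<Rightarrow> 'a set \<Rightarrow> real \<Rightarrow> 'a \<Rightarrow> 'a set" where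
  "level_class w V t v = {x\<in>V. x = v \<or> t \<le> strength w V v x}"

lemma level_class_pair:
  assumes V: "finite V" and w: "\<And>i j. 0 \<le> w i j" and v: "v \<in> V"
    and xy: "x \<in> level_class w V t v" "y \<in> V" "x \<noteq> y"
  shows "y \<in> level_class w V t v \<longleftrightarrow> t \<le> strength w V x y"
proof -
  have x: "x \<in> V" "x = v \<or> t \<le> strength w V v x" using xy(1) by (auto simp: level_class_def)
  show ?thesis
  proof (cases "x = v \<or> y = v")
    case True
    then show ?thesis
      using x xy(2,3) strength_commute[of w V x y] by (auto simp: level_class_def)
  next
    case False
    have 1: "t \<le> strength w V v x" using x False by simp
    have "t \<le> strength w V v y" if "t \<le> strength w V x y"
      by (rule strength_trans[where w = w, OF V w v x(1) xy(2) _ xy(3) _ 1 that]) (use False in auto)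
    moreover have "t \<le> strength w V x y" if "t \<le> strength w V v y"
      by (rule strength_trans[where w = w, OF V w x(1) v xy(2) _ _ xy(3) _ that])
        (use False 1 strength_commute[of w V v x] in auto)
    ultimately show ?thesis using False xy(2) by (auto simp: level_class_def)
  qed
qed

text \<open>The absolute value only matters for pairs that do not lie in the vertex set, whose strength is
  junk, and keeps the scaled weights nonnegative there.\<close>

definition scaled :: "('a \<Rightarrow> 'a \<Rightarrow> real) \<Rightarrow> 'a set \<Rightarrow> 'a \<Rightarrow> 'a \<Rightarrow> real" where
  "scaled w V u v = w u v / \<bar>strength w V u v\<bar>"

text \<open>Among the pairs separated by a cut of the class take one of maximal strength
  \<open>k\<close>. A \<open>k\<close>-strong set \<open>X\<close> witnessing it is cut as well and
  contributes weight at least \<open>k\<close>; all these pairs have strength at most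
  \<open>k\<close>, so after division they still contribute at least 1. Without maximality the
  divisors could exceed the connectivity of the witness.\<close>

lemma strong_scaled_level_class:
  assumes V: "finite V" and w: "\<And>i j. 0 \<le> w i j" and v: "v \<in> V" and t: "0 < t"
  shows "strong (scaled w V) 1 (level_class w V t v)"
  unfolding strong_def
proof (intro allI impI)
  define C where "C = level_class w V t v"
  fix A assume "A \<subseteq> level_class w V t v \<and> A \<noteq> {} \<and> A \<noteq> level_class w V t v"
  then have A: "A \<subseteq> C" "A \<noteq> {}" "A \<noteq> C" by (auto simp: C_def)
  have CV: "C \<subseteq> V" by (auto simp: C_def level_class_def)
  then have finC: "finite C" using V finite_subset by blast
  have pair: "y \<in> C \<longleftrightarrow> t \<le> strength w V x y" if "x \<in> C" "y \<in> V" "x \<noteq> y" for x y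
    using that unfolding C_def by (intro level_class_pair[OF V] w v)
  let ?k = "\<lambda>(x, y). strength w V x y"
  have ne: "A \<times> (C - A) \<noteq> {}" using A by auto
  have fin: "finite (A \<times> (C - A))" using finC A finite_subset by blast
  have "Max (?k ` (A \<times> (C - A))) \<in> ?k ` (A \<times> (C - A))" using fin ne by (intro Max_in) auto
  then obtain p where p: "p \<in> A \<times> (C - A)" "Max (?k ` (A \<times> (C - A))) = ?k p" by auto
  obtain x y where xy: "p = (x, y)" "x \<in> A" "y \<in> C - A" using p(1) by auto
  define k where "k = strength w V x y"
  have kmax: "strength w V a b \<le> k" if "a \<in> A" "b \<in> C - A" for a b
  proof -
    have "?k (a, b) \<le> Max (?k ` (A \<times> (C - A)))" using fin that by (intro Max_ge) auto
    then show ?thesis using p(2) xy(1) by (simp add: k_def)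
  qed
  have xyV: "x \<in> V" "y \<in> V" "x \<noteq> y" "x \<in> C" using xy A CV by auto
  have kt: "t \<le> k" using pair[of x y] xy xyV by (auto simp: k_def)
  obtain X where X: "X \<subseteq> V" "x \<in> X" "y \<in> X" "strong w k X"
    using le_strength_iff[OF V xyV(1-3), of k w] unfolding k_def by auto
  \<comment> \<open>\<open>X\<close> also witnesses strength at least \<open>k\<close>, hence at
    least \<open>t\<close>, between \<open>x\<close> and each of its other members.\<close>
  have XC: "X \<subseteq> C"
  proof
    fix z assume z: "z \<in> X"
    show "z \<in> C"
    proof (cases "z = x")
      case False
      then have "k \<le> strength w V x z"
        unfolding k_def [symmetric]
        by (subst le_strength_iff[OF V xyV(1)]) (use X z False in \<open>auto intro!: exI[of _ X]\<close>)
      then show ?thesis using pair[of x z] xyV(4) X(1) z False kt by auto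
    qed (use xyV in simp)
  qed
  have kpos: "0 < k" using kt t by simp
  have "k \<le> cw w (X \<inter> A) (X - A)" using X xy by (intro strong_cut[where x = x and y = y]) auto
  then have "1 \<le> cw w (X \<inter> A) (X - A) / k" using kpos by simp
  also have "\<dots> = (\<Sum>a\<in>X \<inter> A. \<Sum>b\<in>X - A. w a b / k)" by (simp add: cw_def sum_divide_distrib)
  also have "\<dots> \<le> cw (scaled w V) (X \<inter> A) (X - A)"
    unfolding cw_def
  proof (intro sum_mono)
    fix a b assume ab: "a \<in> X \<inter> A" "b \<in> X - A"
    then have "strength w V a b \<le> k" using kmax XC by blast
    moreover have "t \<le> strength w V a b" using pair[of a b] ab XC CV by blast
    ultimately show "w a b / k \<le> scaled w V a b"
      using t w[of a b] unfolding scaled_def by (intro divide_left_mono) (auto simp: zero_less_mult_iff)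
  qed
  also have "\<dots> \<le> cw (scaled w V) A (C - A)"
    using XC finC A(1) w finite_subset[OF A(1) finC] by (intro cw_mono) (auto simp: scaled_def)
  finally show "1 \<le> cw (scaled w V) A (level_class w V t v - A)" by (simp add: C_def)
qed

section \<open>Query algorithms and edge sampling\<close>

primrec bind_alg :: "'a query_alg \<Rightarrow> ('a \<Rightarrow> 'b query_alg) \<Rightarrow> 'b query_alg" where
  "bind_alg (Return r) f = f r"
| "bind_alg (Query S k) f = Query S (\<lambda>x. bind_alg (k x) f)"
| "bind_alg (Sample p k) f = Sample p (\<lambda>x. bind_alg (k x) f)"

lemma run_bind_alg:
  "run F (bind_alg a f) = bind_pmf (run F a) (\<lambda>(x, q). map_pmf (\<lambda>(y, q'). (y, q + q')) (run F (f x)))"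
proof (induction a)
  case (Return r)
  show ?case by (simp add: bind_return_pmf case_prod_unfold)
next
  case (Query S k)
  show ?case
    by (simp add: Query map_bind_pmf bind_map_pmf case_prod_unfold pmf.map_comp o_def)
next
  case (Sample p k)
  show ?case by (simp add: Sample bind_assoc_pmf)
qed

lemma queries_within_bind_alg:
  "queries_within V a \<Longrightarrow> (\<And>x. queries_within V (f x)) \<Longrightarrow> queries_within V (bind_alg a f)"
  by (induction a) auto

definition out :: "(nat set \<Rightarrow> real) \<Rightarrow> 'r query_alg \<Rightarrow> 'r pmf" where
  "out F a = map_pmf fst (run F a)"

lemma out_Return [simp]: "out F (Return r) = return_pmf r"
  by (simp add: out_def)

lemma out_Sample [simp]: "out F (Sample p k) = bind_pmf p (\<lambda>x. out F (k x))"
  by (simp add: out_def map_bind_pmf)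

lemma out_bind_alg: "out F (bind_alg a f) = bind_pmf (out F a) (\<lambda>x. out F (f x))"
  by (simp add: out_def run_bind_alg map_bind_pmf bind_map_pmf case_prod_unfold pmf.map_comp o_def)

text \<open>A statement about every possible run, with property and cost joined so that the cost of
  a continuation may depend on what the first part has established.\<close>

definition outcome :: "(nat set \<Rightarrow> real) \<Rightarrow> 'r query_alg \<Rightarrow> ('r \<Rightarrow> bool) \<Rightarrow> real \<Rightarrow> bool" where
  "outcome F a P c \<longleftrightarrow> (\<forall>(x, q) \<in> set_pmf (run F a). P x \<and> real q \<le> c)"

lemma outcomeI: "(\<And>x q. (x, q) \<in> set_pmf (run F a) \<Longrightarrow> P x \<and> real q \<le> c) \<Longrightarrow> outcome F a P c"
  by (auto simp: outcome_def)

lemma outcomeD: "outcome F a P c \<Longrightarrow> (x, q) \<in> set_pmf (run F a) \<Longrightarrow> P x \<and> real q \<le> c"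
  by (auto simp: outcome_def)

lemma outcome_set_out: "outcome F a P c \<Longrightarrow> x \<in> set_pmf (out F a) \<Longrightarrow> P x"
  by (auto simp: outcome_def out_def)

lemma outcome_Return: "P r \<Longrightarrow> 0 \<le> c \<Longrightarrow> outcome F (Return r) P c"
  by (auto simp: outcome_def)

lemma outcome_Sample: "(\<And>x. x \<in> set_pmf p \<Longrightarrow> outcome F (k x) P c) \<Longrightarrow> outcome F (Sample p k) P c"
  by (auto simp: outcome_def)

lemma outcome_bind_alg:
  assumes "outcome F a P c" "\<And>x. P x \<Longrightarrow> x \<in> set_pmf (out F a) \<Longrightarrow> outcome F (f x) R c'" "c + c' \<le> c''"
  shows "outcome F (bind_alg a f) R c''"
proof (rule outcomeI)
  fix y q assume "(y, q) \<in> set_pmf (run F (bind_alg a f))"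
  then obtain x q1 q2 where 1: "(x, q1) \<in> set_pmf (run F a)" "(y, q2) \<in> set_pmf (run F (f x))" "q = q1 + q2"
    by (fastforce simp: run_bind_alg)
  have "x \<in> set_pmf (out F a)" unfolding out_def using imageI[OF 1(1), of fst] by simp
  moreover have "P x \<and> real q1 \<le> c" using outcomeD[OF assms(1) 1(1)] .
  moreover from calculation have "R y \<and> real q2 \<le> c'" using outcomeD[OF assms(2) 1(2)] by simp
  ultimately show "R y \<and> real q \<le> c''" using assms(3) 1(3) by simp
qed

lemma outcome_weaken:
  "outcome F a P c \<Longrightarrow> (\<And>x. P x \<Longrightarrow> R x) \<Longrightarrow> c \<le> c' \<Longrightarrow> outcome F a R c'"
  by (force simp: outcome_def)

text \<open>Intersecting with \<open>V\<close> makes every such algorithm well-formed whatever sets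
  it is given; answers are filed under the original set.\<close>

primrec ask_all :: "nat set \<Rightarrow> nat set list \<Rightarrow> (nat set \<Rightarrow> real) query_alg" where
  "ask_all V [] = Return (\<lambda>_. 0)"
| "ask_all V (S # Ss) = Query (S \<inter> V) (\<lambda>x. bind_alg (ask_all V Ss) (\<lambda>T. Return (T(S := x))))"

lemma queries_within_ask_all: "queries_within V (ask_all V Ss)"
  by (induction Ss) (auto intro: queries_within_bind_alg)

lemma run_ask_all:
  "run F (ask_all V Ss) = return_pmf (\<lambda>S. if S \<in> set Ss then F (S \<inter> V) else 0, length Ss)"
  by (induction Ss) (auto simp: run_bind_alg bind_return_pmf fun_eq_iff)

lemma out_ask_all: "out F (ask_all V Ss) = return_pmf (\<lambda>S. if S \<in> set Ss then F (S \<inter> V) else 0)"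
  by (simp add: out_def run_ask_all)

lemma outcome_ask_all:
  "real (length Ss) \<le> c \<Longrightarrow> outcome F (ask_all V Ss) (\<lambda>T. T = (\<lambda>S. if S \<in> set Ss then F (S \<inter> V) else 0)) c"
  by (simp add: outcome_def run_ask_all)

primrec repeat_alg :: "nat \<Rightarrow> 'a query_alg \<Rightarrow> 'a list query_alg" where
  "repeat_alg 0 a = Return []"
| "repeat_alg (Suc N) a = bind_alg a (\<lambda>x. bind_alg (repeat_alg N a) (\<lambda>xs. Return (x # xs)))"

lemma queries_within_repeat_alg: "queries_within V a \<Longrightarrow> queries_within V (repeat_alg N a)"
  by (induction N) (auto intro!: queries_within_bind_alg)

lemma out_repeat_alg: "out F (repeat_alg N a) = replicate_pmf N (out F a)"
  by (induction N) (simp_all add: out_bind_alg)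

lemma outcome_repeat_alg:
  assumes "outcome F a P c"
  shows "outcome F (repeat_alg N a) (\<lambda>xs. length xs = N \<and> (\<forall>x\<in>set xs. P x)) (real N * c)"
proof (induction N)
  case (Suc N)
  show ?case
    unfolding repeat_alg.simps
    by (rule outcome_bind_alg[OF assms], rule outcome_bind_alg[OF Suc], rule outcome_Return[where c = 0])
      (auto simp: algebra_simps)
qed (auto intro: outcome_Return)

text \<open>The decision tree must be defined for arbitrary real answers, also those no graph would
  give; the point mass at 0 covers these and the case of total weight zero.\<close>

definition norm_pmf :: "nat set \<Rightarrow> (nat \<Rightarrow> real) \<Rightarrow> nat pmf" where
  "norm_pmf I f = (if finite I \<and> (\<forall>i\<in>I. 0 \<le> f i) \<and> 0 < sum f I
     then embed_pmf (\<lambda>i. if i \<in> I then f i / sum f I else 0) else return_pmf 0)"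

lemma pmf_norm_pmf:
  assumes "finite I" "\<And>i. i \<in> I \<Longrightarrow> 0 \<le> f i" "0 < sum f I"
  shows "pmf (norm_pmf I f) i = (if i \<in> I then f i / sum f I else 0)"
proof -
  have "pmf (embed_pmf (\<lambda>i. if i \<in> I then f i / sum f I else 0)) i = (if i \<in> I then f i / sum f I else 0)"
  proof (rule pmf_embed_pmf)
    show "0 \<le> (if i \<in> I then f i / sum f I else 0)" for i using assms by auto
    have "(\<integral>\<^sup>+i. ennreal (if i \<in> I then f i / sum f I else 0) \<partial>count_space UNIV)
        = (\<Sum>i\<in>I. ennreal (f i / sum f I))"
      using assms by (subst nn_integral_count_space'[of I]) auto
    also have "\<dots> = ennreal (\<Sum>i\<in>I. f i / sum f I)"
      using assms by (intro sum_ennreal) auto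
    also have "(\<Sum>i\<in>I. f i / sum f I) = 1" using assms(3) by (simp flip: sum_divide_distrib)
    finally show "(\<integral>\<^sup>+i. ennreal (if i \<in> I then f i / sum f I else 0) \<partial>count_space UNIV) = 1" by simp
  qed
  then show ?thesis using assms by (simp add: norm_pmf_def)
qed

lemma pmf_bind_map_Pair:
  "pmf (bind_pmf p (\<lambda>x. map_pmf (Pair x) (q x))) (x, y) = pmf p x * pmf (q x) y"
proof -
  have 0: "pmf (map_pmf (Pair x') (q x')) (x, y) = (if x' = x then pmf (q x) y else 0)" for x'
  proof (cases "x' = x")
    case True
    then show ?thesis by (simp add: pmf_map_inj' inj_on_def)
  next
    case False
    then have "(x, y) \<notin> set_pmf (map_pmf (Pair x') (q x'))" by auto
    then show ?thesis using False by (simp add: pmf_eq_0_set_pmf)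
  qed
  have "pmf (bind_pmf p (\<lambda>x. map_pmf (Pair x) (q x))) (x, y) = (\<integral>x'. (if x' = x then pmf (q x) y else 0) \<partial>measure_pmf p)"
    unfolding pmf_bind 0 ..
  also have "\<dots> = (\<Sum>x'\<in>{x}. (if x' = x then pmf (q x) y else 0) * pmf p x')"
    by (rule integral_measure_pmf_real) (auto split: if_splits)
  finally show ?thesis by (simp add: mult.commute)
qed

section \<open>Drawing an edge with cut queries\<close>

definition cut_between :: "(nat set \<Rightarrow> real) \<Rightarrow> nat set \<Rightarrow> nat set \<Rightarrow> real" where
  "cut_between T A B = (T A + T B - T (A \<union> B)) / 2"

text \<open>Bits are decided from the highest to the lowest: at stage \<open>Suc i\<close> the
  candidates split on bit \<open>i\<close>, and adding \<open>j\<close> selects its parity. The five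
  queries yield the weight from either half to \<open>B\<close>. At stage 0 one candidate is left
  and the choice is forced.\<close>

primrec sample_endpoint :: "nat set \<Rightarrow> nat \<Rightarrow> nat set \<Rightarrow> nat set \<Rightarrow> nat query_alg" where
  "sample_endpoint V 0 A B = Return (SOME x. x \<in> A)"
| "sample_endpoint V (Suc i) A B =
    bind_alg (ask_all V [{x\<in>A. even (x div 2 ^ i)}, {x\<in>A. even (x div 2 ^ i)} \<union> B,
        {x\<in>A. odd (x div 2 ^ i)}, {x\<in>A. odd (x div 2 ^ i)} \<union> B, B])
      (\<lambda>T. Sample (norm_pmf {0, 1} (\<lambda>j. cut_between T {x\<in>A. even (x div 2 ^ i + j)} B))
        (\<lambda>j. sample_endpoint V i {x\<in>A. even (x div 2 ^ i + j)} B))"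

definition sample_edge ::
  "nat set \<Rightarrow> nat \<Rightarrow> nat set \<Rightarrow> (nat \<Rightarrow> nat set) \<Rightarrow> (nat \<Rightarrow> nat set) \<Rightarrow> (nat \<Rightarrow> real) \<Rightarrow> (nat \<times> nat \<times> nat) query_alg" where
  "sample_edge V b I A B x =
    Sample (norm_pmf I x) (\<lambda>i. bind_alg (sample_endpoint V b (A i) (B i))
      (\<lambda>u. bind_alg (sample_endpoint V b (B i) {u}) (\<lambda>v. Return (i, u, v))))"

lemma queries_within_sample_endpoint: "queries_within V (sample_endpoint V i A B)"
  by (induction i arbitrary: A) (auto intro!: queries_within_bind_alg queries_within_ask_all simp del: ask_all.simps)

lemma queries_within_sample_edge: "queries_within V (sample_edge V b I A B x)"
  unfolding sample_edge_def by (auto intro!: queries_within_bind_alg queries_within_sample_endpoint)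

lemma outcome_sample_endpoint: "outcome F (sample_endpoint V i A B) (\<lambda>_. True) (5 * real i)"
proof (induction i arbitrary: A)
  case (Suc i)
  show ?case
    unfolding sample_endpoint.simps
    by (rule outcome_bind_alg[OF outcome_ask_all[where c = 5]], simp, rule outcome_Sample, rule Suc) simp
qed (auto intro: outcome_Return)

lemma outcome_sample_edge: "outcome F (sample_edge V b I A B x) (\<lambda>_. True) (10 * real b)"
  unfolding sample_edge_def
  by (rule outcome_Sample, rule outcome_bind_alg[OF outcome_sample_endpoint],
      rule outcome_bind_alg[OF outcome_sample_endpoint], rule outcome_Return[where c = 0]) auto

locale query_graph =
  fixes n :: nat and G :: wgraph
  assumes wgraph: "wgraph_on n G"
begin

definition V :: "nat set" where "V = {1..n}"
abbreviation "F \<equiv> cut_fun n G"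

lemma G_commute: "G i j = G j i" and G_nonneg: "0 \<le> G i j" and G_irrefl [simp]: "G i i = 0"
  and G_support: "G i j \<noteq> 0 \<Longrightarrow> i \<in> V \<and> j \<in> V"
  using wgraph unfolding wgraph_on_def V_def by blast+

lemma finite_V [simp]: "finite V" and card_V [simp]: "card V = n"
  by (simp_all add: V_def)

lemma finite_subset_V: "A \<subseteq> V \<Longrightarrow> finite A"
  by (rule finite_subset) auto

lemma F_eq_cw: "F S = cw G S (V - S)"
  by (simp add: cut_fun_def cw_def V_def)

lemma cut_between_eq_cw:
  assumes "A \<subseteq> V" "B \<subseteq> V" "A \<inter> B = {}" "T A = F A" "T B = F B" "T (A \<union> B) = F (A \<union> B)"
  shows "cut_between T A B = cw G A B"
proof -
  define R where "R = V - (A \<union> B)"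
  have fin: "finite A" "finite B" "finite R" using assms finite_subset_V by (auto simp: R_def)
  have "V - A = B \<union> R" "V - B = A \<union> R" "V - (A \<union> B) = R" using assms by (auto simp: R_def)
  moreover have "B \<inter> R = {}" "A \<inter> R = {}" by (auto simp: R_def)
  ultimately show ?thesis
    using fin assms cw_commute[of G B A, OF G_commute]
    by (simp add: cut_between_def F_eq_cw cw_Un_left cw_Un_right)
qed

text \<open>The probability of a half is its share of the weight to \<open>B\<close>, so the product
  along the digits telescopes. The injectivity hypothesis says that the remaining \<open>i\<close>
  bits still distinguish the candidates; fixing bit \<open>i\<close> passes it on to stage
  \<open>i\<close>.\<close>

lemma pmf_sample_endpoint:
  assumes "A \<subseteq> V" "B \<subseteq> V" "A \<inter> B = {}" "0 < cw G A B" "inj_on (\<lambda>x. x mod 2 ^ i) A"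
  shows "pmf (out F (sample_endpoint V i A B)) u = (if u \<in> A then cw G {u} B / cw G A B else 0)"
  using assms(1,3-5)
proof (induction i arbitrary: A)
  case 0
  have "A \<noteq> {}" using 0(3) by auto
  then obtain x where x: "x \<in> A" by blast
  then have "A = {x}" using 0(4) by (auto simp: inj_on_def)
  then show ?case using 0(3) by auto
next
  case (Suc i)
  define A' where "A' j = {x\<in>A. even (x div 2 ^ i + j)}" for j :: nat
  define T where "T S = (if S \<in> {A' 0, A' 0 \<union> B, A' 1, A' 1 \<union> B, B} then F (S \<inter> V) else 0)" for S
  have sub: "A' j \<subseteq> V" "A' j \<inter> B = {}" for j using Suc.prems by (auto simp: A'_def)
  have fin: "finite (A' j)" for j using sub finite_subset_V by blast
  have A: "A = A' 0 \<union> A' 1" "A' 0 \<inter> A' 1 = {}" by (auto simp: A'_def)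
  have cwA: "cw G A B = cw G (A' 0) B + cw G (A' 1) B"
    unfolding A(1) using fin fin A(2) by (rule cw_Un_left)
  have T: "cut_between T (A' j) B = cw G (A' j) B" if "j \<in> {0, 1}" for j
  proof (rule cut_between_eq_cw[OF sub(1) assms(2) sub(2)])
    have "A' j \<inter> V = A' j" "B \<inter> V = B" "(A' j \<union> B) \<inter> V = A' j \<union> B"
      using sub assms(2) by auto
    then show "T (A' j) = F (A' j)" "T B = F B" "T (A' j \<union> B) = F (A' j \<union> B)"
      using that by (auto simp: T_def)
  qed
  have nn: "0 \<le> cw G (A' j) B" for j using G_nonneg by (rule cw_nonneg)
  have "norm_pmf {0, 1} (\<lambda>j. cut_between T (A' j) B) = norm_pmf {0, 1} (\<lambda>j. cw G (A' j) B)"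
    unfolding norm_pmf_def by (simp add: T cong: if_cong)
  moreover have step: "sample_endpoint V (Suc i) A B =
      bind_alg (ask_all V [A' 0, A' 0 \<union> B, A' 1, A' 1 \<union> B, B])
        (\<lambda>T. Sample (norm_pmf {0, 1} (\<lambda>j. cut_between T (A' j) B)) (\<lambda>j. sample_endpoint V i (A' j) B))"
    by (simp add: A'_def del: ask_all.simps)
  moreover have ask: "out F (ask_all V [A' 0, A' 0 \<union> B, A' 1, A' 1 \<union> B, B]) = return_pmf T"
    unfolding out_ask_all T_def by simp
  ultimately have out: "out F (sample_endpoint V (Suc i) A B) =
      bind_pmf (norm_pmf {0, 1} (\<lambda>j. cw G (A' j) B)) (\<lambda>j. out F (sample_endpoint V i (A' j) B))"
    unfolding step out_bind_alg ask by (simp add: bind_return_pmf)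
  have pn: "pmf (norm_pmf {0, 1} (\<lambda>j. cw G (A' j) B)) j = (if j \<in> {0, 1} then cw G (A' j) B / cw G A B else 0)" for j
    using nn Suc.prems(3) by (subst pmf_norm_pmf) (auto simp: cwA)
  have IH: "pmf (out F (sample_endpoint V i (A' j) B)) u = (if u \<in> A' j then cw G {u} B / cw G (A' j) B else 0)"
    if "0 < cw G (A' j) B" for j
  proof (rule Suc.IH[OF sub that])
    show "inj_on (\<lambda>x. x mod 2 ^ i) (A' j)"
    proof (rule inj_onI)
      fix x y assume xy: "x \<in> A' j" "y \<in> A' j" "x mod 2 ^ i = y mod 2 ^ i"
      have "x div 2 ^ i mod 2 = y div 2 ^ i mod 2"
        using xy(1,2) by (auto simp: A'_def mod2_eq_if)
      then have "x mod 2 ^ Suc i = y mod 2 ^ Suc i"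
        using xy(3) mod_mult2_eq[of x "2 ^ i" 2] mod_mult2_eq[of y "2 ^ i" 2] by (simp add: mult.commute)
      then show "x = y" using Suc.prems(4) xy(1,2) by (auto simp: inj_on_def A'_def)
    qed
  qed
  have "pmf (out F (sample_endpoint V (Suc i) A B)) u =
      (\<Sum>j\<in>{0, 1}. pmf (out F (sample_endpoint V i (A' j) B)) u * pmf (norm_pmf {0, 1} (\<lambda>j. cw G (A' j) B)) j)"
    unfolding out pmf_bind
    by (rule integral_measure_pmf_real) (auto simp: set_pmf_iff pn simp del: One_nat_def split: if_splits)
  also have "\<dots> = (\<Sum>j\<in>{0, 1}. if u \<in> A' j then cw G {u} B / cw G A B else 0)"
  proof (rule sum.cong[OF refl])
    fix j :: nat assume j: "j \<in> {0, 1}"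
    show "pmf (out F (sample_endpoint V i (A' j) B)) u * pmf (norm_pmf {0, 1} (\<lambda>j. cw G (A' j) B)) j
        = (if u \<in> A' j then cw G {u} B / cw G A B else 0)"
    proof (cases "0 < cw G (A' j) B")
      case True
      then show ?thesis using j by (simp add: IH pn del: One_nat_def)
    next
      \<comment> \<open>A half without weight to \<open>B\<close> is entered with probability zero,
        and its members have no weight to \<open>B\<close> either, so both sides vanish whatever the
        recursive call returns.\<close>
      case False
      then have z: "cw G (A' j) B = 0" using nn[of j] by simp
      have "cw G {u} B = 0" if "u \<in> A' j"
        using cw_mono[of G "{u}" "A' j" B B] that fin z G_nonneg assms(2) cw_nonneg[of G "{u}" B]
          finite_subset[OF assms(2)] by force
      then show ?thesis using j z by (simp add: pn del: One_nat_def)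
    qed
  qed
  also have "\<dots> = (if u \<in> A then cw G {u} B / cw G A B else 0)"
    using A by auto
  finally show ?case .
qed

text \<open>The second endpoint is drawn relative to the single vertex \<open>u\<close> already
  chosen, so three factors telescope: share of the pair \<open>i\<close>, share of \<open>u\<close>
  in its weight, share of \<open>v\<close> in the weight of \<open>u\<close>. The multiplier
  \<open>l\<close> is 1 in the first stage and the inverse scale in the second.\<close>

lemma pmf_sample_edge:
  assumes b: "n < 2 ^ b" and I: "finite I"
    and AB: "\<And>i. i \<in> I \<Longrightarrow> A i \<subseteq> V \<and> B i \<subseteq> V \<and> A i \<inter> B i = {} \<and> 0 \<le> l i \<and> x i = l i * cw G (A i) (B i)"
    and pos: "0 < sum x I"
  shows "pmf (out F (sample_edge V b I A B x)) (i, u, v) =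
    (if i \<in> I \<and> u \<in> A i \<and> v \<in> B i then l i * G u v / sum x I else 0)"
proof -
  have inj: "inj_on (\<lambda>x. x mod 2 ^ b) X" if "X \<subseteq> V" for X
  proof -
    have "x mod 2 ^ b = x" if "x \<in> X" for x
      using that \<open>X \<subseteq> V\<close> b unfolding V_def by (intro mod_less) force
    then show ?thesis by (simp add: inj_on_def)
  qed
  have nn: "0 \<le> cw G X Y" for X Y using G_nonneg by (rule cw_nonneg)
  have xn: "0 \<le> x i" if "i \<in> I" for i using AB[OF that] nn by simp
  let ?S = "\<lambda>i. out F (sample_endpoint V b (A i) (B i))"
  let ?S' = "\<lambda>i u. out F (sample_endpoint V b (B i) {u})"
  have "out F (sample_edge V b I A B x) =
     bind_pmf (norm_pmf I x) (\<lambda>i. map_pmf (Pair i) (bind_pmf (?S i) (\<lambda>u. map_pmf (Pair u) (?S' i u))))"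
    by (simp add: sample_edge_def out_bind_alg map_pmf_def bind_assoc_pmf bind_return_pmf)
  then have eq: "pmf (out F (sample_edge V b I A B x)) (i, u, v) = pmf (norm_pmf I x) i * (pmf (?S i) u * pmf (?S' i u) v)"
    by (simp add: pmf_bind_map_Pair)
  have pn: "pmf (norm_pmf I x) i = (if i \<in> I then x i / sum x I else 0)"
    using I xn pos by (rule pmf_norm_pmf)
  show ?thesis
  proof (cases "i \<in> I")
    case False
    then show ?thesis by (simp add: eq pn)
  next
    case i: True
    note ABi = AB[OF i]
    have le: "G u v \<le> cw G X Y" if "u \<in> X" "v \<in> Y" "X \<subseteq> V" "Y \<subseteq> V" for u v X Y
      using cw_mono[of G "{u}" X "{v}" Y] that G_nonneg finite_subset[of _ V] by (auto simp: cw_def)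
    show ?thesis
    proof (cases "0 < cw G (A i) (B i)")
      case False
      then have z: "cw G (A i) (B i) = 0" using nn[of "A i" "B i"] by simp
      then have "G u v = 0" if "u \<in> A i" "v \<in> B i" using le[OF that] ABi G_nonneg[of u v] by simp
      then show ?thesis using ABi z by (simp add: eq pn)
    next
      case cA: True
      have S: "pmf (?S i) u = (if u \<in> A i then cw G {u} (B i) / cw G (A i) (B i) else 0)"
        using ABi cA inj by (intro pmf_sample_endpoint) auto
      show ?thesis
      proof (cases "u \<in> A i \<and> 0 < cw G {u} (B i)")
        case False
        then have "G u v = 0 \<and> cw G {u} (B i) = 0" if "u \<in> A i" "v \<in> B i"
          using le[of u "{u}" v "B i"] that ABi nn[of "{u}" "B i"] G_nonneg[of u v] by auto
        moreover have "cw G {u} (B i) = 0" if "u \<in> A i" using False that nn[of "{u}" "B i"] by simp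
        ultimately show ?thesis by (auto simp: eq pn S)
      next
        case True
        have com: "cw G (B i) {u} = cw G {u} (B i)" using G_commute by (rule cw_commute)
        have "pmf (?S' i u) v = (if v \<in> B i then cw G {v} {u} / cw G (B i) {u} else 0)"
          using ABi True inj com by (intro pmf_sample_endpoint) auto
        also have "cw G {v} {u} = G u v" using G_commute[of u v] by (simp add: cw_def)
        finally show ?thesis using i True cA ABi by (auto simp: eq pn S com)
      qed
    qed
  qed
qed

end

section \<open>Tail bounds for independent samples\<close>

lemma nn_integral_exp_replicate_pmf:
  fixes f :: "'a \<Rightarrow> real"
  shows "(\<integral>\<^sup>+xs. ennreal (exp (s * (\<Sum>x\<leftarrow>xs. f x))) \<partial>replicate_pmf N p)
    = (\<integral>\<^sup>+x. ennreal (exp (s * f x)) \<partial>measure_pmf p) ^ N"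
proof (induction N)
  case (Suc N)
  have "(\<integral>\<^sup>+xs. ennreal (exp (s * (\<Sum>x\<leftarrow>xs. f x))) \<partial>replicate_pmf (Suc N) p)
      = (\<integral>\<^sup>+x. \<integral>\<^sup>+xs. ennreal (exp (s * f x)) * ennreal (exp (s * (\<Sum>x\<leftarrow>xs. f x))) \<partial>replicate_pmf N p \<partial>measure_pmf p)"
    by (simp add: distrib_left exp_add ennreal_mult')
  also have "\<dots> = (\<integral>\<^sup>+x. ennreal (exp (s * f x)) \<partial>measure_pmf p) ^ Suc N"
    by (simp add: nn_integral_cmult nn_integral_multc Suc)
  finally show ?case .
qed simp

text \<open>On [0, 1] the convex function \<open>exp (s * x)\<close> lies below its chord
  \<open>1 + x * (exp s - 1)\<close>; so values in the whole interval obey the bound for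
  indicators.\<close>

lemma nn_integral_exp_le:
  fixes f :: "'a \<Rightarrow> real"
  assumes f: "\<And>x. x \<in> set_pmf p \<Longrightarrow> 0 \<le> f x \<and> f x \<le> 1"
  shows "(\<integral>\<^sup>+x. ennreal (exp (s * f x)) \<partial>measure_pmf p)
    \<le> ennreal (exp (measure_pmf.expectation p f * (exp s - 1)))"
proof -
  have int: "integrable (measure_pmf p) f"
    using f by (intro measure_pmf.integrable_const_bound[where B = 1]) (auto simp: AE_measure_pmf_iff)
  have le: "exp (s * f x) \<le> 1 + f x * (exp s - 1)" if "x \<in> set_pmf p" for x
    using convex_onD[OF exp_convex, of "f x" 0 s] f[OF that] by (simp add: algebra_simps)
  have nn: "0 \<le> 1 + f x * (exp s - 1)" if "x \<in> set_pmf p" for x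
    using le[OF that] exp_ge_zero[of "s * f x"] by linarith
  have "(\<integral>\<^sup>+x. ennreal (exp (s * f x)) \<partial>measure_pmf p) \<le> (\<integral>\<^sup>+x. ennreal (1 + f x * (exp s - 1)) \<partial>measure_pmf p)"
    using le by (intro nn_integral_mono_AE) (auto simp: AE_measure_pmf_iff intro: ennreal_leI)
  also have "\<dots> = ennreal (\<integral>x. 1 + f x * (exp s - 1) \<partial>measure_pmf p)"
    using int nn by (intro nn_integral_eq_integral) (auto simp: AE_measure_pmf_iff)
  also have "(\<integral>x. 1 + f x * (exp s - 1) \<partial>measure_pmf p) = 1 + measure_pmf.expectation p f * (exp s - 1)"
    using int by simp
  also have "ennreal \<dots> \<le> ennreal (exp (measure_pmf.expectation p f * (exp s - 1)))"
    by (intro ennreal_leI exp_ge_add_one_self)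
  finally show ?thesis .
qed

text \<open>Markov's inequality for the exponential moment. The factor \<open>s\<close> in the event
  lets its sign choose the tail: negative \<open>s\<close> bounds the sum from above, positive
  \<open>s\<close> from below.\<close>

lemma exponential_tail:
  fixes f :: "'a \<Rightarrow> real"
  assumes f: "\<And>x. x \<in> set_pmf p \<Longrightarrow> 0 \<le> f x \<and> f x \<le> 1"
  shows "measure_pmf.prob (replicate_pmf N p) {xs. s * a \<le> s * (\<Sum>x\<leftarrow>xs. f x)}
    \<le> exp (real N * measure_pmf.expectation p f * (exp s - 1) - s * a)"
proof -
  let ?E = "{xs. s * a \<le> s * (\<Sum>x\<leftarrow>xs. f x)}"
  let ?m = "measure_pmf.expectation p f"
  have "emeasure (replicate_pmf N p) ?E = (\<integral>\<^sup>+xs. indicator ?E xs \<partial>replicate_pmf N p)" by simp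
  also have "\<dots> \<le> (\<integral>\<^sup>+xs. ennreal (exp (- s * a)) * ennreal (exp (s * (\<Sum>x\<leftarrow>xs. f x))) \<partial>replicate_pmf N p)"
    by (intro nn_integral_mono)
      (auto simp: indicator_def simp flip: ennreal_mult' exp_add split: if_splits)
  also have "\<dots> = ennreal (exp (- s * a)) * (\<integral>\<^sup>+x. ennreal (exp (s * f x)) \<partial>measure_pmf p) ^ N"
    by (simp add: nn_integral_cmult nn_integral_exp_replicate_pmf)
  also have "\<dots> \<le> ennreal (exp (- s * a)) * ennreal (exp (?m * (exp s - 1))) ^ N"
    using nn_integral_exp_le[of p f s] f by (intro mult_left_mono power_mono) auto
  also have "\<dots> = ennreal (exp (- s * a) * exp (?m * (exp s - 1)) ^ N)"
    by (simp add: ennreal_mult' ennreal_power)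
  also have "exp (- s * a) * exp (?m * (exp s - 1)) ^ N = exp (real N * ?m * (exp s - 1) - s * a)"
    by (simp add: algebra_simps flip: exp_of_nat_mult exp_add)
  finally show ?thesis
    by (simp add: measure_pmf.emeasure_eq_measure)
qed

lemma exp_minus_le_quadratic: "0 \<le> (x::real) \<Longrightarrow> exp (- x) \<le> 1 - x + x\<^sup>2"
proof -
  assume x: "0 \<le> x"
  have "exp (- x) = 1 / exp x" by (simp add: exp_minus field_simps)
  also have "\<dots> \<le> 1 / (1 + x)" using x exp_ge_add_one_self[of x] by (intro divide_left_mono) auto
  also have "\<dots> \<le> 1 - x + x\<^sup>2"
  proof -
    have "(1 - x + x\<^sup>2) * (1 + x) = 1 + x ^ 3" by (simp add: algebra_simps power2_eq_square power3_eq_cube)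
    then have "1 \<le> (1 - x + x\<^sup>2) * (1 + x)" using x by simp
    then show ?thesis using x by (simp add: divide_le_eq)
  qed
  finally show ?thesis .
qed

text \<open>With \<open>s = - d / 2\<close> and the quadratic bound on \<open>exp\<close>, the
  exponent is at most \<open>m * (- d / 2 + d\<^sup>2 / 4) + (d / 2) * (1 - d) * m\<close>, which
  equals \<open>- d\<^sup>2 * m / 4\<close>.\<close>

lemma chernoff_lower:
  fixes f :: "'a \<Rightarrow> real"
  assumes f: "\<And>x. x \<in> set_pmf p \<Longrightarrow> 0 \<le> f x \<and> f x \<le> 1" and d: "0 \<le> d"
  shows "measure_pmf.prob (replicate_pmf N p) {xs. (\<Sum>x\<leftarrow>xs. f x) \<le> (1 - d) * (real N * measure_pmf.expectation p f)}
    \<le> exp (- d\<^sup>2 * (real N * measure_pmf.expectation p f) / 4)"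
proof (cases "d = 0")
  case False
  define m where "m = real N * measure_pmf.expectation p f"
  have "0 \<le> measure_pmf.expectation p f"
    using f by (intro integral_nonneg_AE) (auto simp: AE_measure_pmf_iff)
  then have m: "0 \<le> m" by (simp add: m_def)
  have "{xs. (\<Sum>x\<leftarrow>xs. f x) \<le> (1 - d) * m} = {xs. (- (d / 2)) * ((1 - d) * m) \<le> (- (d / 2)) * (\<Sum>x\<leftarrow>xs. f x)}"
    using d False by (auto simp: mult_le_cancel_left)
  then have "measure_pmf.prob (replicate_pmf N p) {xs. (\<Sum>x\<leftarrow>xs. f x) \<le> (1 - d) * m}
      \<le> exp (m * (exp (- (d / 2)) - 1) - (- (d / 2)) * ((1 - d) * m))"
    using exponential_tail[where f = f and p = p and N = N and s = "- (d / 2)" and a = "(1 - d) * m", OF f]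
    by (simp add: m_def)
  note tail = this
  have "m * (exp (- (d / 2)) - 1) \<le> m * (- (d / 2) + (d / 2)\<^sup>2)"
    using exp_minus_le_quadratic[of "d / 2"] d m by (intro mult_left_mono) auto
  then have "m * (exp (- (d / 2)) - 1) - (- (d / 2)) * ((1 - d) * m)
      \<le> m * (- (d / 2) + (d / 2)\<^sup>2) - (- (d / 2)) * ((1 - d) * m)" by simp
  also have "\<dots> = - d\<^sup>2 * m / 4" by (simp add: field_simps power2_eq_square)
  finally have "exp (m * (exp (- (d / 2)) - 1) - (- (d / 2)) * ((1 - d) * m)) \<le> exp (- d\<^sup>2 * m / 4)"
    by simp
  with tail show ?thesis unfolding m_def [symmetric] by (rule order_trans)
qed simp

lemma chernoff_upper:
  fixes f :: "'a \<Rightarrow> real"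
  assumes f: "\<And>x. x \<in> set_pmf p \<Longrightarrow> 0 \<le> f x \<and> f x \<le> 1" and d: "0 \<le> d" "d \<le> 1"
  shows "measure_pmf.prob (replicate_pmf N p) {xs. (1 + d) * (real N * measure_pmf.expectation p f) \<le> (\<Sum>x\<leftarrow>xs. f x)}
    \<le> exp (- d\<^sup>2 * (real N * measure_pmf.expectation p f) / 4)"
proof (cases "d = 0")
  case False
  define m where "m = real N * measure_pmf.expectation p f"
  have "0 \<le> measure_pmf.expectation p f"
    using f by (intro integral_nonneg_AE) (auto simp: AE_measure_pmf_iff)
  then have m: "0 \<le> m" by (simp add: m_def)
  have "{xs. (1 + d) * m \<le> (\<Sum>x\<leftarrow>xs. f x)} = {xs. (d / 2) * ((1 + d) * m) \<le> (d / 2) * (\<Sum>x\<leftarrow>xs. f x)}"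
    using d False by (auto simp: mult_le_cancel_left)
  then have "measure_pmf.prob (replicate_pmf N p) {xs. (1 + d) * m \<le> (\<Sum>x\<leftarrow>xs. f x)}
      \<le> exp (m * (exp (d / 2) - 1) - (d / 2) * ((1 + d) * m))"
    using exponential_tail[where f = f and p = p and N = N and s = "d / 2" and a = "(1 + d) * m", OF f]
    by (simp add: m_def)
  note tail = this
  have "m * (exp (d / 2) - 1) \<le> m * (d / 2 + (d / 2)\<^sup>2)"
    using exp_bound[of "d / 2"] d m by (intro mult_left_mono) auto
  then have "m * (exp (d / 2) - 1) - (d / 2) * ((1 + d) * m)
      \<le> m * (d / 2 + (d / 2)\<^sup>2) - (d / 2) * ((1 + d) * m)" by simp
  also have "\<dots> = - d\<^sup>2 * m / 4" by (simp add: field_simps power2_eq_square)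
  finally have "exp (m * (exp (d / 2) - 1) - (d / 2) * ((1 + d) * m)) \<le> exp (- d\<^sup>2 * m / 4)"
    by simp
  with tail show ?thesis unfolding m_def [symmetric] by (rule order_trans)
qed simp

text \<open>Meant for thresholds several times the mean, out of reach of
  \<open>chernoff_upper\<close> with its restriction to \<open>d \<le> 1\<close>; it takes
  \<open>s = 1\<close> and \<open>exp 1 - 1 \<le> 2\<close>.\<close>

lemma tail_exp2:
  fixes f :: "'a \<Rightarrow> real"
  assumes f: "\<And>x. x \<in> set_pmf p \<Longrightarrow> 0 \<le> f x \<and> f x \<le> 1"
  shows "measure_pmf.prob (replicate_pmf N p) {xs. a \<le> (\<Sum>x\<leftarrow>xs. f x)}
    \<le> exp (2 * (real N * measure_pmf.expectation p f) - a)"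
proof -
  have "0 \<le> measure_pmf.expectation p f"
    using f by (intro integral_nonneg_AE) (auto simp: AE_measure_pmf_iff)
  then have "real N * measure_pmf.expectation p f * (exp 1 - 1) \<le> real N * measure_pmf.expectation p f * 2"
    using exp_le by (intro mult_left_mono) auto
  then have "exp (real N * measure_pmf.expectation p f * (exp 1 - 1) - 1 * a) \<le> exp (2 * (real N * measure_pmf.expectation p f) - a)"
    by simp
  with exponential_tail[where f = f and p = p and N = N and s = 1 and a = a, OF f] show ?thesis
    by (simp add: order_trans)
qed

lemma prob_bind_pmf_le:
  assumes "measure_pmf.prob p B \<le> c" "\<And>x. x \<in> set_pmf p \<Longrightarrow> x \<notin> B \<Longrightarrow> measure_pmf.prob (f x) E \<le> c'" "0 \<le> c'"
  shows "measure_pmf.prob (bind_pmf p f) E \<le> c + c'"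
proof -
  have c: "0 \<le> c" using assms(1) measure_nonneg order_trans by blast
  have "emeasure (bind_pmf p f) E = (\<integral>\<^sup>+x. emeasure (f x) E \<partial>measure_pmf p)" by simp
  also have "\<dots> \<le> (\<integral>\<^sup>+x. indicator B x + ennreal c' \<partial>measure_pmf p)"
  proof (intro nn_integral_mono_AE, unfold AE_measure_pmf_iff, intro ballI)
    fix x assume x: "x \<in> set_pmf p"
    show "emeasure (f x) E \<le> indicator B x + ennreal c'"
    proof (cases "x \<in> B")
      case True
      then have "emeasure (f x) E \<le> indicator B x" using measure_pmf.emeasure_le_1[of "f x" E] by simp
      also have "\<dots> \<le> indicator B x + ennreal c'" by simp
      finally show ?thesis .
    next
      case False
      then show ?thesis using assms(2)[OF x False] assms(3)
        by (simp add: measure_pmf.emeasure_eq_measure ennreal_leI)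
    qed
  qed
  also have "\<dots> = emeasure p B + ennreal c'"
    by (subst nn_integral_add) (auto simp: measure_pmf.emeasure_space_1)
  also have "\<dots> \<le> ennreal (c + c')"
    using assms c by (simp add: measure_pmf.emeasure_eq_measure flip: ennreal_plus)
  finally show ?thesis using assms(3) c
    by (simp add: measure_pmf.emeasure_eq_measure del: ennreal_plus)
qed

section \<open>Contraction rounds\<close>

definition cls :: "nat set \<Rightarrow> (nat \<Rightarrow> nat) \<Rightarrow> nat \<Rightarrow> nat set" where
  "cls V f a = {x\<in>V. f x = a}"

definition coarsen :: "(nat \<Rightarrow> nat) \<Rightarrow> nat set \<Rightarrow> (nat \<Rightarrow> nat) \<Rightarrow> nat \<Rightarrow> nat" where
  "coarsen f M Q x = (if f x \<in> M then Q (f x) else f x)"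

definition active :: "nat set \<Rightarrow> (nat \<Rightarrow> nat) \<Rightarrow> (nat \<Rightarrow> real) \<Rightarrow> nat set" where
  "active V f deg = {a\<in>f ` V. sum deg (f ` V) \<le> 4 * real (card V) * deg a}"

definition sample_graph :: "(nat \<Rightarrow> nat) \<Rightarrow> (nat \<times> nat \<times> nat) list \<Rightarrow> nat \<Rightarrow> nat \<Rightarrow> real" where
  "sample_graph f xs a b = (\<Sum>(i, u, v)\<leftarrow>xs. of_bool (f u = a \<and> f v = b) + of_bool (f u = b \<and> f v = a))"

text \<open>The guarantees of \<open>strong_partition_exists\<close> in one predicate, so that the
  algorithm can pick such a map by choice, local computation being free.\<close>

definition admissible :: "nat set \<Rightarrow> (nat \<Rightarrow> nat \<Rightarrow> real) \<Rightarrow> real \<Rightarrow> (nat \<Rightarrow> nat) \<Rightarrow> bool" where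
  "admissible M h t Q \<longleftrightarrow> Q ` M \<subseteq> M \<and> (\<forall>b. strong h t {a\<in>M. Q a = b}) \<and>
     crossing h M Q \<le> 2 * t * (real (card M) - 1)"

definition sample_active ::
  "nat set \<Rightarrow> nat \<Rightarrow> nat \<Rightarrow> (nat \<Rightarrow> nat) \<Rightarrow> nat set \<Rightarrow> (real \<times> (nat \<times> nat \<times> nat) list) query_alg" where
  "sample_active V b N f M = (let U = {x\<in>V. f x \<in> M} in
    bind_alg (ask_all V (map (cls V f) (sorted_list_of_set M) @ map (\<lambda>a. U - cls V f a) (sorted_list_of_set M) @ [U]))
      (\<lambda>T. let x = (\<lambda>a. cut_between T (cls V f a) (U - cls V f a)) in
        bind_alg (repeat_alg N (sample_edge V b M (cls V f) (\<lambda>a. U - cls V f a) x))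
          (\<lambda>xs. Return (sum x M, xs))))"

text \<open>\<open>(A, B, kap)\<close> stands for all edges from \<open>A\<close> to
  \<open>B\<close>, which the algorithm never sees individually, together with a common lower bound
  \<open>kap\<close> for their strengths.\<close>

type_synonym group = "nat set \<times> nat set \<times> real"

text \<open>Each class is paired with the rest of the block it is merged into, so an edge contracted
  in this round appears once in either order. Blocks of one vertex give an empty right side; a round
  thus adds exactly \<open>card M\<close> groups.\<close>

definition new_groups :: "nat set \<Rightarrow> (nat \<Rightarrow> nat) \<Rightarrow> nat set \<Rightarrow> (nat \<Rightarrow> nat) \<Rightarrow> real \<Rightarrow> group list" where
  "new_groups V f M Q kap =
    map (\<lambda>a. (cls V f a, cls V (coarsen f M Q) (Q a) - cls V f a, kap)) (sorted_list_of_set M)"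

text \<open>At this threshold the crossing weight of the sampled multigraph is below
  \<open>N / 2\<close> in both orders together, so fewer than a quarter of the samples
  cross.\<close>

definition partition_of :: "(nat \<Rightarrow> nat) \<Rightarrow> nat set \<Rightarrow> nat \<Rightarrow> (nat \<times> nat \<times> nat) list \<Rightarrow> nat \<Rightarrow> nat" where
  "partition_of f M N xs = (SOME Q. admissible M (sample_graph f xs) (real N / (4 * real (card M))) Q)"

text \<open>Only labels in \<open>M\<close> can change their class, so only their degrees are
  queried again. Giving up when the total has not dropped to 3/4 makes the cost bound hold in every
  run. The continuation \<open>rec\<close> is a parameter to keep \<open>contract\<close> primitive
  recursive.\<close>

definition round_step where
  "round_step V f deg kap M N rec Y xs =
    (let Q = partition_of f M N xs; f' = coarsen f M Q; kap' = min kap (Y / (32 * real (card M)))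
     in bind_alg (ask_all V (map (cls V f') (sorted_list_of_set M))) (\<lambda>T.
       let deg' = (\<lambda>a. if a \<in> M then T (cls V f' a) else deg a)
       in if sum deg' (f' ` V) > 3 / 4 * sum deg (f ` V) then Return []
       else bind_alg (rec f' deg' kap') (\<lambda>L. Return (new_groups V f M Q kap' @ L))))"

text \<open>The state is a labelling \<open>f\<close> of the vertices, whose fibres are the vertices of the contracted
  graph, the table \<open>deg\<close> of their degrees, and the least scale \<open>kap\<close> used so far: as sets merged in
  earlier rounds are only known to be connected at the earlier scales, the scale may not grow again.\<close>

primrec contract ::
  "nat set \<Rightarrow> nat \<Rightarrow> real \<Rightarrow> nat \<Rightarrow> (nat \<Rightarrow> nat) \<Rightarrow> (nat \<Rightarrow> real) \<Rightarrow> real \<Rightarrow> group list query_alg" where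
  "contract V b c 0 f deg kap = Return []"
| "contract V b c (Suc k) f deg kap =
    (let M = active V f deg; N = nat \<lceil>c * real (card M)\<rceil>
     in if sum deg (f ` V) \<le> 0 then Return []
     else bind_alg (sample_active V b N f M) (\<lambda>(Y, xs). round_step V f deg kap M N (contract V b c k) Y xs))"

lemma queries_within_sample_active: "queries_within V (sample_active V b N f M)"
  unfolding sample_active_def Let_def
  by (intro queries_within_bind_alg queries_within_ask_all queries_within_repeat_alg queries_within_sample_edge) simp

lemma queries_within_round_step:
  "(\<And>f deg kap. queries_within V (rec f deg kap)) \<Longrightarrow> queries_within V (round_step V f deg kap M N rec Y xs)"
  by (auto simp: round_step_def Let_def intro!: queries_within_bind_alg queries_within_ask_all)

lemma queries_within_contract: "queries_within V (contract V b c k f deg kap)"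
  by (induction k arbitrary: f deg kap)
    (auto simp: Let_def intro!: queries_within_bind_alg queries_within_sample_active queries_within_round_step)

lemma cls_subset: "cls V f a \<subseteq> V"
  by (auto simp: cls_def)

context query_graph
begin

definition split_weight :: "nat set \<Rightarrow> (nat \<Rightarrow> nat) \<Rightarrow> real" where
  "split_weight X f = crossing G X f"

definition act :: "(nat \<Rightarrow> nat) \<Rightarrow> nat set \<Rightarrow> nat set" where
  "act f M = {x\<in>V. f x \<in> M}"

lemma act_subset: "act f M \<subseteq> V" by (auto simp: act_def)

lemma finite_act [simp]: "finite (act f M)" by (rule finite_subset_V[OF act_subset])

lemma split_weight_nonneg: "0 \<le> split_weight X f"
  by (auto simp: split_weight_def crossing_def G_nonneg intro!: sum_nonneg)

lemma split_weight_eq_sum_cw: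
  assumes "finite X"
  shows "(\<Sum>a\<in>f ` X. cw G {x\<in>X. f x = a} (X - {x\<in>X. f x = a})) = split_weight X f"
proof -
  have "cw G {x\<in>X. f x = a} (X - {x\<in>X. f x = a}) =
     (\<Sum>u\<in>{x\<in>X. f x = a}. \<Sum>v\<in>X. if f u \<noteq> f v then G u v else 0)" for a
    unfolding cw_def
  proof (rule sum.cong[OF refl])
    fix u assume u: "u \<in> {x\<in>X. f x = a}"
    have "X - {x\<in>X. f x = a} = {v\<in>X. f u \<noteq> f v}" using u by auto
    then show "(\<Sum>v\<in>X - {x\<in>X. f x = a}. G u v) = (\<Sum>v\<in>X. if f u \<noteq> f v then G u v else 0)"
      using assms by (simp add: sum.inter_filter)
  qed
  then have "(\<Sum>a\<in>f ` X. cw G {x\<in>X. f x = a} (X - {x\<in>X. f x = a})) =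
     (\<Sum>a\<in>f ` X. \<Sum>u\<in>{x\<in>X. f x = a}. \<Sum>v\<in>X. if f u \<noteq> f v then G u v else 0)" by simp
  also have "\<dots> = split_weight X f"
    unfolding split_weight_def crossing_def using assms by (intro sum.group) auto
  finally show ?thesis .
qed

definition consistent :: "(nat \<Rightarrow> nat) \<Rightarrow> (nat \<Rightarrow> real) \<Rightarrow> bool" where
  "consistent f deg \<longleftrightarrow> (\<forall>a\<in>f ` V. deg a = F (cls V f a))"

lemma consistentD: "consistent f deg \<Longrightarrow> a \<in> f ` V \<Longrightarrow> deg a = F (cls V f a)"
  by (auto simp: consistent_def)

lemma consistent_sum: "consistent f deg \<Longrightarrow> sum deg (f ` V) = split_weight V f"
proof -
  assume c: "consistent f deg"
  have "sum deg (f ` V) = (\<Sum>a\<in>f ` V. cw G {x\<in>V. f x = a} (V - {x\<in>V. f x = a}))"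
    using c by (intro sum.cong refl) (simp add: consistentD F_eq_cw cls_def)
  then show ?thesis by (simp add: split_weight_eq_sum_cw)
qed

lemma F_nonneg: "0 \<le> F S"
  unfolding F_eq_cw using G_nonneg by (rule cw_nonneg)

lemma deg_nonneg: "consistent f deg \<Longrightarrow> a \<in> f ` V \<Longrightarrow> 0 \<le> deg a"
  by (simp add: consistentD F_nonneg)

lemma deg_le: "consistent f deg \<Longrightarrow> a \<in> f ` V \<Longrightarrow> deg a \<le> sum deg (f ` V)"
  using deg_nonneg by (intro member_le_sum) auto

lemma active_subset: "active V f deg \<subseteq> f ` V"
  by (auto simp: active_def)

lemma finite_active [simp]: "finite (active V f deg)"
  by (rule finite_subset[OF active_subset]) simp

definition active_weight :: "(nat \<Rightarrow> nat) \<Rightarrow> nat set \<Rightarrow> real" where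
  "active_weight f M = split_weight (act f M) f"

lemma cls_act: "a \<in> M \<Longrightarrow> {x\<in>act f M. f x = a} = cls V f a"
  by (auto simp: act_def cls_def)

lemma active_weight_eq:
  assumes "M \<subseteq> f ` V"
  shows "active_weight f M = (\<Sum>a\<in>M. cw G (cls V f a) (act f M - cls V f a))"
proof -
  have "f ` act f M = M" using assms by (auto simp: act_def)
  then show ?thesis
    unfolding active_weight_def by (simp add: cls_act flip: split_weight_eq_sum_cw)
qed

text \<open>Each inactive vertex has degree below \<open>D / (4 * n)\<close> and there are at most
  \<open>n\<close> of them, so pairs with an inactive first end weigh at most \<open>D / 4\<close>,
  and by symmetry so do those with an inactive second end.\<close>

lemma active_weight_ge_half:
  assumes c: "consistent f deg" and D: "0 < sum deg (f ` V)"
  shows "sum deg (f ` V) / 2 \<le> active_weight f (active V f deg)"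
proof -
  define M where "M = active V f deg"
  define D where "D = sum deg (f ` V)"
  define R where "R = V - act f M"
  let ?g = "\<lambda>u v. if f u \<noteq> f v then G u v else 0"
  have Vn: "0 < n" using D card_V card_gt_0_iff[of V] by (cases "V = {}") auto
  have fin: "finite R" "finite (act f M)" by (auto simp: R_def)
  have V: "V = act f M \<union> R" "act f M \<inter> R = {}" using act_subset by (auto simp: R_def)
  have g: "0 \<le> ?g u v" for u v by (simp add: G_nonneg)
  have gs: "?g u v = ?g v u" for u v using G_commute[of u v] by auto
  have R: "(\<Sum>u\<in>R. \<Sum>v\<in>V. ?g u v) \<le> D / 4"
  proof -
    have fR: "f ` R \<subseteq> f ` V - M" by (auto simp: R_def act_def)
    have "(\<Sum>u\<in>R. \<Sum>v\<in>V. ?g u v) = (\<Sum>a\<in>f ` V - M. \<Sum>u\<in>{u\<in>R. f u = a}. \<Sum>v\<in>V. ?g u v)"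
      using fin fR by (intro sum.group[symmetric]) auto
    also have "\<dots> \<le> (\<Sum>a\<in>f ` V - M. deg a)"
    proof (rule sum_mono)
      fix a assume a: "a \<in> f ` V - M"
      have "(\<Sum>u\<in>{u\<in>R. f u = a}. \<Sum>v\<in>V. ?g u v) = (\<Sum>u\<in>cls V f a. \<Sum>v\<in>V. ?g u v)"
        using a by (intro sum.cong) (auto simp: R_def act_def cls_def)
      also have "\<dots> = (\<Sum>u\<in>cls V f a. \<Sum>v\<in>V - cls V f a. G u v)"
      proof (rule sum.cong[OF refl])
        fix u assume u: "u \<in> cls V f a"
        have "V - cls V f a = {v\<in>V. f u \<noteq> f v}" using u by (auto simp: cls_def)
        then show "(\<Sum>v\<in>V. ?g u v) = (\<Sum>v\<in>V - cls V f a. G u v)" by (simp add: sum.inter_filter)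
      qed
      also have "\<dots> = deg a" using consistentD[OF c, of a] a by (simp add: F_eq_cw cw_def)
      finally show "(\<Sum>u\<in>{u\<in>R. f u = a}. \<Sum>v\<in>V. ?g u v) \<le> deg a" by simp
    qed
    also have "\<dots> \<le> (\<Sum>a\<in>f ` V - M. D / (4 * real n))"
    proof (rule sum_mono)
      fix a assume "a \<in> f ` V - M"
      then have "\<not> D \<le> 4 * real n * deg a" by (auto simp: M_def active_def D_def)
      then show "deg a \<le> D / (4 * real n)" using Vn by (simp add: field_simps)
    qed
    also have "\<dots> = real (card (f ` V - M)) * (D / (4 * real n))" by simp
    also have "\<dots> \<le> real n * (D / (4 * real n))"
    proof (rule mult_right_mono)
      have "card (f ` V - M) \<le> card (f ` V)" by (intro card_mono) auto
      also have "\<dots> \<le> n" using card_image_le[of V f] by simp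
      finally show "real (card (f ` V - M)) \<le> real n" by simp
    qed (use D in \<open>simp add: D_def\<close>)
    also have "\<dots> = D / 4" using Vn by simp
    finally show ?thesis .
  qed
  have "D = split_weight V f" using consistent_sum[OF c] by (simp add: D_def)
  also have "\<dots> = (\<Sum>u\<in>V. \<Sum>v\<in>V. ?g u v)" by (simp add: split_weight_def crossing_def)
  also have "\<dots> = (\<Sum>u\<in>act f M. \<Sum>v\<in>V. ?g u v) + (\<Sum>u\<in>R. \<Sum>v\<in>V. ?g u v)"
    by (subst V(1), rule sum.union_disjoint[OF fin(2,1) V(2)])
  also have "(\<Sum>u\<in>act f M. \<Sum>v\<in>V. ?g u v) = (\<Sum>u\<in>act f M. (\<Sum>v\<in>act f M. ?g u v) + (\<Sum>v\<in>R. ?g u v))"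
    by (subst V(1), subst sum.union_disjoint[OF fin(2,1) V(2)]) simp
  also have "\<dots> = active_weight f M + (\<Sum>u\<in>act f M. \<Sum>v\<in>R. ?g u v)"
    by (simp add: sum.distrib active_weight_def split_weight_def crossing_def)
  also have "(\<Sum>u\<in>act f M. \<Sum>v\<in>R. ?g u v) = (\<Sum>v\<in>R. \<Sum>u\<in>act f M. ?g v u)"
    by (subst sum.swap) (simp only: gs)
  also have "\<dots> \<le> (\<Sum>v\<in>R. \<Sum>u\<in>V. ?g v u)"
    using g act_subset by (intro sum_mono sum_mono2) auto
  finally show ?thesis using R by (simp add: M_def D_def)
qed

text \<open>Labels outside \<open>M\<close> are kept, and \<open>Q\<close> maps into
  \<open>M\<close>, so a pair can become merged only if both labels are active. The loss of total
  weight is therefore read off inside the active part.\<close>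

lemma split_weight_coarsen:
  assumes Q: "Q ` M \<subseteq> M"
  shows "split_weight V (coarsen f M Q) = split_weight V f - (active_weight f M - split_weight (act f M) (Q \<circ> f))"
proof -
  define U where "U = act f M"
  let ?f' = "coarsen f M Q"
  let ?g = "\<lambda>u v. if f u \<noteq> f v \<and> ?f' u = ?f' v then G u v else 0"
  have 1: "split_weight X f = split_weight X ?f' + (\<Sum>u\<in>X. \<Sum>v\<in>X. ?g u v)" if "X = V \<or> X = U" for X
    unfolding split_weight_def crossing_def sum.distrib[symmetric]
    by (intro sum.cong refl) (auto simp: coarsen_def)
  have "(\<Sum>u\<in>V. \<Sum>v\<in>V. ?g u v) = (\<Sum>u\<in>U. \<Sum>v\<in>U. ?g u v)"
  proof -
    have in_U: "u \<in> U \<and> v \<in> U" if "u \<in> V" "v \<in> V" "?g u v \<noteq> 0" for u v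
      using that Q by (auto simp: U_def act_def coarsen_def split: if_splits)
    have "(\<Sum>u\<in>V. \<Sum>v\<in>V. ?g u v) = (\<Sum>u\<in>V. \<Sum>v\<in>U. ?g u v)"
    proof (rule sum.cong[OF refl], rule sum.mono_neutral_right)
      show "\<forall>v\<in>V - U. ?g u v = 0" if "u \<in> V" for u using in_U[OF that] by blast
    qed (use act_subset in \<open>auto simp: U_def\<close>)
    also have "\<dots> = (\<Sum>u\<in>U. \<Sum>v\<in>U. ?g u v)"
    proof (rule sum.mono_neutral_right)
      have "(\<Sum>v\<in>U. ?g u v) = 0" if "u \<in> V - U" for u
        using in_U[of u] that act_subset unfolding U_def by (intro sum.neutral) blast
      then show "\<forall>u\<in>V - U. (\<Sum>v\<in>U. ?g u v) = 0" by blast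
    qed (use act_subset in \<open>auto simp: U_def\<close>)
    finally show ?thesis .
  qed
  moreover have "split_weight U ?f' = split_weight U (Q \<circ> f)"
    unfolding split_weight_def crossing_def by (intro sum.cong refl) (auto simp: U_def act_def coarsen_def)
  ultimately show ?thesis using 1[of V] 1[of U] by (simp add: active_weight_def U_def)
qed

lemma cls_coarsen:
  assumes Q: "Q ` M \<subseteq> M" and b: "b \<in> M"
  shows "cls V (coarsen f M Q) b = {x\<in>act f M. Q (f x) = b}"
  using assms by (auto simp: cls_def act_def coarsen_def)

lemma sum_new_groups:
  assumes Q: "Q ` M \<subseteq> M" and M: "M \<subseteq> f ` V" "finite M"
  shows "(\<Sum>a\<in>M. cw G (cls V f a) (cls V (coarsen f M Q) (Q a) - cls V f a)) =
    active_weight f M - split_weight (act f M) (Q \<circ> f)"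
proof -
  define U where "U = act f M"
  let ?g = "\<lambda>u v. if f u \<noteq> f v \<and> Q (f u) = Q (f v) then G u v else 0"
  have "f ` U = M" using M by (auto simp: U_def act_def)
  have finU: "finite U" by (simp add: U_def)
  have "cw G (cls V f a) (cls V (coarsen f M Q) (Q a) - cls V f a) = (\<Sum>u\<in>{u\<in>U. f u = a}. \<Sum>v\<in>U. ?g u v)"
    if a: "a \<in> M" for a
    unfolding cw_def
  proof (rule sum.cong)
    show "cls V f a = {u\<in>U. f u = a}" using a by (auto simp: U_def cls_def act_def)
    fix u assume "u \<in> {u\<in>U. f u = a}"
    then have u: "f u = a" "u \<in> U" by auto
    have "cls V (coarsen f M Q) (Q a) - cls V f a = {v\<in>U. f u \<noteq> f v \<and> Q (f u) = Q (f v)}"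
      using a Q u act_subset by (subst cls_coarsen) (auto simp: cls_def U_def)
    then show "(\<Sum>v\<in>cls V (coarsen f M Q) (Q a) - cls V f a. G u v) = (\<Sum>v\<in>U. ?g u v)"
      by (simp add: finU sum.inter_filter)
  qed
  then have "(\<Sum>a\<in>M. cw G (cls V f a) (cls V (coarsen f M Q) (Q a) - cls V f a))
      = (\<Sum>a\<in>f ` U. \<Sum>u\<in>{u\<in>U. f u = a}. \<Sum>v\<in>U. ?g u v)"
    unfolding \<open>f ` U = M\<close> by (rule sum.cong[OF refl])
  also have "\<dots> = (\<Sum>u\<in>U. \<Sum>v\<in>U. ?g u v)" using finU by (intro sum.group) auto
  also have "\<dots> = split_weight U f - split_weight U (Q \<circ> f)"
    unfolding split_weight_def crossing_def sum_subtractf[symmetric] by (intro sum.cong refl) auto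
  finally show ?thesis by (simp add: active_weight_def U_def)
qed

section \<open>Amortised number of active vertices\<close>

definition log43 :: "real \<Rightarrow> real" where "log43 x = ln x / ln (4 / 3)"

text \<open>The base 4/3 turns one successful round into a decrease by one. An active vertex
  satisfies \<open>D / deg \<le> 4 * n\<close>, so \<open>cap\<close> bounds the number of rounds it
  can stay active at fixed degree.\<close>

definition cap :: real where "cap = 1 + log43 (4 * real n)"

text \<open>Counts the rounds in which \<open>a\<close> may still be active: activity begins once
  \<open>D\<close> has fallen to \<open>4 * n * deg a\<close>, and \<open>D\<close> never falls
  below \<open>deg a\<close>. Until then, and for degree zero, the full \<open>cap\<close> is
  reserved.\<close>

definition vertex_potential :: "(nat \<Rightarrow> real) \<Rightarrow> real \<Rightarrow> nat \<Rightarrow> real" where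
  "vertex_potential deg D a = (if deg a \<le> 0 then cap else min cap (1 + log43 (D / deg a)))"

text \<open>A vertex of fixed degree is active during \<open>O(ln n)\<close> rounds, since every round shrinks the
  total weight by a constant factor; a vertex created by a contraction is paid for by the
  drop in the number of vertices.\<close>

definition potential :: "(nat \<Rightarrow> nat) \<Rightarrow> (nat \<Rightarrow> real) \<Rightarrow> real" where
  "potential f deg = (let D = sum deg (f ` V) in
     if D \<le> 0 then 0 else \<Sum>a\<in>f ` V. vertex_potential deg D a + cap)"

lemma log43_mono: "0 < x \<Longrightarrow> x \<le> y \<Longrightarrow> log43 x \<le> log43 y"
  by (simp add: log43_def divide_right_mono)

lemma log43_nonneg: "1 \<le> x \<Longrightarrow> 0 \<le> log43 x"
  by (simp add: log43_def)

lemma log43_shrink: "0 < x \<Longrightarrow> log43 (3 / 4 * x) = log43 x - 1"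
proof -
  assume x: "0 < x"
  have "ln (3 / 4 * x) = ln (x / (4 / 3))" by (simp add: field_simps)
  also have "\<dots> = ln x - ln (4 / 3)" using x by (subst ln_divide_pos) auto
  finally show ?thesis by (simp add: log43_def diff_divide_distrib)
qed

lemma cap_ge_1: "1 \<le> n \<Longrightarrow> 1 \<le> cap"
  by (simp add: cap_def log43_nonneg)

lemma weight_pos_imp: "0 < (sum deg (f ` V) :: real) \<Longrightarrow> 1 \<le> n"
proof (rule ccontr)
  assume D: "0 < (sum deg (f ` V) :: real)" and "\<not> 1 \<le> n"
  then have "V = {}" by (simp add: V_def)
  with D show False by simp
qed

lemma vertex_potential_ge_1:
  assumes c: "consistent f deg" and a: "a \<in> f ` V" and D: "0 < sum deg (f ` V)"
  shows "1 \<le> vertex_potential deg (sum deg (f ` V)) a"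
proof (cases "deg a \<le> 0")
  case True
  then show ?thesis using cap_ge_1[OF weight_pos_imp[OF D]] by (simp add: vertex_potential_def)
next
  case False
  then have "1 \<le> sum deg (f ` V) / deg a" using deg_le[OF c a] by simp
  then show ?thesis using cap_ge_1[OF weight_pos_imp[OF D]] log43_nonneg[of "sum deg (f ` V) / deg a"] False
    by (simp add: vertex_potential_def)
qed

lemma card_active_le_potential:
  assumes c: "consistent f deg" and D: "0 < sum deg (f ` V)"
  shows "real (card (active V f deg)) \<le> potential f deg"
proof -
  have ge: "1 \<le> vertex_potential deg (sum deg (f ` V)) a + cap" if "a \<in> f ` V" for a
    using vertex_potential_ge_1[OF c that D] cap_ge_1[OF weight_pos_imp[OF D]] by simp
  have "real (card (active V f deg)) = (\<Sum>a\<in>active V f deg. 1)" by simp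
  also have "\<dots> \<le> (\<Sum>a\<in>f ` V. 1)" using active_subset by (intro sum_mono2) auto
  also have "\<dots> \<le> (\<Sum>a\<in>f ` V. vertex_potential deg (sum deg (f ` V)) a + cap)"
    using ge by (rule sum_mono)
  finally show ?thesis using D by (simp add: potential_def)
qed

lemma potential_nonneg: "consistent f deg \<Longrightarrow> 0 \<le> potential f deg"
  using card_active_le_potential[of f deg] by (cases "0 < sum deg (f ` V)") (auto simp: potential_def)

text \<open>Block by block: an inactive vertex does not gain potential; an active vertex left alone
  loses one, since the total shrinks by 3/4; and \<open>k \<ge> 2\<close> merged vertices hold at
  least \<open>k * (1 + cap)\<close>, enough for the \<open>2 * cap\<close> of the new vertex and a
  payment of \<open>k\<close>.\<close>

lemma potential_step:
  assumes M: "M = active V f deg" and Q: "Q ` M \<subseteq> M"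
    and c: "consistent f deg" "consistent (coarsen f M Q) deg'"
    and deg': "\<And>a. a \<notin> M \<Longrightarrow> deg' a = deg a"
    and D: "0 < sum deg (f ` V)" "sum deg' (coarsen f M Q ` V) \<le> 3 / 4 * sum deg (f ` V)"
  shows "potential (coarsen f M Q) deg' + real (card M) \<le> potential f deg"
proof -
  define f' where "f' = coarsen f M Q"
  define D0 where "D0 = sum deg (f ` V)"
  define D1 where "D1 = sum deg' (f' ` V)"
  note n1 = weight_pos_imp[OF D(1)]
  note cap1 = cap_ge_1[OF n1]
  have M_sub: "M \<subseteq> f ` V" using M active_subset by simp
  have finM: "finite M" using M by simp
  let ?p = "vertex_potential deg D0" and ?p' = "vertex_potential deg' D1"
  have le_cap: "?p a \<le> cap" "?p' a \<le> cap" for a by (auto simp: vertex_potential_def)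
  have ge1: "1 \<le> ?p a" if "a \<in> f ` V" for a
    unfolding D0_def using c(1) that D(1) by (rule vertex_potential_ge_1)
  have pot: "potential f deg = (\<Sum>a\<in>f ` V. ?p a + cap)"
    using D(1) by (simp add: potential_def D0_def)
  have img: "f' ` V = (f ` V - M) \<union> Q ` M"
  proof
    show "f' ` V \<subseteq> (f ` V - M) \<union> Q ` M" by (auto simp: f'_def coarsen_def)
    show "(f ` V - M) \<union> Q ` M \<subseteq> f' ` V"
    proof
      fix b assume "b \<in> (f ` V - M) \<union> Q ` M"
      then consider x where "x \<in> V" "f x \<notin> M" "b = f x" | a where "a \<in> M" "b = Q a" by blast
      then show "b \<in> f' ` V"
      proof cases
        case 1
        then show ?thesis by (auto simp: f'_def coarsen_def image_iff intro!: bexI[of _ x])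
      next
        case 2
        then obtain x where "x \<in> V" "f x = a" using M_sub by blast
        then show ?thesis using 2 by (auto simp: f'_def coarsen_def image_iff intro!: bexI[of _ x])
      qed
    qed
  qed
  have split: "(\<Sum>a\<in>f ` V. ?p a + cap) = (\<Sum>a\<in>f ` V - M. ?p a + cap) + (\<Sum>a\<in>M. ?p a + cap)"
    using M_sub by (intro sum.subset_diff) auto
  show ?thesis
  proof (cases "D1 \<le> 0")
    \<comment> \<open>With no weight left the new potential is zero by definition, and the old one
      alone covers the active vertices.\<close>
    case True
    then show ?thesis using card_active_le_potential[OF c(1) D(1)] M
      by (simp add: potential_def D1_def f'_def)
  next
    case False
    have mono: "?p' a \<le> ?p a" if a: "a \<in> f ` V - M" for a
    proof (cases "deg a \<le> 0")
      case True
      then show ?thesis using le_cap(2)[of a] by (simp add: vertex_potential_def)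
    next
      case f: False
      have "D1 / deg a \<le> D0 / deg a" using D f by (intro divide_right_mono) (auto simp: D0_def D1_def f'_def)
      then have "log43 (D1 / deg a) \<le> log43 (D0 / deg a)" using False f by (intro log43_mono) auto
      then show ?thesis using f a deg'[of a] by (auto simp: vertex_potential_def)
    qed
    have block: "?p' b + cap + real (card {a\<in>M. Q a = b}) \<le> (\<Sum>a\<in>{a\<in>M. Q a = b}. ?p a + cap)" if b: "b \<in> Q ` M" for b
    proof (cases "card {a\<in>M. Q a = b} = 1")
      case True
      then obtain a where a: "{a\<in>M. Q a = b} = {a}" by (auto simp: card_1_singleton_iff)
      then have aM: "a \<in> M" "Q a = b" by auto
      have bM: "b \<in> M" using b Q by blast
      have "cls V f' b = cls V f a"
        unfolding f'_def cls_coarsen[OF Q bM] using a by (auto simp: act_def cls_def)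
      moreover have "b \<in> f' ` V" using img b by blast
      \<comment> \<open>\<open>Q\<close> may rename a vertex that it merges with nothing. The class
        is the same set, so the degree survives the renaming; and as the vertex is active, the
        minimum with \<open>cap\<close> does not hide the decrease.\<close>
      ultimately have deg_eq: "deg' b = deg a"
        using consistentD[OF c(2)] consistentD[OF c(1), of a] aM M_sub by (simp add: f'_def subsetD)
      have act: "D0 \<le> 4 * real n * deg a" using aM M by (simp add: active_def D0_def)
      then have pos: "0 < deg a" using D(1) n1 unfolding D0_def
        by (metis less_le_trans mult_eq_0_iff mult_less_0_iff not_less_iff_gr_or_eq of_nat_0_le_iff linorder_not_le mult_nonneg_nonneg zero_le_numeral)
      have "D0 / deg a \<le> 4 * real n" using act pos by (simp add: divide_le_eq)
      then have "log43 (D0 / deg a) \<le> log43 (4 * real n)" using pos D(1) by (intro log43_mono) (auto simp: D0_def)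
      then have p: "?p a = 1 + log43 (D0 / deg a)" using pos by (simp add: vertex_potential_def cap_def)
      have "log43 (D1 / deg a) \<le> log43 (3 / 4 * (D0 / deg a))"
        using D(2) pos False by (intro log43_mono) (auto simp: D0_def D1_def f'_def divide_right_mono field_simps)
      also have "\<dots> = log43 (D0 / deg a) - 1" using D(1) pos by (intro log43_shrink) (auto simp: D0_def)
      finally have "?p' b \<le> ?p a - 1" using pos p by (simp add: vertex_potential_def deg_eq)
      then show ?thesis using a by simp
    next
      case F: False
      have "{a\<in>M. Q a = b} \<noteq> {}" using b by auto
      then have "card {a\<in>M. Q a = b} \<noteq> 0" using finM by auto
      then have k2: "2 \<le> card {a\<in>M. Q a = b}" using F by linarith
      have "?p' b + cap \<le> 2 * cap" using le_cap by simp
      also have "\<dots> \<le> real (card {a\<in>M. Q a = b}) * cap" using k2 cap1 by (intro mult_right_mono) auto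
      finally have "?p' b + cap + real (card {a\<in>M. Q a = b}) \<le> (\<Sum>a\<in>{a\<in>M. Q a = b}. 1 + cap)"
        by (simp add: algebra_simps)
      also have "\<dots> \<le> (\<Sum>a\<in>{a\<in>M. Q a = b}. ?p a + cap)" using ge1 M_sub by (intro sum_mono) auto
      finally show ?thesis .
    qed
    have "potential f' deg' = (\<Sum>a\<in>(f ` V - M) \<union> Q ` M. ?p' a + cap)"
      using False by (simp add: potential_def D1_def img)
    also have "\<dots> = (\<Sum>a\<in>f ` V - M. ?p' a + cap) + (\<Sum>b\<in>Q ` M. ?p' b + cap)"
      using Q finM by (intro sum.union_disjoint) auto
    also have "\<dots> \<le> (\<Sum>a\<in>f ` V - M. ?p a + cap) + (\<Sum>b\<in>Q ` M. ?p' b + cap)"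
      using mono by (intro add_right_mono sum_mono) auto
    finally have "potential f' deg' + real (card M)
        \<le> (\<Sum>a\<in>f ` V - M. ?p a + cap) + ((\<Sum>b\<in>Q ` M. ?p' b + cap) + real (card M))" by simp
    also have "(\<Sum>b\<in>Q ` M. ?p' b + cap) + real (card M)
        = (\<Sum>b\<in>Q ` M. ?p' b + cap) + (\<Sum>b\<in>Q ` M. real (card {a\<in>M. Q a = b}))"
      using sum.group[OF finM _ subset_refl, of Q "\<lambda>_. 1::real"] finM by simp
    also have "(\<Sum>b\<in>Q ` M. ?p' b + cap) + (\<Sum>b\<in>Q ` M. real (card {a\<in>M. Q a = b}))
        \<le> (\<Sum>b\<in>Q ` M. \<Sum>a\<in>{a\<in>M. Q a = b}. ?p a + cap)"
      using block by (subst sum.distrib[symmetric], intro sum_mono) auto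
    also have "\<dots> = (\<Sum>a\<in>M. ?p a + cap)" using finM by (intro sum.group) auto
    finally show ?thesis using split pot by (simp add: f'_def)
  qed
qed

end

lemma norm_pmf_cong: "(\<And>i. i \<in> I \<Longrightarrow> x i = y i) \<Longrightarrow> norm_pmf I x = norm_pmf I y"
  unfolding norm_pmf_def by (simp cong: sum.cong if_cong ball_cong)

lemma sample_edge_cong: "(\<And>i. i \<in> I \<Longrightarrow> x i = y i) \<Longrightarrow> sample_edge V b I A B x = sample_edge V b I A B y"
  unfolding sample_edge_def using norm_pmf_cong[of I x y] by simp

lemma sample_graph_commute: "sample_graph f xs a b = sample_graph f xs b a"
  by (simp add: sample_graph_def add.commute)

lemma admissible_exists:
  assumes "finite M" "M \<noteq> {}" "0 \<le> t"
  shows "admissible M (sample_graph f xs) t (SOME Q. admissible M (sample_graph f xs) t Q)"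
  using strong_partition_exists[OF assms(1,2) sample_graph_commute assms(3)]
  unfolding admissible_def by (rule someI_ex)

context query_graph
begin

section \<open>Distribution of the sampled edges\<close>

definition edge_sampler :: "nat \<Rightarrow> (nat \<Rightarrow> nat) \<Rightarrow> nat set \<Rightarrow> (nat \<times> nat \<times> nat) pmf" where
  "edge_sampler b f M = out F (sample_edge V b M (cls V f) (\<lambda>a. act f M - cls V f a)
     (\<lambda>a. cw G (cls V f a) (act f M - cls V f a)))"

lemma cut_table:
  assumes "A \<subseteq> V" "B \<subseteq> V" "A \<inter> B = {}" "A \<in> set Ss" "B \<in> set Ss" "A \<union> B \<in> set Ss"
  shows "cut_between (\<lambda>S. if S \<in> set Ss then F (S \<inter> V) else 0) A B = cw G A B"
proof -
  have "A \<inter> V = A" "B \<inter> V = B" "(A \<union> B) \<inter> V = A \<union> B" using assms by auto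
  then show ?thesis using assms by (intro cut_between_eq_cw) auto
qed

lemma cls_Un_act: "a \<in> M \<Longrightarrow> cls V f a \<union> (act f M - cls V f a) = act f M"
  by (auto simp: cls_def act_def)

definition active_queries :: "(nat \<Rightarrow> nat) \<Rightarrow> nat set \<Rightarrow> nat set list" where
  "active_queries f M = map (cls V f) (sorted_list_of_set M) @
    map (\<lambda>a. act f M - cls V f a) (sorted_list_of_set M) @ [act f M]"

lemma sample_active_eq:
  "sample_active V b N f M = bind_alg (ask_all V (active_queries f M)) (\<lambda>T.
     bind_alg (repeat_alg N (sample_edge V b M (cls V f) (\<lambda>a. act f M - cls V f a)
         (\<lambda>a. cut_between T (cls V f a) (act f M - cls V f a))))
       (\<lambda>xs. Return (\<Sum>a\<in>M. cut_between T (cls V f a) (act f M - cls V f a), xs)))"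
  by (simp add: sample_active_def active_queries_def act_def Let_def)

lemma cut_active_queries:
  assumes "finite M" "a \<in> M"
  shows "cut_between (\<lambda>S. if S \<in> set (active_queries f M) then F (S \<inter> V) else 0) (cls V f a) (act f M - cls V f a) =
    cw G (cls V f a) (act f M - cls V f a)"
proof (rule cut_table)
  show "act f M - cls V f a \<subseteq> V" using act_subset[of f M] by blast
  show "cls V f a \<in> set (active_queries f M)" "act f M - cls V f a \<in> set (active_queries f M)"
      "cls V f a \<union> (act f M - cls V f a) \<in> set (active_queries f M)"
    using assms unfolding cls_Un_act[OF assms(2)] active_queries_def by auto
qed (auto simp: cls_subset)

lemma sum_cut_active_queries:
  assumes "M \<subseteq> f ` V" "finite M"
  shows "(\<Sum>a\<in>M. cut_between (\<lambda>S. if S \<in> set (active_queries f M) then F (S \<inter> V) else 0)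
    (cls V f a) (act f M - cls V f a)) = active_weight f M"
  unfolding active_weight_eq[OF assms(1)] by (rule sum.cong[OF refl]) (rule cut_active_queries[OF assms(2)])

lemma out_sample_active:
  assumes "M \<subseteq> f ` V" "finite M"
  shows "out F (sample_active V b N f M) = map_pmf (Pair (active_weight f M)) (replicate_pmf N (edge_sampler b f M))"
proof -
  let ?T = "\<lambda>S. if S \<in> set (active_queries f M) then F (S \<inter> V) else 0"
  have "sample_edge V b M (cls V f) (\<lambda>a. act f M - cls V f a) (\<lambda>a. cut_between ?T (cls V f a) (act f M - cls V f a))
      = sample_edge V b M (cls V f) (\<lambda>a. act f M - cls V f a) (\<lambda>a. cw G (cls V f a) (act f M - cls V f a))"
    by (rule sample_edge_cong) (rule cut_active_queries[OF assms(2)])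
  then show ?thesis
    unfolding sample_active_eq out_bind_alg out_ask_all bind_return_pmf sum_cut_active_queries[OF assms] out_repeat_alg
    by (simp add: map_pmf_def edge_sampler_def)
qed

lemma outcome_sample_active:
  assumes "M \<subseteq> f ` V" "finite M" "1 \<le> card M"
  shows "outcome F (sample_active V b N f M) (\<lambda>(Y, xs). Y = active_weight f M)
    (3 * real (card M) + real N * (10 * real b))"
  unfolding sample_active_eq
proof (rule outcome_bind_alg)
  let ?T = "\<lambda>S. if S \<in> set (active_queries f M) then F (S \<inter> V) else 0"
  show "outcome F (ask_all V (active_queries f M)) (\<lambda>T. T = ?T) (3 * real (card M))"
    using assms(2,3) by (intro outcome_ask_all) (simp add: active_queries_def)
  fix T assume T: "T = ?T"
  show "outcome F (bind_alg (repeat_alg N (sample_edge V b M (cls V f) (\<lambda>a. act f M - cls V f a)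
         (\<lambda>a. cut_between T (cls V f a) (act f M - cls V f a))))
       (\<lambda>xs. Return (\<Sum>a\<in>M. cut_between T (cls V f a) (act f M - cls V f a), xs)))
     (\<lambda>(Y, xs). Y = active_weight f M) (real N * (10 * real b))"
    unfolding T sum_cut_active_queries[OF assms(1,2)]
    by (rule outcome_bind_alg[OF outcome_repeat_alg[OF outcome_sample_edge]], rule outcome_Return[where c = 0]) auto
qed simp

text \<open>The drawn index is the label of \<open>u\<close>, so the triple is determined by the
  ordered pair, which is drawn with probability proportional to its weight.\<close>

lemma edge_sampler_expectation:
  assumes M: "M \<subseteq> f ` V" "finite M" and b: "n < 2 ^ b" and pos: "0 < active_weight f M"
  shows "measure_pmf.expectation (edge_sampler b f M) (\<lambda>(i, u, v). g u v) =
      (\<Sum>u\<in>act f M. \<Sum>v\<in>act f M. if f u \<noteq> f v then G u v * g u v else 0) / active_weight f M"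
    and "(i, u, v) \<in> set_pmf (edge_sampler b f M) \<Longrightarrow> u \<in> act f M \<and> v \<in> act f M \<and> f u \<noteq> f v"
proof -
  define U where "U = act f M"
  define p where "p = edge_sampler b f M"
  have pmf: "pmf p (i, u, v) =
      (if i \<in> M \<and> u \<in> cls V f i \<and> v \<in> U - cls V f i then 1 * G u v / active_weight f M else 0)" for i u v
    unfolding p_def edge_sampler_def active_weight_eq[OF M(1)] U_def
  proof (rule pmf_sample_edge[OF b M(2)])
    fix i assume "i \<in> M"
    show "cls V f i \<subseteq> V \<and> act f M - cls V f i \<subseteq> V \<and> cls V f i \<inter> (act f M - cls V f i) = {} \<and> 0 \<le> (1::real) \<and>
        cw G (cls V f i) (act f M - cls V f i) = 1 * cw G (cls V f i) (act f M - cls V f i)"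
      using cls_subset[of V f i] act_subset[of f M] by auto
  qed (use pos active_weight_eq[OF M(1)] in simp)
  have supp: "u \<in> U \<and> v \<in> U \<and> f u \<noteq> f v \<and> i = f u" if "(i, u, v) \<in> set_pmf p" for i u v
    using that pmf[of i u v] by (auto simp: set_pmf_iff cls_def U_def act_def split: if_splits)
  then show "(i, u, v) \<in> set_pmf (edge_sampler b f M) \<Longrightarrow> u \<in> act f M \<and> v \<in> act f M \<and> f u \<noteq> f v"
    unfolding p_def U_def by blast
  have "measure_pmf.expectation p (\<lambda>(i, u, v). g u v)
      = (\<Sum>x\<in>(\<lambda>(u, v). (f u, u, v)) ` (U \<times> U). (case x of (i, u, v) \<Rightarrow> g u v) * pmf p x)"
  proof (rule integral_measure_pmf_real)
    show "finite ((\<lambda>(u, v). (f u, u, v)) ` (U \<times> U))" by (simp add: U_def)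
    fix x assume "x \<in> set_pmf p"
    then show "x \<in> (\<lambda>(u, v). (f u, u, v)) ` (U \<times> U)" using supp by (cases x) force
  qed
  also have "\<dots> = (\<Sum>(u, v)\<in>U \<times> U. g u v * pmf p (f u, u, v))"
    by (subst sum.reindex) (auto simp: inj_on_def case_prod_unfold)
  also have "\<dots> = (\<Sum>(u, v)\<in>U \<times> U. (if f u \<noteq> f v then G u v * g u v else 0) / active_weight f M)"
    by (rule sum.cong[OF refl]) (auto simp: pmf U_def act_def cls_def)
  also have "\<dots> = (\<Sum>u\<in>U. \<Sum>v\<in>U. (if f u \<noteq> f v then G u v * g u v else 0)) / active_weight f M"
    by (simp add: sum.cartesian_product case_prod_unfold sum_divide_distrib)
  finally show "measure_pmf.expectation (edge_sampler b f M) (\<lambda>(i, u, v). g u v) =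
      (\<Sum>u\<in>act f M. \<Sum>v\<in>act f M. if f u \<noteq> f v then G u v * g u v else 0) / active_weight f M"
    by (simp add: p_def U_def)
qed

section \<open>Query cost and total weight of the groups\<close>

definition group_weight :: "group list \<Rightarrow> real" where
  "group_weight L = (\<Sum>(A, B, kap)\<leftarrow>L. cw G A B / kap)"

definition valid_groups :: "group list \<Rightarrow> bool" where
  "valid_groups L \<longleftrightarrow> (\<forall>(A, B, kap)\<in>set L. A \<subseteq> V \<and> B \<subseteq> V \<and> A \<inter> B = {} \<and> 0 < kap)"

lemma group_weight_simps [simp]:
  "group_weight [] = 0" "group_weight (L @ L') = group_weight L + group_weight L'"
  by (simp_all add: group_weight_def)

lemma valid_groups_simps [simp]:
  "valid_groups []" "valid_groups (L @ L') \<longleftrightarrow> valid_groups L \<and> valid_groups L'"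
  by (simp_all add: valid_groups_def ball_Un)

lemma valid_new_groups: "0 < kap \<Longrightarrow> valid_groups (new_groups V f M Q kap)"
  using cls_subset by (fastforce simp: valid_groups_def new_groups_def)

lemma group_weight_new_groups:
  assumes "Q ` M \<subseteq> M" "M \<subseteq> f ` V" "finite M"
  shows "group_weight (new_groups V f M Q kap) = (active_weight f M - split_weight (act f M) (Q \<circ> f)) / kap"
proof -
  have "group_weight (new_groups V f M Q kap) =
     (\<Sum>a\<in>M. cw G (cls V f a) (cls V (coarsen f M Q) (Q a) - cls V f a) / kap)"
    using assms(3) by (simp add: group_weight_def new_groups_def o_def sum_list_distinct_conv_sum_set)
  also have "\<dots> = (\<Sum>a\<in>M. cw G (cls V f a) (cls V (coarsen f M Q) (Q a) - cls V f a)) / kap"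
    by (simp add: sum_divide_distrib)
  finally show ?thesis using sum_new_groups[OF assms] by simp
qed

definition new_deg :: "(nat \<Rightarrow> nat) \<Rightarrow> nat set \<Rightarrow> (nat \<Rightarrow> nat) \<Rightarrow> (nat \<Rightarrow> real) \<Rightarrow> nat \<Rightarrow> real" where
  "new_deg f M Q deg a = (if a \<in> M then F (cls V (coarsen f M Q) a) else deg a)"

lemma consistent_new_deg:
  assumes c: "consistent f deg" and Q: "Q ` M \<subseteq> M"
  shows "consistent (coarsen f M Q) (new_deg f M Q deg)"
  unfolding consistent_def
proof
  fix a assume a: "a \<in> coarsen f M Q ` V"
  show "new_deg f M Q deg a = F (cls V (coarsen f M Q) a)"
  proof (cases "a \<in> M")
    case False
    have "coarsen f M Q x = a \<longleftrightarrow> f x = a" for x using False Q by (auto simp: coarsen_def)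
    moreover obtain x where "x \<in> V" "coarsen f M Q x = a" using a by blast
    ultimately have "cls V (coarsen f M Q) a = cls V f a" "a \<in> f ` V" by (auto simp: cls_def)
    then show ?thesis using consistentD[OF c] False by (simp add: new_deg_def)
  qed (simp add: new_deg_def)
qed

lemma degree_table:
  assumes "finite M"
  shows "(\<lambda>a. if a \<in> M then (\<lambda>S. if S \<in> set (map (cls V (coarsen f M Q)) (sorted_list_of_set M)) then F (S \<inter> V) else 0)
      (cls V (coarsen f M Q) a) else deg a) = new_deg f M Q deg"
proof -
  have "cls V g a \<inter> V = cls V g a" for g a using cls_subset by blast
  then show ?thesis using assms by (auto simp: new_deg_def fun_eq_iff)
qed

lemma outcome_round_step:
  assumes Q: "Q = partition_of f M N xs" and f': "f' = coarsen f M Q" and deg': "deg' = new_deg f M Q deg"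
    and kap': "kap' = min kap (Y / (32 * real (card M)))" and M: "finite M"
    and "outcome F (if sum deg' (f' ` V) > 3 / 4 * sum deg (f ` V) then Return []
    else bind_alg (rec f' deg' kap') (\<lambda>L. Return (new_groups V f M Q kap' @ L))) R c"
  shows "outcome F (round_step V f deg kap M N rec Y xs) R (real (card M) + c)"
  unfolding round_step_def Let_def Q[symmetric] f'[symmetric] kap'[symmetric]
  by (rule outcome_bind_alg[OF outcome_ask_all[where c = "real (card M)"] _ order_refl])
    (use assms(6) in \<open>simp_all only: degree_table[OF M] f' deg' length_map
       length_sorted_list_of_set order_refl\<close>)

lemma out_round_step:
  assumes Q: "Q = partition_of f M N xs" and f': "f' = coarsen f M Q" and deg': "deg' = new_deg f M Q deg"
    and kap': "kap' = min kap (Y / (32 * real (card M)))" and M: "finite M"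
    and "sum deg' (f' ` V) \<le> 3 / 4 * sum deg (f ` V)"
  shows "out F (round_step V f deg kap M N rec Y xs) =
    map_pmf (\<lambda>L. new_groups V f M Q kap' @ L) (out F (rec f' deg' kap'))"
proof -
  have "\<not> sum deg' (f' ` V) > 3 / 4 * sum deg (f ` V)" using assms(6) by simp
  then show ?thesis
    unfolding round_step_def Let_def Q[symmetric] f'[symmetric] kap'[symmetric]
      out_bind_alg out_ask_all bind_return_pmf
    by (simp only: degree_table[OF M] f' deg' if_False out_bind_alg map_pmf_def out_Return)
qed

lemma active_nonempty:
  assumes "consistent f deg" "0 < sum deg (f ` V)"
  shows "0 < active_weight f (active V f deg)" "1 \<le> card (active V f deg)"
proof -
  show *: "0 < active_weight f (active V f deg)" using active_weight_ge_half[OF assms] assms(2) by linarith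
  then have "active V f deg \<noteq> {}"
    by (auto simp: active_weight_def act_def split_weight_def crossing_def)
  then show "1 \<le> card (active V f deg)" by (simp add: Suc_le_eq card_gt_0_iff)
qed

text \<open>A round costs at most \<open>4 + 10 * b * (c + 1)\<close> queries per active vertex, and
  the potential drops by the number of active vertices. For the group weight the factor 4 reproduces
  itself: the new groups weigh at most \<open>D / kap'\<close>, the recursion adds
  \<open>3 * D / kap'\<close> because 3/4 of \<open>D\<close> is left, and passing from
  \<open>kap'\<close> to \<open>kap\<close> costs \<open>4 * 64 = 256\<close> per active
  vertex.\<close>

lemma outcome_contract:
  assumes "consistent f deg" "0 < kap" "0 \<le> c"
  shows "outcome F (contract V b c k f deg kap)
    (\<lambda>L. valid_groups L \<and> real (length L) \<le> potential f deg \<and>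
       group_weight L \<le> 4 * sum deg (f ` V) / kap + 256 * potential f deg)
    ((4 + 10 * real b * (c + 1)) * potential f deg)"
  using assms(1,2)
proof (induction k arbitrary: f deg kap)
  case 0
  have "0 \<le> sum deg (f ` V)" using consistent_sum[OF 0(1)] split_weight_nonneg by simp
  then show ?case using potential_nonneg[OF 0(1)] 0(2) assms(3) by (auto intro!: outcome_Return)
next
  case (Suc k)
  note cons = Suc.prems(1)
  define D where "D = sum deg (f ` V)"
  have Dnn: "0 \<le> D" using consistent_sum[OF cons] split_weight_nonneg by (simp add: D_def)
  note pot = potential_nonneg[OF cons]
  show ?case
  proof (cases "D \<le> 0")
    case True
    then show ?thesis using pot Suc.prems(2) Dnn assms(3)
      by (auto simp: D_def intro!: outcome_Return)
  next
    case False
    then have D: "0 < D" by simp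
    define M where "M = active V f deg"
    define m where "m = real (card M)"
    define N where "N = nat \<lceil>c * m\<rceil>"
    define Y where "Y = active_weight f M"
    define kap' where "kap' = min kap (Y / (32 * m))"
    have M: "M \<subseteq> f ` V" "finite M" using active_subset by (auto simp: M_def)
    have Y: "D / 2 \<le> Y" using active_weight_ge_half[OF cons] D by (simp add: D_def Y_def M_def)
    have m1: "1 \<le> card M" using active_nonempty(2)[OF cons] D by (simp add: D_def M_def)
    then have m: "1 \<le> m" by (simp add: m_def)
    have kap': "0 < kap'" using Suc.prems(2) D Y m by (simp add: kap'_def)
    have N: "real N \<le> (c + 1) * m"
    proof -
      have "real N \<le> c * m + 1" unfolding N_def using assms(3) m by (simp add: of_nat_nat)
      then show ?thesis using m by (simp add: algebra_simps)
    qed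
    \<comment> \<open>If the scale shrinks, then \<open>kap' = Y / (32 * m)\<close>, and
      \<open>D \<le> 2 * Y\<close> gives 64.\<close>
    have DK: "D / kap' \<le> D / kap + 64 * m"
    proof -
      have "D / (Y / (32 * m)) \<le> 64 * m"
        using Y D m by (simp add: divide_le_eq mult.commute)
      moreover have "0 \<le> D / (Y / (32 * m))" "0 \<le> D / kap" using D Y m Suc.prems(2) by auto
      ultimately show ?thesis using m by (auto simp: kap'_def min_def)
    qed
    let ?c0 = "4 + 10 * real b * (c + 1)"
    let ?R = "\<lambda>L. valid_groups L \<and> real (length L) \<le> potential f deg \<and>
       group_weight L \<le> 4 * D / kap + 256 * potential f deg"
    have contract: "contract V b c (Suc k) f deg kap = bind_alg (sample_active V b N f M)
        (\<lambda>(Y, xs). round_step V f deg kap M N (contract V b c k) Y xs)"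
      using False by (simp add: Let_def M_def N_def m_def D_def)
    show ?thesis
      unfolding contract D_def[symmetric]
    proof (rule outcome_bind_alg[OF outcome_sample_active[OF M m1]])
      fix Yxs :: "real \<times> (nat \<times> nat \<times> nat) list"
      assume "case Yxs of (Y, xs) \<Rightarrow> Y = active_weight f M"
      then obtain xs where Yxs: "Yxs = (Y, xs)" by (cases Yxs) (simp add: Y_def)
      define Q where "Q = partition_of f M N xs"
      define f' where "f' = coarsen f M Q"
      define deg' where "deg' = new_deg f M Q deg"
      have "admissible M (sample_graph f xs) (real N / (4 * m)) Q"
        unfolding Q_def partition_of_def m_def using M m1 by (intro admissible_exists) auto
      then have Q: "Q ` M \<subseteq> M" by (simp add: admissible_def)
      have cons': "consistent f' deg'"
        unfolding f'_def deg'_def using cons Q by (rule consistent_new_deg)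
      have "outcome F (if sum deg' (f' ` V) > 3 / 4 * D then Return []
          else bind_alg (contract V b c k f' deg' kap') (\<lambda>L. Return (new_groups V f M Q kap' @ L)))
        ?R (?c0 * (potential f deg - m))"
      proof (cases "sum deg' (f' ` V) > 3 / 4 * D")
        case True
        have "m \<le> potential f deg"
          using card_active_le_potential[OF cons] D by (simp add: m_def M_def D_def)
        then show ?thesis
          using True pot D Suc.prems(2) assms(3) by (auto intro!: outcome_Return)
      next
        case False
        have step: "potential f' deg' + m \<le> potential f deg"
          unfolding f'_def m_def using M_def Q cons cons'[unfolded f'_def] D False
          by (intro potential_step) (auto simp: deg'_def new_deg_def D_def f'_def)
        have len: "real (length (new_groups V f M Q kap')) = m" by (simp add: new_groups_def m_def)
        have gw: "group_weight (new_groups V f M Q kap') \<le> D / kap'"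
        proof -
          have "active_weight f M - split_weight (act f M) (Q \<circ> f) \<le> D"
            using split_weight_coarsen[OF Q, of f] split_weight_nonneg[of V "coarsen f M Q"] consistent_sum[OF cons] by (simp add: D_def)
          then show ?thesis unfolding group_weight_new_groups[OF Q M]
            using kap' by (intro divide_right_mono) auto
        qed
        have "outcome F (bind_alg (contract V b c k f' deg' kap') (\<lambda>L. Return (new_groups V f M Q kap' @ L)))
           ?R (?c0 * (potential f deg - m))"
        proof (rule outcome_bind_alg[OF Suc.IH[OF cons' kap']], rule outcome_Return[where c = 0])
          fix L assume L: "valid_groups L \<and> real (length L) \<le> potential f' deg' \<and>
             group_weight L \<le> 4 * sum deg' (f' ` V) / kap' + 256 * potential f' deg'"
          have "4 * sum deg' (f' ` V) / kap' \<le> 3 * (D / kap')"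
            using False kap' by (simp add: field_simps)
          then have "group_weight (new_groups V f M Q kap' @ L) \<le> 4 * (D / kap') + 256 * potential f' deg'"
            using L gw by simp
          also have "\<dots> \<le> 4 * (D / kap) + 256 * potential f deg" using DK step by linarith
          finally show "?R (new_groups V f M Q kap' @ L)"
            using L step len valid_new_groups[OF kap'] by simp
        next
          show "?c0 * potential f' deg' + 0 \<le> ?c0 * (potential f deg - m)"
            using step assms(3) by (simp add: mult_left_mono)
        qed simp
        then show ?thesis using False by simp
      qed
      then show "outcome F (case Yxs of (Y, xs) \<Rightarrow> round_step V f deg kap M N (contract V b c k) Y xs)
          ?R (real (card M) + ?c0 * (potential f deg - m))"
        unfolding Yxs prod.case D_def by (intro outcome_round_step[OF Q_def f'_def deg'_def _ M(2)])
          (simp_all only: kap'_def m_def)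
    next
      have "real N * (10 * real b) \<le> (c + 1) * m * (10 * real b)" using N by (intro mult_right_mono) auto
      then show "3 * real (card M) + real N * (10 * real b) + (real (card M) + ?c0 * (potential f deg - m)) \<le> ?c0 * potential f deg"
        by (simp add: m_def algebra_simps)
    qed
  qed
qed

section \<open>Invariants of the contraction and failure of a round\<close>

definition strongly_merged :: "(nat \<Rightarrow> nat) \<Rightarrow> real \<Rightarrow> bool" where
  "strongly_merged f kap \<longleftrightarrow> (\<forall>u\<in>V. \<forall>v\<in>V. u \<noteq> v \<longrightarrow> f u = f v \<longrightarrow> kap \<le> strength G V u v)"

text \<open>Stated relative to a labelling for the recursion: \<open>L\<close> has to account for
  exactly the edges not yet contracted by \<open>f\<close>. For the identity this makes every edge,
  in either order, belong to one group, which the sampling of the second stage relies on.\<close>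

definition good_groups :: "(nat \<Rightarrow> nat) \<Rightarrow> group list \<Rightarrow> bool" where
  "good_groups f L \<longleftrightarrow>
    (\<forall>u v. 0 < G u v \<longrightarrow> (\<Sum>(A, B, kap)\<leftarrow>L. of_bool (u \<in> A \<and> v \<in> B)) = (of_bool (f u \<noteq> f v) :: real)) \<and>
    (\<forall>(A, B, kap)\<in>set L. \<forall>u\<in>A. \<forall>v\<in>B. kap \<le> strength G V u v)"

lemma good_groups_step:
  assumes M: "finite M" and Q: "Q ` M \<subseteq> M"
    and inv: "strongly_merged (coarsen f M Q) kap" and L: "good_groups (coarsen f M Q) L"
  shows "good_groups f (new_groups V f M Q kap @ L)"
proof -
  define f' where "f' = coarsen f M Q"
  have count: "(\<Sum>(A, B, kap)\<leftarrow>new_groups V f M Q kap. of_bool (u \<in> A \<and> v \<in> B)) =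
      (of_bool (f u \<noteq> f v \<and> f' u = f' v) :: real)" if uv: "u \<in> V" "v \<in> V" for u v
  proof -
    have "(\<Sum>(A, B, kap)\<leftarrow>new_groups V f M Q kap. of_bool (u \<in> A \<and> v \<in> B)) =
        (\<Sum>a\<in>M. of_bool (u \<in> cls V f a \<and> v \<in> cls V f' (Q a) - cls V f a) :: real)"
      using M by (simp add: new_groups_def f'_def o_def sum_list_distinct_conv_sum_set)
    also have "\<dots> = (\<Sum>a\<in>M. if f u = a then of_bool (f' v = Q a \<and> f v \<noteq> a) else 0)"
      using uv by (intro sum.cong refl) (auto simp: cls_def)
    also have "\<dots> = (if f u \<in> M then of_bool (f' v = Q (f u) \<and> f v \<noteq> f u) else 0)"
      using M by simp
    also have "\<dots> = of_bool (f u \<noteq> f v \<and> f' u = f' v)"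
      using Q by (auto simp: f'_def coarsen_def split: if_splits)
    finally show ?thesis .
  qed
  have "(\<Sum>(A, B, kap)\<leftarrow>new_groups V f M Q kap @ L. of_bool (u \<in> A \<and> v \<in> B)) = (of_bool (f u \<noteq> f v) :: real)"
    if "0 < G u v" for u v
  proof -
    have uv: "u \<in> V" "v \<in> V" using G_support[of u v] that by auto
    have "(\<Sum>(A, B, kap)\<leftarrow>L. of_bool (u \<in> A \<and> v \<in> B)) = (of_bool (f' u \<noteq> f' v) :: real)"
      using L that by (simp add: good_groups_def f'_def)
    then show ?thesis using count[OF uv] by (auto simp: f'_def coarsen_def)
  qed
  moreover have "\<forall>(A, B, kap)\<in>set (new_groups V f M Q kap @ L). \<forall>u\<in>A. \<forall>v\<in>B. kap \<le> strength G V u v"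
  proof -
    have "kap \<le> strength G V u v" if a: "a \<in> M" "u \<in> cls V f a" "v \<in> cls V f' (Q a) - cls V f a" for a u v
    proof -
      have "u \<in> V" "v \<in> V" "u \<noteq> v" "f' u = f' v" using a by (auto simp: cls_def f'_def coarsen_def)
      then show ?thesis using inv unfolding strongly_merged_def f'_def by blast
    qed
    then show ?thesis using L M by (auto simp: new_groups_def f'_def good_groups_def)
  qed
  ultimately show ?thesis unfolding good_groups_def by blast
qed

lemma cw_sample_graph:
  assumes "finite X" "finite Z"
  shows "cw (sample_graph f xs) X Z =
    (\<Sum>(i, u, v)\<leftarrow>xs. of_bool (f u \<in> X \<and> f v \<in> Z) + of_bool (f v \<in> X \<and> f u \<in> Z))"
proof (induction xs)
  case Nil
  show ?case by (simp add: sample_graph_def cw_def)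
next
  case (Cons x xs)
  obtain i u v where x: "x = (i, u, v)" by (cases x) auto
  have one: "(\<Sum>a\<in>X. \<Sum>b\<in>Z. of_bool (p = a \<and> q = b)) = (of_bool (p \<in> X \<and> q \<in> Z) :: real)" for p q
    using assms by (simp add: of_bool_conj flip: sum_distrib_left sum_distrib_right)
  have "cw (sample_graph f (x # xs)) X Z = (\<Sum>a\<in>X. \<Sum>b\<in>Z. of_bool (f u = a \<and> f v = b))
      + (\<Sum>a\<in>X. \<Sum>b\<in>Z. of_bool (f v = a \<and> f u = b)) + cw (sample_graph f xs) X Z"
    by (simp add: sample_graph_def cw_def x sum.distrib conj_commute add.assoc)
  then show ?case unfolding one Cons by (simp add: x)
qed

lemma crossing_sample_graph:
  assumes "finite M" "\<And>i u v. (i, u, v) \<in> set xs \<Longrightarrow> f u \<in> M \<and> f v \<in> M"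
  shows "crossing (sample_graph f xs) M Q = 2 * (\<Sum>(i, u, v)\<leftarrow>xs. of_bool (Q (f u) \<noteq> Q (f v)))"
  using assms(2)
proof (induction xs)
  case Nil
  show ?case by (simp add: sample_graph_def crossing_def)
next
  case (Cons x xs)
  obtain i u v where x: "x = (i, u, v)" by (cases x) auto
  have uv: "f u \<in> M" "f v \<in> M" using Cons.prems[of i u v] x by auto
  have one: "(\<Sum>a\<in>M. \<Sum>b\<in>M. if Q a \<noteq> Q b then of_bool (p = a \<and> q = b) else 0) = (of_bool (Q p \<noteq> Q q) :: real)"
    if "p \<in> M" "q \<in> M" for p q
  proof -
    have "(\<Sum>a\<in>M. \<Sum>b\<in>M. if Q a \<noteq> Q b then of_bool (p = a \<and> q = b) else 0)
        = (\<Sum>a\<in>M. if p = a then (\<Sum>b\<in>M. if q = b then of_bool (Q a \<noteq> Q b) else 0) else (0::real))"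
      by (intro sum.cong refl) (auto intro!: sum.cong sum.neutral)
    then show ?thesis using assms(1) that by simp
  qed
  have "crossing (sample_graph f (x # xs)) M Q =
       (\<Sum>a\<in>M. \<Sum>b\<in>M. if Q a \<noteq> Q b then of_bool (f u = a \<and> f v = b) else 0)
     + (\<Sum>a\<in>M. \<Sum>b\<in>M. if Q a \<noteq> Q b then of_bool (f v = a \<and> f u = b) else 0) + crossing (sample_graph f xs) M Q"
    unfolding crossing_def sum.distrib[symmetric]
    by (intro sum.cong refl) (auto simp: sample_graph_def x conj_commute)
  also have "\<dots> = 2 * of_bool (Q (f u) \<noteq> Q (f v)) + crossing (sample_graph f xs) M Q"
    using one[OF uv] one[OF uv(2,1)] by (simp add: eq_commute)
  also have "crossing (sample_graph f xs) M Q = 2 * (\<Sum>(i, u, v)\<leftarrow>xs. of_bool (Q (f u) \<noteq> Q (f v)))"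
  proof (rule Cons.IH)
    show "f u \<in> M \<and> f v \<in> M" if "(i, u, v) \<in> set xs" for i u v
      using Cons.prems[of i u v] that by simp
  qed
  finally show ?case by (simp add: x)
qed

text \<open>No strong set meets both sides of a pair of the system, so no witness of strength
  \<open>t\<close> can contain both points; applied to singletons, the same fact gives
  \<open>x \<noteq> y\<close>.\<close>

lemma strength_ge_separated:
  assumes D: "cut_system G t V V D" and AB: "(A, B) \<in> D"
    and xy: "x \<in> V" "y \<in> V" "x \<in> A" "y \<in> B"
  shows "x \<noteq> y \<and> \<not> t \<le> strength G V x y"
proof -
  have ne: "x \<noteq> y"
    using cut_system_strong[OF D AB strong_singleton[of G t x]] xy by auto
  have "\<not> t \<le> strength G V x y"
  proof
    assume "t \<le> strength G V x y"
    then obtain X where "X \<subseteq> V" "x \<in> X" "y \<in> X" "strong G t X"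
      using le_strength_iff[OF finite_V xy(1,2) ne] by blast
    then show False using cut_system_strong[OF D AB] xy by blast
  qed
  with ne show ?thesis by blast
qed

text \<open>The set \<open>Y\<close> of vertices in a merged block either lies in a strong set, and
  then all its pairs are strong, or is split by a pair \<open>(A, B)\<close> of the system. Old
  classes have strength at least \<open>t\<close> inside and cannot be split, so
  \<open>(A, B)\<close> induces a cut of the block of labels. Connectivity of the sampled multigraph
  forces \<open>tau\<close> samples across it, against \<open>few\<close>.\<close>

lemma strongly_merged_coarsen:
  assumes inv: "strongly_merged f kap" and t: "t \<le> kap" and Q: "Q ` M \<subseteq> M" and M: "finite M"
    and D: "cut_system G t V V D"
    and strong: "\<And>b. strong (sample_graph f xs) tau {a\<in>M. Q a = b}"
    and xs: "\<And>i u v. (i, u, v) \<in> set xs \<Longrightarrow> u \<in> act f M \<and> v \<in> act f M"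
    and few: "\<And>A B. (A, B) \<in> D \<Longrightarrow> (\<Sum>(i, u, v)\<leftarrow>xs. of_bool (u \<in> A \<and> v \<in> B \<or> u \<in> B \<and> v \<in> A)) < tau"
  shows "strongly_merged (coarsen f M Q) t"
  unfolding strongly_merged_def
proof (intro ballI impI)
  fix u v assume uv: "u \<in> V" "v \<in> V" "u \<noteq> v" "coarsen f M Q u = coarsen f M Q v"
  show "t \<le> strength G V u v"
  proof (cases "f u = f v")
    case True
    then show ?thesis using inv uv t unfolding strongly_merged_def by fastforce
  next
    case False
    then have in_M: "f u \<in> M" "f v \<in> M" using uv(4) Q by (auto simp: coarsen_def split: if_splits)
    define b where "b = Q (f u)"
    have bv: "b = Q (f v)" using uv(4) in_M by (simp add: coarsen_def b_def)
    define Y where "Y = {x\<in>act f M. Q (f x) = b}"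
    have Y: "Y \<subseteq> V" "u \<in> Y" "v \<in> Y" using uv in_M bv by (auto simp: Y_def act_def b_def)
    then have "Y \<noteq> {}" by auto
    from D Y(1) this show ?thesis
    proof (cases rule: cut_system_cover)
      case (strong X)
      then show ?thesis using le_strength_iff[OF finite_V uv(1-3)] Y by blast
    next
      case (cut A B)
      obtain x y where x: "x \<in> Y" "x \<in> A" and y: "y \<in> Y" "y \<in> B" using cut by blast
      define Mb where "Mb = {a\<in>M. Q a = b}"
      define PA where "PA = {a\<in>Mb. cls V f a \<inter> A \<noteq> {}}"
      have fin: "finite PA" "finite (Mb - PA)" using M by (auto simp: PA_def Mb_def)
      have YM: "z \<in> Y \<longleftrightarrow> z \<in> V \<and> f z \<in> Mb" for z by (auto simp: Y_def act_def Mb_def)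
      have PA_A: "f z \<notin> PA" if z: "z \<in> Y" "z \<in> B" for z
      proof
        assume "f z \<in> PA"
        then obtain z' where z': "z' \<in> V" "f z' = f z" "z' \<in> A" by (auto simp: PA_def cls_def)
        have zV: "z \<in> V" using z Y(1) by auto
        note sep = strength_ge_separated[OF D cut(1) z'(1) zV z'(3) z(2)]
        then have "kap \<le> strength G V z' z" using inv z' zV unfolding strongly_merged_def by blast
        then show False using sep t by simp
      qed
      have A_PA: "f z \<in> PA" if "z \<in> Y" "z \<in> A" for z
        using that YM[of z] by (auto simp: PA_def cls_def)
      have notA: "z \<in> B" if "z \<in> Y" "f z \<notin> PA" for z using that A_PA cut(2) by blast
      have notB: "z \<in> A" if "z \<in> Y" "f z \<in> PA" for z using that PA_A cut(2) by blast
      have "tau \<le> cw (sample_graph f xs) PA (Mb - PA)"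
      proof (rule strongD)
        show "strong (sample_graph f xs) tau Mb" unfolding Mb_def by (rule assms(6))
        show "PA \<subseteq> Mb" by (auto simp: PA_def)
        show "PA \<noteq> {}" using A_PA[OF x] by blast
        show "PA \<noteq> Mb" using PA_A[OF y] YM[of y] y by blast
      qed
      also have "\<dots> = (\<Sum>(i, u, v)\<leftarrow>xs. of_bool (f u \<in> PA \<and> f v \<in> Mb - PA) + of_bool (f v \<in> PA \<and> f u \<in> Mb - PA))"
        by (rule cw_sample_graph[OF fin])
      also have "\<dots> \<le> (\<Sum>(i, u, v)\<leftarrow>xs. of_bool (u \<in> A \<and> v \<in> B \<or> u \<in> B \<and> v \<in> A))"
      proof (rule sum_list_mono)
        fix e assume e: "e \<in> set xs"
        obtain i p q where epq: "e = (i, p, q)" by (cases e) auto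
        then have pq: "p \<in> V" "q \<in> V" using xs[of i p q] e act_subset by auto
        have 1: "p \<in> A \<and> q \<in> B" if "f p \<in> PA" "f q \<in> Mb - PA"
          using that notA[of q] notB[of p] YM pq by (auto simp: PA_def)
        have 2: "q \<in> A \<and> p \<in> B" if "f q \<in> PA" "f p \<in> Mb - PA"
          using that notA[of p] notB[of q] YM pq by (auto simp: PA_def)
        show "(case e of (i, u, v) \<Rightarrow> of_bool (f u \<in> PA \<and> f v \<in> Mb - PA) + of_bool (f v \<in> PA \<and> f u \<in> Mb - PA))
           \<le> (case e of (i, u, v) \<Rightarrow> (of_bool (u \<in> A \<and> v \<in> B \<or> u \<in> B \<and> v \<in> A) :: real))"
          using 1 2 by (auto simp: epq)
      qed
      finally show ?thesis using few[OF cut(1)] by simp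
    qed
  qed
qed

definition bad_samples :: "(nat \<Rightarrow> nat) \<Rightarrow> nat set \<Rightarrow> nat \<Rightarrow> real \<Rightarrow> (nat \<times> nat \<times> nat) list set" where
  "bad_samples f M N t = {xs. let Q = partition_of f M N xs in
     \<not> (strongly_merged (coarsen f M Q) t \<and> split_weight (act f M) (Q \<circ> f) \<le> active_weight f M / 2)}"

text \<open>A sample is bad only if some fixed partition cutting more than half of the active weight
  is crossed too rarely, or some fixed light cut of the system too often. Neither family depends on
  the sample; each contributes \<open>n * exp (- c / 32)\<close>.\<close>

lemma prob_bad_samples:
  assumes M: "M \<subseteq> f ` V" "finite M" "1 \<le> card M" and b: "n < 2 ^ b"
    and pos: "0 < active_weight f M" and inv: "strongly_merged f kap"
    and t: "t \<le> kap" "t \<le> active_weight f M / (32 * real (card M))"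
    and c: "32 * ln (real n) \<le> c" "0 < c" and N: "N = nat \<lceil>c * real (card M)\<rceil>"
  shows "measure_pmf.prob (replicate_pmf N (edge_sampler b f M)) (bad_samples f M N t) \<le> 2 * real n * exp (- c / 32)"
proof -
  define p where "p = edge_sampler b f M"
  define P where "P = replicate_pmf N p"
  define m where "m = real (card M)"
  define tau where "tau = real N / (4 * m)"
  define Y where "Y = active_weight f M"
  define U where "U = act f M"
  note ex = edge_sampler_expectation[OF M(1,2) b pos, folded p_def Y_def U_def]
  have cardM_n: "card M \<le> n"
  proof -
    have "card M \<le> card (f ` V)" using M(1) by (intro card_mono) auto
    also have "\<dots> \<le> n" using card_image_le[of V f] by simp
    finally show ?thesis .
  qed
  have m: "1 \<le> m" "m \<le> real n" using M(3) cardM_n by (auto simp: m_def)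
  have n1: "1 \<le> real n" using m by simp
  have Ypos: "0 < Y" using pos by (simp add: Y_def)
  have Nc: "c * m \<le> real N" unfolding N m_def by linarith
  have Npos: "0 < real N" using Nc c m by (smt (verit) mult_pos_pos)
  have tau: "0 < tau" using Npos m by (simp add: tau_def)
  have supp: "u \<in> U \<and> v \<in> U" if "xs \<in> set_pmf P" "(i, u, v) \<in> set xs" for xs i u v
    using that ex(2)[of i u v] by (auto simp: P_def set_replicate_pmf)
  obtain D where D: "cut_system G t V V D"
  proof -
    have "V \<noteq> {}" using M(1,3) by auto
    then have "\<exists>D. cut_system G t V V D" by (intro cut_system_exists) (auto simp: G_nonneg)
    then show thesis using that by blast
  qed
  \<comment> \<open>Extensional maps make the family finite, of size at most \<open>m ^ m\<close>;
    the partition found is restricted to \<open>M\<close> before it is compared.\<close>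
  define heavy where "heavy = {Q \<in> PiE M (\<lambda>_. M). Y / 2 < split_weight U (Q \<circ> f)}"
  define EA where "EA Q = {xs. (\<Sum>(i :: nat, u, v)\<leftarrow>xs. of_bool (Q (f u) \<noteq> Q (f v))) \<le> real N / 4}" for Q :: "nat \<Rightarrow> nat"
  define EB where "EB = (\<lambda>(A :: nat set, B). {xs. tau \<le> (\<Sum>(i :: nat, u, v)\<leftarrow>xs. of_bool (u \<in> A \<and> v \<in> B \<or> u \<in> B \<and> v \<in> A))})"
  have cover: "bad_samples f M N t \<inter> set_pmf P \<subseteq> (\<Union>Q\<in>heavy. EA Q) \<union> (\<Union>AB\<in>D. EB AB)"
  proof
    fix xs assume xs: "xs \<in> bad_samples f M N t \<inter> set_pmf P"
    define Q where "Q = partition_of f M N xs"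
    have adm: "admissible M (sample_graph f xs) tau Q"
      unfolding Q_def partition_of_def tau_def m_def using M by (intro admissible_exists) auto
    then have Q: "Q ` M \<subseteq> M" "\<And>b. strong (sample_graph f xs) tau {a\<in>M. Q a = b}"
      "crossing (sample_graph f xs) M Q \<le> 2 * tau * (m - 1)"
      unfolding admissible_def m_def by blast+
    have sup: "u \<in> U \<and> v \<in> U" if "(i, u, v) \<in> set xs" for i u v using supp xs that by blast
    show "xs \<in> (\<Union>Q\<in>heavy. EA Q) \<union> (\<Union>AB\<in>D. EB AB)"
    proof (rule ccontr)
      assume *: "xs \<notin> (\<Union>Q\<in>heavy. EA Q) \<union> (\<Union>AB\<in>D. EB AB)"
      have "strongly_merged (coarsen f M Q) t"
      proof (rule strongly_merged_coarsen[OF inv t(1) Q(1) M(2) D Q(2)])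
        show "u \<in> act f M \<and> v \<in> act f M" if "(i, u, v) \<in> set xs" for i u v
          using sup[OF that] by (simp add: U_def)
        show "(\<Sum>(i, u, v)\<leftarrow>xs. of_bool (u \<in> A \<and> v \<in> B \<or> u \<in> B \<and> v \<in> A)) < tau" if "(A, B) \<in> D" for A B
          using * that by (force simp: EB_def not_le)
      qed
      moreover have "split_weight U (Q \<circ> f) \<le> Y / 2"
      proof (rule ccontr)
        assume gt: "\<not> split_weight U (Q \<circ> f) \<le> Y / 2"
        define Q' where "Q' = restrict Q M"
        have "split_weight U (Q' \<circ> f) = split_weight U (Q \<circ> f)"
          unfolding split_weight_def crossing_def by (intro sum.cong refl) (auto simp: Q'_def U_def act_def)
        then have "Q' \<in> heavy" using gt Q(1) by (auto simp: heavy_def Q'_def)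
        then have "xs \<notin> EA Q'" using * by blast
        then have "real N / 4 < (\<Sum>(i, u, v)\<leftarrow>xs. of_bool (Q' (f u) \<noteq> Q' (f v)))" by (simp add: EA_def not_le)
        also have "\<dots> = (\<Sum>(i, u, v)\<leftarrow>xs. of_bool (Q (f u) \<noteq> Q (f v)))"
          by (intro arg_cong[where f = sum_list] map_cong refl) (use sup in \<open>auto simp: Q'_def U_def act_def\<close>)
        finally have "real N / 2 < crossing (sample_graph f xs) M Q"
          using sup by (subst crossing_sample_graph) (auto simp: M(2) U_def act_def)
        also have "\<dots> \<le> 2 * tau * m" using Q(3) tau by (simp add: algebra_simps)
        also have "\<dots> = real N / 2" using m by (simp add: tau_def)
        finally show False by simp
      qed
      ultimately show False using xs by (simp add: bad_samples_def Q_def Let_def Y_def U_def)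
    qed
  qed
  have A: "measure_pmf.prob P (EA Q) \<le> exp (- real N / 32)" if "Q \<in> heavy" for Q
  proof -
    let ?g = "\<lambda>(i :: nat, u, v). of_bool (Q (f u) \<noteq> Q (f v)) :: real"
    define mu where "mu = measure_pmf.expectation p ?g"
    have "mu = split_weight U (Q \<circ> f) / Y"
      unfolding mu_def ex(1) split_weight_def crossing_def
      by (intro arg_cong2[where f = "(/)"] sum.cong refl) auto
    moreover have "Y / 2 / Y < split_weight U (Q \<circ> f) / Y"
      using that Ypos by (intro divide_strict_right_mono) (auto simp: heavy_def)
    ultimately have mu: "1 / 2 < mu" using Ypos by simp
    have "EA Q \<subseteq> {xs. (\<Sum>x\<leftarrow>xs. ?g x) \<le> (1 - 1 / 2) * (real N * mu)}"
    proof
      fix xs assume "xs \<in> EA Q"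
      then have "(\<Sum>x\<leftarrow>xs. ?g x) \<le> real N / 4" by (simp add: EA_def)
      also have "\<dots> \<le> (1 - 1 / 2) * (real N * mu)" using mult_left_mono[of "1 / 2" mu "real N"] mu by simp
      finally show "xs \<in> {xs. (\<Sum>x\<leftarrow>xs. ?g x) \<le> (1 - 1 / 2) * (real N * mu)}" by simp
    qed
    then have "measure_pmf.prob P (EA Q) \<le> measure_pmf.prob P {xs. (\<Sum>x\<leftarrow>xs. ?g x) \<le> (1 - 1 / 2) * (real N * mu)}"
      by (intro measure_pmf.finite_measure_mono) auto
    also have "\<dots> \<le> exp (- (1 / 2)\<^sup>2 * (real N * mu) / 4)"
      unfolding P_def mu_def by (rule chernoff_lower) auto
    \<comment> \<open>The mean exceeds \<open>N / 2\<close>, and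
      \<open>(1 / 2)\<^sup>2 * (N / 2) / 4 = N / 32\<close>.\<close>
    also have "\<dots> \<le> exp (- real N / 32)"
      using mult_left_mono[of "1 / 2" mu "real N"] mu by (simp add: power2_eq_square)
    finally show ?thesis .
  qed
  have B: "measure_pmf.prob P (EB AB) \<le> exp (- c / 8)" if AB: "AB \<in> D" for AB
  proof -
    obtain A B where ABeq: "AB = (A, B)" by (cases AB)
    note DAB = cut_systemD[OF D AB[unfolded ABeq]]
    let ?g = "\<lambda>(i :: nat, u, v). of_bool (u \<in> A \<and> v \<in> B \<or> u \<in> B \<and> v \<in> A) :: real"
    define mu where "mu = measure_pmf.expectation p ?g"
    have "(\<Sum>u\<in>U. \<Sum>v\<in>U. if f u \<noteq> f v then G u v * of_bool (u \<in> A \<and> v \<in> B \<or> u \<in> B \<and> v \<in> A) else 0)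
        \<le> (\<Sum>u\<in>V. \<Sum>v\<in>V. if f u \<noteq> f v then G u v * of_bool (u \<in> A \<and> v \<in> B \<or> u \<in> B \<and> v \<in> A) else 0)"
    proof -
      have mono: "(\<Sum>u\<in>U. \<Sum>v\<in>U. h u v) \<le> (\<Sum>u\<in>V. \<Sum>v\<in>V. h u v)" if "\<And>u v. 0 \<le> h u v" for h :: "nat \<Rightarrow> nat \<Rightarrow> real"
        using cw_mono[of h U V U V] that act_subset by (simp add: cw_def U_def)
      show ?thesis by (rule mono) (auto simp: G_nonneg)
    qed
    also have "\<dots> \<le> (\<Sum>u\<in>V. \<Sum>v\<in>V. (if u \<in> A \<and> v \<in> B then G u v else 0) + (if u \<in> B \<and> v \<in> A then G u v else 0))"
      by (intro sum_mono) (auto simp: G_nonneg)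
    also have "\<dots> = (\<Sum>u\<in>V. \<Sum>v\<in>V. if u \<in> A \<and> v \<in> B then G u v else 0) + (\<Sum>u\<in>V. \<Sum>v\<in>V. if u \<in> B \<and> v \<in> A then G u v else 0)"
      by (simp add: sum.distrib)
    also have "\<dots> = cw G A B + cw G B A"
    proof -
      have "(\<Sum>u\<in>V. \<Sum>v\<in>V. if u \<in> X \<and> v \<in> Z then G u v else 0) = cw G X Z" if "X \<subseteq> V" "Z \<subseteq> V" for X Z
      proof -
        have "(\<Sum>v\<in>V. if u \<in> X \<and> v \<in> Z then G u v else 0) = (if u \<in> X then sum (G u) Z else 0)" for u
        proof -
          have "{v\<in>V. v \<in> Z} = Z" using that by auto
          then show ?thesis using sum.inter_filter[of V "G u" "\<lambda>v. v \<in> Z"] by simp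
        qed
        moreover have "{u\<in>V. u \<in> X} = X" using that by auto
        ultimately show ?thesis using sum.inter_filter[of V "\<lambda>u. sum (G u) Z" "\<lambda>u. u \<in> X"] by (simp add: cw_def)
      qed
      then show ?thesis using DAB by simp
    qed
    also have "\<dots> = 2 * cw G A B" using cw_commute[of G B A] G_commute by simp
    also have "\<dots> \<le> 2 * t" using DAB(3) by simp
    also have "\<dots> \<le> Y / (16 * m)" using t(2) by (simp add: Y_def m_def)
    finally have "mu \<le> (Y / (16 * m)) / Y"
      unfolding mu_def ex(1) using Ypos by (intro divide_right_mono) auto
    then have mu: "mu \<le> 1 / (16 * m)" using Ypos by simp
    have "EB AB = {xs. tau \<le> (\<Sum>x\<leftarrow>xs. ?g x)}" by (simp add: EB_def ABeq)
    also have "measure_pmf.prob P \<dots> \<le> exp (2 * (real N * mu) - tau)"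
      unfolding P_def mu_def by (rule tail_exp2) auto
    \<comment> \<open>The mean is at most \<open>N / (16 * m) = tau / 4\<close>, so twice the mean
      leaves half of \<open>tau\<close>, and \<open>tau\<close> is at least
      \<open>c / 4\<close>.\<close>
    also have "\<dots> \<le> exp (- c / 8)"
    proof -
      have "2 * (real N * mu) \<le> 2 * (real N * (1 / (16 * m)))" using mu by (intro mult_left_mono) auto
      also have "\<dots> = tau / 2" by (simp add: tau_def)
      finally have "2 * (real N * mu) - tau \<le> - (tau / 2)" by simp
      moreover have "c / 4 \<le> tau" using Nc m by (simp add: tau_def field_simps)
      ultimately show ?thesis by simp
    qed
    finally show ?thesis .
  qed
  have finD: "finite D" "card D \<le> n" using cut_system_card[OF D] by auto
  have fin_heavy: "finite heavy" unfolding heavy_def using M(2) by (auto intro!: finite_PiE)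
  have heavy_card: "real (card heavy) \<le> m powr m"
  proof -
    have "card heavy \<le> card (PiE M (\<lambda>_. M))"
      unfolding heavy_def using M(2) by (intro card_mono finite_PiE) auto
    also have "\<dots> = card M ^ card M" using M(2) by (simp add: card_PiE)
    finally have "real (card heavy) \<le> real (card M ^ card M)" by (rule of_nat_mono)
    then show ?thesis using m by (simp add: m_def powr_realpow)
  qed
  have "measure_pmf.prob P (bad_samples f M N t) = measure_pmf.prob P (bad_samples f M N t \<inter> set_pmf P)"
    by (simp add: measure_Int_set_pmf)
  also have "\<dots> \<le> measure_pmf.prob P ((\<Union>Q\<in>heavy. EA Q) \<union> (\<Union>AB\<in>D. EB AB))"
    using cover by (intro measure_pmf.finite_measure_mono) auto
  also have "\<dots> \<le> measure_pmf.prob P (\<Union>Q\<in>heavy. EA Q) + measure_pmf.prob P (\<Union>AB\<in>D. EB AB)"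
    by (intro measure_Un_le) auto
  also have "measure_pmf.prob P (\<Union>Q\<in>heavy. EA Q) \<le> (\<Sum>Q\<in>heavy. measure_pmf.prob P (EA Q))"
    using fin_heavy by (intro measure_UNION_le) auto
  also have "\<dots> \<le> real (card heavy) * exp (- real N / 32)"
    using A by (rule sum_bounded_above)
  also have "\<dots> \<le> m powr m * exp (- (c * m) / 32)"
    using heavy_card Nc by (intro mult_mono) auto
  \<comment> \<open>The exponent is at most \<open>- m * (c / 32 - ln n)\<close>. The bracket is
    nonnegative by the choice of \<open>c\<close>, so \<open>m\<close> may be lowered to 1.\<close>
  also have "\<dots> \<le> real n * exp (- c / 32)"
  proof -
    have "m powr m * exp (- (c * m) / 32) = exp (m * ln m + - (c * m) / 32)"
      using m unfolding exp_add by (simp add: powr_def)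
    also have "\<dots> \<le> exp (- (m * (c / 32 - ln (real n))))"
      using m mult_left_mono[of "ln m" "ln (real n)" m] by (simp add: algebra_simps)
    also have "\<dots> \<le> exp (- (1 * (c / 32 - ln (real n))))"
      using m c mult_right_mono[of 1 m "c / 32 - ln (real n)"] by simp
    also have "\<dots> = exp (ln (real n) + - c / 32)" by simp
    also have "\<dots> = real n * exp (- c / 32)" using n1 unfolding exp_add by simp
    finally show ?thesis .
  qed
  also have "measure_pmf.prob P (\<Union>AB\<in>D. EB AB) \<le> (\<Sum>AB\<in>D. measure_pmf.prob P (EB AB))"
    using finD by (intro measure_UNION_le) auto
  also have "\<dots> \<le> real (card D) * exp (- c / 8)"
    using B by (rule sum_bounded_above)
  also have "\<dots> \<le> real n * exp (- c / 32)"
    using finD c by (intro mult_mono) auto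
  finally show ?thesis by (simp add: P_def p_def)
qed

lemma good_groups_Nil:
  assumes "split_weight V f \<le> 0"
  shows "good_groups f []"
proof -
  have "f u = f v" if "0 < G u v" for u v
  proof (rule ccontr)
    assume ne: "f u \<noteq> f v"
    have uv: "u \<in> V" "v \<in> V" using G_support[of u v] that by auto
    have "G u v \<le> cw (\<lambda>u v. if f u \<noteq> f v then G u v else 0) V V"
      using cw_mono[of "\<lambda>u v. if f u \<noteq> f v then G u v else 0" "{u}" V "{v}" V] uv ne
      by (simp add: cw_def G_nonneg)
    then show False using assms that by (simp add: split_weight_def crossing_def cw_def)
  qed
  then show ?thesis by (simp add: good_groups_def)
qed

text \<open>If no label disappeared, \<open>Q\<close> would be onto and hence injective on the
  finite set \<open>M\<close>, and all active weight would remain split. So every good round merges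
  something, which bounds the number of rounds.\<close>

lemma card_coarsen_less:
  assumes M: "M \<subseteq> f ` V" and Q: "Q ` M \<subseteq> M" and pos: "0 < active_weight f M"
    and le: "split_weight (act f M) (Q \<circ> f) \<le> active_weight f M / 2"
  shows "card (coarsen f M Q ` V) < card (f ` V)"
proof (rule ccontr)
  assume ge: "\<not> ?thesis"
  have finM: "finite M" using M by (rule finite_subset) simp
  have sub: "coarsen f M Q ` V \<subseteq> f ` V" using M Q by (auto simp: coarsen_def)
  then have eq: "coarsen f M Q ` V = f ` V" using ge by (intro card_seteq) auto
  have "M \<subseteq> Q ` M"
  proof
    fix a assume a: "a \<in> M"
    then have "a \<in> coarsen f M Q ` V" using M unfolding eq by (rule_tac subsetD)
    then obtain x where "a = coarsen f M Q x" by (rule imageE)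
    then show "a \<in> Q ` M" using a by (auto simp: coarsen_def split: if_splits)
  qed
  then have "inj_on Q M" by (rule finite_surj_inj[OF finM])
  then have "split_weight (act f M) (Q \<circ> f) = active_weight f M"
    unfolding active_weight_def split_weight_def crossing_def
    by (intro sum.cong refl) (auto simp: act_def inj_on_def)
  then show False using le pos by simp
qed

text \<open>Good rounds lower the number of labels, so a budget of \<open>k\<close> rounds brings
  \<open>Suc k\<close> labels down to one, where no edge is left; the failure probabilities add up
  over the rounds.\<close>

lemma prob_contract_bad:
  assumes "consistent f deg" "strongly_merged f kap" "0 < kap" "card (f ` V) \<le> Suc k"
    and b: "n < 2 ^ b" and c: "32 * ln (real n) \<le> c" "0 < c"
  shows "measure_pmf.prob (out F (contract V b c k f deg kap)) {L. \<not> good_groups f L}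
    \<le> real k * (2 * real n * exp (- c / 32))"
  using assms(1-4)
proof (induction k arbitrary: f deg kap)
  case 0
  have eq: "f u = f v" if "u \<in> V" "v \<in> V" for u v
  proof -
    have "\<forall>a\<in>f ` V. \<forall>b\<in>f ` V. a = b" using 0(4) by (subst card_le_Suc0_iff_eq[symmetric]) simp_all
    from bspec[OF bspec[OF this imageI[OF that(1)]] imageI[OF that(2)]] show ?thesis .
  qed
  have "split_weight V f = 0" unfolding split_weight_def crossing_def
    by (intro sum.neutral ballI, rule if_not_P, rule notI, erule notE, rule eq)
  then have "good_groups f []" by (intro good_groups_Nil) (rule eq_refl)
  then show ?case by simp
next
  case (Suc k)
  note cons = Suc.prems(1) and inv = Suc.prems(2)
  define D where "D = sum deg (f ` V)"
  define e where "e = 2 * real n * exp (- c / 32)"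
  have e: "0 \<le> e" by (simp add: e_def)
  show ?case
  proof (cases "D \<le> 0")
    case True
    then have "good_groups f []" using consistent_sum[OF cons] by (intro good_groups_Nil) (simp add: D_def)
    then show ?thesis using True e by (simp add: D_def e_def)
  next
    case False
    then have D: "0 < D" by simp
    define M where "M = active V f deg"
    define N where "N = nat \<lceil>c * real (card M)\<rceil>"
    define Y where "Y = active_weight f M"
    define kap' where "kap' = min kap (Y / (32 * real (card M)))"
    have M: "M \<subseteq> f ` V" "finite M" using active_subset by (auto simp: M_def)
    have Y: "0 < Y" "D / 2 \<le> Y" and m1: "1 \<le> card M"
      using active_nonempty[OF cons] active_weight_ge_half[OF cons] D by (auto simp: D_def M_def Y_def)
    have kap': "0 < kap'" using Suc.prems(3) Y m1 by (simp add: kap'_def)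
    let ?cont = "\<lambda>xs. round_step V f deg kap M N (contract V b c k) Y xs"
    have "contract V b c (Suc k) f deg kap = bind_alg (sample_active V b N f M)
        (\<lambda>(Y, xs). round_step V f deg kap M N (contract V b c k) Y xs)"
      using False by (simp add: Let_def M_def N_def D_def)
    then have out: "out F (contract V b c (Suc k) f deg kap) =
        bind_pmf (replicate_pmf N (edge_sampler b f M)) (\<lambda>xs. out F (?cont xs))"
      by (simp only: out_bind_alg out_sample_active[OF M] bind_map_pmf prod.case Y_def)
    have "measure_pmf.prob (out F (contract V b c (Suc k) f deg kap)) {L. \<not> good_groups f L} \<le> e + real k * e"
      unfolding out
    proof (rule prob_bind_pmf_le)
      show "measure_pmf.prob (replicate_pmf N (edge_sampler b f M)) (bad_samples f M N kap') \<le> e"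
        unfolding e_def using M m1 b Y(1) inv c N_def
        by (intro prob_bad_samples[where kap = kap]) (auto simp: kap'_def Y_def)
      show "0 \<le> real k * e" using e by simp
      fix xs assume nb: "xs \<notin> bad_samples f M N kap'"
      define Q where "Q = partition_of f M N xs"
      define f' where "f' = coarsen f M Q"
      have "admissible M (sample_graph f xs) (real N / (4 * real (card M))) Q"
        unfolding Q_def partition_of_def using M m1 by (intro admissible_exists) auto
      then have Q: "Q ` M \<subseteq> M" by (simp add: admissible_def)
      define deg' where "deg' = new_deg f M Q deg"
      have cons': "consistent f' deg'"
        unfolding f'_def deg'_def using cons Q by (rule consistent_new_deg)
      have inv': "strongly_merged f' kap'" and half: "split_weight (act f M) (Q \<circ> f) \<le> Y / 2"
        using nb by (auto simp: bad_samples_def Let_def Q_def f'_def Y_def)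
      \<comment> \<open>At least \<open>Y / 2\<close>, hence at least \<open>D / 4\<close>, has been
        contracted, so the premature stop is not taken.\<close>
      have "sum deg' (f' ` V) \<le> 3 / 4 * D"
        using consistent_sum[OF cons'] split_weight_coarsen[OF Q, of f] consistent_sum[OF cons] half Y
        by (simp add: f'_def D_def Y_def)
      then have "out F (?cont xs) = map_pmf (\<lambda>L. new_groups V f M Q kap' @ L) (out F (contract V b c k f' deg' kap'))"
        unfolding D_def by (intro out_round_step[OF Q_def f'_def deg'_def kap'_def M(2)])
      then have "measure_pmf.prob (out F (?cont xs)) {L. \<not> good_groups f L} =
          measure_pmf.prob (out F (contract V b c k f' deg' kap')) {L. \<not> good_groups f (new_groups V f M Q kap' @ L)}"
        by (simp add: vimage_def)
      also have "\<dots> \<le> measure_pmf.prob (out F (contract V b c k f' deg' kap')) {L. \<not> good_groups f' L}"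
        using good_groups_step[OF M(2) Q, of f kap'] inv' by (intro measure_pmf.finite_measure_mono) (auto simp: f'_def)
      also have "\<dots> \<le> real k * e"
        unfolding e_def
      proof (rule Suc.IH[OF cons' inv' kap'])
        have "card (f' ` V) < card (f ` V)"
          unfolding f'_def using card_coarsen_less[OF M(1) Q] Y half by (simp add: Y_def)
        then show "card (f' ` V) \<le> Suc k" using Suc.prems(4) by simp
      qed
      finally show "measure_pmf.prob (out F (?cont xs)) {L. \<not> good_groups f L} \<le> real k * e" .
    qed
    also have "e + real k * e = real (Suc k) * (2 * real n * exp (- c / 32))"
      by (simp add: e_def algebra_simps)
    finally show ?thesis .
  qed
qed

end

section \<open>Sampling by strength\<close>

definition left_part :: "group list \<Rightarrow> nat \<Rightarrow> nat set" where "left_part L i = fst (L ! i)"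
definition right_part :: "group list \<Rightarrow> nat \<Rightarrow> nat set" where "right_part L i = fst (snd (L ! i))"
definition scale :: "group list \<Rightarrow> nat \<Rightarrow> real" where "scale L i = snd (snd (L ! i))"

text \<open>An unbiased estimate of the weights: an ordered edge is drawn with probability weight
  over \<open>scale * Z\<close>, the factor \<open>scale\<close> undoes the bias, and the 2 reflects
  that an edge can be drawn in either order.\<close>

definition reweighted :: "group list \<Rightarrow> real \<Rightarrow> (nat \<times> nat \<times> nat) list \<Rightarrow> wgraph" where
  "reweighted L Z xs u v = Z / (2 * real (length xs)) *
     (\<Sum>(i, p, q)\<leftarrow>xs. scale L i * (of_bool (p = u \<and> q = v) + of_bool (p = v \<and> q = u)))"

lemma reweighted_commute: "reweighted L Z xs u v = reweighted L Z xs v u"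
  by (simp add: reweighted_def add.commute)

lemma sum_reweighted:
  assumes k: "\<And>u v. k u v = (k v u :: real)" and fin: "finite P" "finite R"
  shows "(\<Sum>u\<in>P. \<Sum>v\<in>R. reweighted L Z xs u v / k u v) = Z / (2 * real (length xs)) *
    (\<Sum>(i, p, q)\<leftarrow>xs. scale L i / k p q * (of_bool (p \<in> P \<and> q \<in> R) + of_bool (q \<in> P \<and> p \<in> R)))"
proof -
  have one: "(\<Sum>u\<in>P. \<Sum>v\<in>R. s * (of_bool (p = u \<and> q = v) + of_bool (p = v \<and> q = u)) / k u v) =
      s / k p q * (of_bool (p \<in> P \<and> q \<in> R) + of_bool (q \<in> P \<and> p \<in> R))" for s p q
  proof -
    have del: "(\<Sum>u\<in>P. \<Sum>v\<in>R. of_bool (p = u \<and> q = v) * h u v) = of_bool (p \<in> P \<and> q \<in> R) * h p q"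
      for p q and h :: "nat \<Rightarrow> nat \<Rightarrow> real"
    proof -
      have "(\<Sum>u\<in>P. \<Sum>v\<in>R. of_bool (p = u \<and> q = v) * h u v) =
          (\<Sum>u\<in>P. if p = u then (\<Sum>v\<in>R. if q = v then h p v else 0) else 0)"
        by (intro sum.cong refl) (auto intro!: sum.cong sum.neutral)
      then show ?thesis using fin by simp
    qed
    have del': "(\<Sum>u\<in>P. \<Sum>v\<in>R. of_bool (p = v \<and> q = u) * h u v) = of_bool (q \<in> P \<and> p \<in> R) * h q p"
      for h :: "nat \<Rightarrow> nat \<Rightarrow> real"
      unfolding del[symmetric] by (subst conj_commute) (rule refl)
    have alg: "s * (x + y) / z = x * (s / z) + y * (s / z)" for x y z :: real
      by (simp add: add_divide_distrib distrib_left mult.commute)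
    have "(\<Sum>u\<in>P. \<Sum>v\<in>R. s * (of_bool (p = u \<and> q = v) + of_bool (p = v \<and> q = u)) / k u v) =
       of_bool (p \<in> P \<and> q \<in> R) * (s / k p q) + of_bool (q \<in> P \<and> p \<in> R) * (s / k q p)"
      unfolding alg sum.distrib del del' by (rule refl)
    also have "\<dots> = s / k p q * (of_bool (p \<in> P \<and> q \<in> R) + of_bool (q \<in> P \<and> p \<in> R))"
      unfolding k[of q p] by (simp only: distrib_left mult.commute)
    finally show ?thesis .
  qed
  have "(\<Sum>u\<in>P. \<Sum>v\<in>R. (\<Sum>(i, p, q)\<leftarrow>xs. scale L i * (of_bool (p = u \<and> q = v) + of_bool (p = v \<and> q = u))) / k u v)
     = (\<Sum>(i, p, q)\<leftarrow>xs. scale L i / k p q * (of_bool (p \<in> P \<and> q \<in> R) + of_bool (q \<in> P \<and> p \<in> R)))"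
  proof (induction xs)
    case (Cons x xs)
    obtain i p q where x: "x = (i, p, q)" by (cases x) auto
    show ?case
      by (simp only: x list.map sum_list.Cons prod.case add_divide_distrib sum.distrib one Cons)
  qed simp
  then show ?thesis
    unfolding reweighted_def times_divide_eq_right[symmetric] sum_distrib_left[symmetric] by (simp only:)
qed

locale group_sampling = query_graph +
  fixes L :: "group list" and b :: nat
  assumes valid: "valid_groups L" and good: "good_groups (\<lambda>x. x) L"
    and weight_pos: "0 < group_weight L" and bits: "n < 2 ^ b"
begin

abbreviation "I \<equiv> {..<length L}"
abbreviation "Z \<equiv> group_weight L"
abbreviation "str \<equiv> strength G V"

definition rate :: "nat \<Rightarrow> real" where
  "rate i = cw G (left_part L i) (right_part L i) / scale L i"

definition sampler :: "(nat \<times> nat \<times> nat) pmf" where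
  "sampler = out F (sample_edge V b I (left_part L) (right_part L) rate)"

lemma group_props:
  assumes "i < length L"
  shows "left_part L i \<subseteq> V" "right_part L i \<subseteq> V" "left_part L i \<inter> right_part L i = {}" "0 < scale L i"
    "u \<in> left_part L i \<Longrightarrow> v \<in> right_part L i \<Longrightarrow> scale L i \<le> str u v"
proof -
  have m: "L ! i \<in> set L" using assms by simp
  obtain A B k where e: "L ! i = (A, B, k)" by (cases "L ! i") auto
  have "A \<subseteq> V \<and> B \<subseteq> V \<and> A \<inter> B = {} \<and> 0 < k" "\<forall>u\<in>A. \<forall>v\<in>B. k \<le> str u v"
    using valid good m unfolding e valid_groups_def good_groups_def by fastforce+
  then show "left_part L i \<subseteq> V" "right_part L i \<subseteq> V" "left_part L i \<inter> right_part L i = {}" "0 < scale L i"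
    "u \<in> left_part L i \<Longrightarrow> v \<in> right_part L i \<Longrightarrow> scale L i \<le> str u v"
    by (auto simp: left_part_def right_part_def scale_def e)
qed

lemma sum_rate: "sum rate I = Z"
  unfolding group_weight_def sum_list_sum_nth
  by (auto simp: rate_def left_part_def right_part_def scale_def case_prod_unfold atLeast0LessThan)

lemma cover_count:
  assumes "0 < G u v"
  shows "(\<Sum>i\<in>I. of_bool (u \<in> left_part L i \<and> v \<in> right_part L i)) = (1::real)"
proof -
  have ne: "u \<noteq> v" using assms by auto
  have "(\<Sum>i\<in>I. of_bool (u \<in> left_part L i \<and> v \<in> right_part L i)) =
      (\<Sum>(A, B, kap)\<leftarrow>L. of_bool (u \<in> A \<and> v \<in> B) :: real)"
    unfolding sum_list_sum_nth
    by (auto simp: left_part_def right_part_def case_prod_unfold atLeast0LessThan)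
  also have "\<dots> = 1" using good assms ne unfolding good_groups_def by auto
  finally show ?thesis .
qed

lemma pmf_sampler:
  "pmf sampler (i, u, v) = (if i \<in> I \<and> u \<in> left_part L i \<and> v \<in> right_part L i then 1 / scale L i * G u v / Z else 0)"
  unfolding sampler_def sum_rate[symmetric]
proof (rule pmf_sample_edge[OF bits])
  show "left_part L i \<subseteq> V \<and> right_part L i \<subseteq> V \<and> left_part L i \<inter> right_part L i = {} \<and> 0 \<le> 1 / scale L i \<and>
     rate i = 1 / scale L i * cw G (left_part L i) (right_part L i)" if "i \<in> I" for i
    using group_props[of i] that by (auto simp: rate_def)
qed (use weight_pos sum_rate in auto)

lemma sampler_support:
  assumes "(i, u, v) \<in> set_pmf sampler"
  shows "i < length L" "u \<in> V" "v \<in> V" "u \<noteq> v" "0 < scale L i" "scale L i \<le> str u v"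
proof -
  have *: "i < length L" "u \<in> left_part L i" "v \<in> right_part L i"
    using assms pmf_sampler[of i u v] by (auto simp: set_pmf_iff split: if_splits)
  then show "i < length L" "u \<in> V" "v \<in> V" "u \<noteq> v" "0 < scale L i" "scale L i \<le> str u v"
    using group_props[OF *(1)] by auto
qed

text \<open>The scale cancels against the sampling probability, after which the groups enter only
  through \<open>cover_count\<close>: each edge is seen exactly once per order.\<close>

lemma sampler_expectation:
  "measure_pmf.expectation sampler (\<lambda>(i, u, v). scale L i * h u v) = (\<Sum>u\<in>V. \<Sum>v\<in>V. G u v * h u v) / Z"
proof -
  have "measure_pmf.expectation sampler (\<lambda>(i, u, v). scale L i * h u v) =
      (\<Sum>x\<in>I \<times> V \<times> V. (case x of (i, u, v) \<Rightarrow> scale L i * h u v) * pmf sampler x)"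
  proof (rule integral_measure_pmf_real)
    fix x assume "x \<in> set_pmf sampler"
    then show "x \<in> I \<times> V \<times> V" using sampler_support by (cases x) auto
  qed simp
  also have "\<dots> = (\<Sum>i\<in>I. \<Sum>u\<in>V. \<Sum>v\<in>V. scale L i * h u v * pmf sampler (i, u, v))"
    by (simp add: sum.cartesian_product case_prod_unfold)
  also have "\<dots> = (\<Sum>i\<in>I. \<Sum>u\<in>V. \<Sum>v\<in>V. of_bool (u \<in> left_part L i \<and> v \<in> right_part L i) * (G u v * h u v / Z))"
  proof (intro sum.cong refl)
    fix i u v assume "i \<in> I"
    then have "scale L i \<noteq> 0" using group_props(4)[of i] by simp
    then show "scale L i * h u v * pmf sampler (i, u, v) =
       of_bool (u \<in> left_part L i \<and> v \<in> right_part L i) * (G u v * h u v / Z)"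
      using \<open>i \<in> I\<close> by (simp add: pmf_sampler)
  qed
  also have "\<dots> = (\<Sum>u\<in>V. \<Sum>v\<in>V. \<Sum>i\<in>I. of_bool (u \<in> left_part L i \<and> v \<in> right_part L i) * (G u v * h u v / Z))"
    by (subst sum.swap, rule sum.cong[OF refl], rule sum.swap)
  also have "\<dots> = (\<Sum>u\<in>V. \<Sum>v\<in>V. G u v * h u v / Z)"
  proof (intro sum.cong refl)
    fix u v
    show "(\<Sum>i\<in>I. of_bool (u \<in> left_part L i \<and> v \<in> right_part L i) * (G u v * h u v / Z)) = G u v * h u v / Z"
    proof (cases "G u v = 0")
      case False
      then have "0 < G u v" using G_nonneg[of u v] by simp
      then show ?thesis unfolding sum_distrib_right[symmetric] by (simp only: cover_count mult_1)
    qed simp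
  qed
  finally show ?thesis by (simp add: sum_divide_distrib)
qed

text \<open>What one sample adds to a cut of \<open>C\<close> in the graph divided by strengths.
  Since scales are at most strengths, the value lies in [0, 1], so the tail bounds apply whatever
  the range of the weights.\<close>

definition cut_statistic :: "nat set \<Rightarrow> nat set \<Rightarrow> nat \<times> nat \<times> nat \<Rightarrow> real" where
  "cut_statistic C A = (\<lambda>(i, u, v). scale L i * (of_bool (u \<in> C \<and> v \<in> C \<and> (u \<in> A) \<noteq> (v \<in> A)) / \<bar>str u v\<bar>))"

abbreviation "sc \<equiv> scaled G V"

lemma sc_commute: "sc u v = sc v u" and sc_nonneg: "0 \<le> sc u v"
  using G_commute[of u v] G_nonneg strength_commute[of G V u v] by (auto simp: scaled_def)

lemma expectation_cut_statistic:
  assumes "C \<subseteq> V" "A \<subseteq> C"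
  shows "measure_pmf.expectation sampler (cut_statistic C A) = 2 * cw sc A (C - A) / Z"
proof -
  have "(\<Sum>u\<in>V. \<Sum>v\<in>V. G u v * (of_bool (u \<in> C \<and> v \<in> C \<and> (u \<in> A) \<noteq> (v \<in> A)) / \<bar>str u v\<bar>)) =
      (\<Sum>u\<in>C. \<Sum>v\<in>C. if (u \<in> A) \<noteq> (v \<in> A) then sc u v else 0)"
  proof -
    have "(\<Sum>u\<in>V. \<Sum>v\<in>V. G u v * (of_bool (u \<in> C \<and> v \<in> C \<and> (u \<in> A) \<noteq> (v \<in> A)) / \<bar>str u v\<bar>)) =
       (\<Sum>u\<in>C. \<Sum>v\<in>V. G u v * (of_bool (u \<in> C \<and> v \<in> C \<and> (u \<in> A) \<noteq> (v \<in> A)) / \<bar>str u v\<bar>))"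
      using assms by (intro sum.mono_neutral_right) auto
    also have "\<dots> = (\<Sum>u\<in>C. \<Sum>v\<in>C. G u v * (of_bool (u \<in> C \<and> v \<in> C \<and> (u \<in> A) \<noteq> (v \<in> A)) / \<bar>str u v\<bar>))"
      using assms by (intro sum.cong refl sum.mono_neutral_right) auto
    also have "\<dots> = (\<Sum>u\<in>C. \<Sum>v\<in>C. if (u \<in> A) \<noteq> (v \<in> A) then sc u v else 0)"
      by (intro sum.cong refl) (auto simp: scaled_def)
    finally show ?thesis .
  qed
  also have "\<dots> = 2 * cw sc A (C - A)"
    using assms finite_subset_V[of C] by (intro cut_weights_sum sc_commute) auto
  finally show ?thesis unfolding cut_statistic_def sampler_expectation by simp
qed

lemma cut_statistic_range:
  assumes "x \<in> set_pmf sampler"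
  shows "0 \<le> cut_statistic C A x \<and> cut_statistic C A x \<le> 1"
proof -
  obtain i u v where x: "x = (i, u, v)" by (cases x) auto
  note s = sampler_support[OF assms[unfolded x]]
  have "scale L i / \<bar>str u v\<bar> \<le> 1" using s by (simp add: divide_le_eq)
  then show ?thesis using s by (auto simp: x cut_statistic_def)
qed

definition deviating :: "nat \<Rightarrow> real \<Rightarrow> nat set \<Rightarrow> nat set \<Rightarrow> (nat \<times> nat \<times> nat) list set" where
  "deviating N e C A = {xs. e * (2 * real N / Z * cw sc A (C - A)) \<le> \<bar>(\<Sum>x\<leftarrow>xs. cut_statistic C A x) - 2 * real N / Z * cw sc A (C - A)\<bar>}"

lemma prob_deviating:
  assumes "C \<subseteq> V" "A \<subseteq> C" "0 \<le> e" "e \<le> 1"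
  shows "measure_pmf.prob (replicate_pmf N sampler) (deviating N e C A)
    \<le> 2 * exp (- (e\<^sup>2 * real N / (2 * Z)) * cw sc A (C - A))"
proof -
  define M where "M = 2 * real N / Z * cw sc A (C - A)"
  let ?P = "replicate_pmf N sampler" and ?S = "\<lambda>xs. \<Sum>x\<leftarrow>xs. cut_statistic C A x"
  have M: "real N * measure_pmf.expectation sampler (cut_statistic C A) = M"
    by (simp add: expectation_cut_statistic[OF assms(1,2)] M_def)
  have "deviating N e C A = {xs. e * M \<le> \<bar>?S xs - M\<bar>}"
    by (simp only: deviating_def M_def)
  then have "deviating N e C A \<subseteq> {xs. ?S xs \<le> (1 - e) * M} \<union> {xs. (1 + e) * M \<le> ?S xs}"
    by (auto simp: algebra_simps abs_if split: if_splits)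
  then have "measure_pmf.prob ?P (deviating N e C A) \<le>
      measure_pmf.prob ?P ({xs. ?S xs \<le> (1 - e) * M} \<union> {xs. (1 + e) * M \<le> ?S xs})"
    by (intro measure_pmf.finite_measure_mono) auto
  also have "\<dots> \<le> measure_pmf.prob ?P {xs. ?S xs \<le> (1 - e) * M} + measure_pmf.prob ?P {xs. (1 + e) * M \<le> ?S xs}"
    by (intro measure_Un_le) auto
  also have "\<dots> \<le> exp (- e\<^sup>2 * M / 4) + exp (- e\<^sup>2 * M / 4)"
    using chernoff_lower[of sampler "cut_statistic C A" e N] chernoff_upper[of sampler "cut_statistic C A" e N]
      cut_statistic_range assms(3,4) unfolding M by (intro add_mono) auto
  also have "- e\<^sup>2 * M / 4 = - (e\<^sup>2 * real N / (2 * Z)) * cw sc A (C - A)"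
    by (simp add: M_def)
  finally show ?thesis by simp
qed

section \<open>Level classes and the union bound over their cuts\<close>

definition classes :: "real \<Rightarrow> nat set set" where
  "classes t = level_class G V t ` V"

text \<open>Level sets change only at values of the strength, so quadratically many thresholds
  represent all levels; at positive ones the scaled classes have minimum cut at least 1.\<close>

definition thresholds :: "real set" where
  "thresholds = {t \<in> (\<lambda>(u, v). str u v) ` (V \<times> V). 0 < t}"

definition some_deviating :: "nat \<Rightarrow> real \<Rightarrow> (nat \<times> nat \<times> nat) list set" where
  "some_deviating N e = (\<Union>t\<in>thresholds. \<Union>C\<in>classes t. \<Union>A\<in>cuts C. deviating N e C A)"

lemma class_subset: "C \<in> classes t \<Longrightarrow> C \<subseteq> V"
  by (auto simp: classes_def level_class_def)

lemma finite_thresholds: "finite thresholds" "card thresholds \<le> n * n"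
proof -
  have "finite ((\<lambda>(u, v). str u v) ` (V \<times> V))" by simp
  then show "finite thresholds" by (simp add: thresholds_def)
  have "card thresholds \<le> card ((\<lambda>(u, v). str u v) ` (V \<times> V))"
    unfolding thresholds_def by (intro card_mono) auto
  also have "\<dots> \<le> card (V \<times> V)" by (intro card_image_le) simp
  finally show "card thresholds \<le> n * n" by simp
qed

text \<open>At most \<open>n * n\<close> thresholds, \<open>n\<close> classes for each and
  \<open>8 * n ^ 3 * exp (- T)\<close> for the cuts of a class: the sixth power of \<open>n\<close>
  is their product.\<close>

lemma prob_some_deviating:
  assumes e: "0 \<le> e" "e \<le> 1" and t: "real n * exp (- (e\<^sup>2 * real N / (2 * Z)) / 2) \<le> 1 / 2"
  shows "measure_pmf.prob (replicate_pmf N sampler) (some_deviating N e) \<le> 8 * real n ^ 6 * exp (- (e\<^sup>2 * real N / (2 * Z)))"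
proof -
  define T where "T = e\<^sup>2 * real N / (2 * Z)"
  let ?P = "replicate_pmf N sampler"
  have T0: "0 \<le> T" using weight_pos by (simp add: T_def)
  have C: "measure_pmf.prob ?P (\<Union>A\<in>cuts C. deviating N e C A) \<le> 8 * real n ^ 3 * exp (- T)"
    if t': "t' \<in> thresholds" and C: "C \<in> classes t'" for t' C
  proof -
    have CV: "C \<subseteq> V" and finC: "finite C" using class_subset[OF C] finite_subset_V by auto
    have "measure_pmf.prob ?P (\<Union>A\<in>cuts C. deviating N e C A) \<le> (\<Sum>A\<in>cuts C. measure_pmf.prob ?P (deviating N e C A))"
      using finC by (intro measure_UNION_le) auto
    also have "\<dots> \<le> (\<Sum>A\<in>cuts C. 2 * exp (- T * cw sc A (C - A)))"
      unfolding T_def using CV e by (intro sum_mono prob_deviating) (auto simp: cuts_def)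
    also have "\<dots> = 2 * (\<Sum>A\<in>cuts C. exp (- T * cw sc A (C - A)))" by (simp add: sum_distrib_left)
    also have "\<dots> \<le> 2 * (4 * real n ^ 3 * exp (- T))"
    proof (intro mult_left_mono sum_exp_cuts_le)
      show "card C \<le> n" using card_mono[OF finite_V CV] by simp
      obtain v where v: "v \<in> V" "C = level_class G V t' v" using C by (auto simp: classes_def)
      show "strong sc 1 C" unfolding v(2)
        using v(1) t' by (intro strong_scaled_level_class G_nonneg) (auto simp: thresholds_def)
    qed (use finC sc_commute sc_nonneg T0 t in \<open>auto simp: T_def\<close>)
    finally show ?thesis by simp
  qed
  have t': "measure_pmf.prob ?P (\<Union>C\<in>classes t'. \<Union>A\<in>cuts C. deviating N e C A) \<le> real n * (8 * real n ^ 3 * exp (- T))"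
    if "t' \<in> thresholds" for t'
  proof -
    have "measure_pmf.prob ?P (\<Union>C\<in>classes t'. \<Union>A\<in>cuts C. deviating N e C A)
        \<le> (\<Sum>C\<in>classes t'. measure_pmf.prob ?P (\<Union>A\<in>cuts C. deviating N e C A))"
      by (intro measure_UNION_le) (auto simp: classes_def)
    also have "\<dots> \<le> real (card (classes t')) * (8 * real n ^ 3 * exp (- T))"
      using C[OF that] by (rule sum_bounded_above)
    also have "\<dots> \<le> real n * (8 * real n ^ 3 * exp (- T))"
      using card_image_le[OF finite_V, of "level_class G V t'"] by (intro mult_right_mono) (auto simp: classes_def)
    finally show ?thesis .
  qed
  have "measure_pmf.prob ?P (some_deviating N e) \<le>
      (\<Sum>t'\<in>thresholds. measure_pmf.prob ?P (\<Union>C\<in>classes t'. \<Union>A\<in>cuts C. deviating N e C A))"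
    unfolding some_deviating_def using finite_thresholds by (intro measure_UNION_le) auto
  also have "\<dots> \<le> real (card thresholds) * (real n * (8 * real n ^ 3 * exp (- T)))"
    using t' by (rule sum_bounded_above)
  also have "\<dots> \<le> real (n * n) * (real n * (8 * real n ^ 3 * exp (- T)))"
    using finite_thresholds(2) by (intro mult_right_mono) (auto simp flip: of_nat_mult)
  also have "\<dots> = 8 * real n ^ 6 * exp (- T)" by (simp add: power_def numeral_eq_Suc)
  finally show ?thesis by (simp add: T_def)
qed

lemma str_nonneg: "u \<in> V \<Longrightarrow> v \<in> V \<Longrightarrow> u \<noteq> v \<Longrightarrow> 0 \<le> str u v"
  using strength_ge_weight[OF finite_V, of G u v] G_commute G_nonneg[of u v] by (auto intro: order_trans)

lemma classes_disjoint:
  assumes "C \<in> classes t" "C' \<in> classes t" "C \<noteq> C'"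
  shows "C \<inter> C' = {}"
proof (rule ccontr)
  assume "C \<inter> C' \<noteq> {}"
  then obtain x where x: "x \<in> C" "x \<in> C'" by blast
  have mem: "y \<in> D \<longleftrightarrow> y \<in> V \<and> (y = x \<or> t \<le> str x y)" if "D \<in> classes t" "x \<in> D" for D y
  proof -
    obtain v where v: "v \<in> V" "D = level_class G V t v" using \<open>D \<in> classes t\<close> by (auto simp: classes_def)
    show ?thesis
    proof (cases "y \<in> V \<and> x \<noteq> y")
      case True
      then show ?thesis unfolding v(2)
        using level_class_pair[OF finite_V _ v(1), of G x t y] \<open>x \<in> D\<close> v(2) G_nonneg by auto
    next
      case False
      then show ?thesis using that class_subset by blast
    qed
  qed
  have "C = C'" using mem[OF assms(1) x(1)] mem[OF assms(2) x(2)] by blast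
  with assms(3) show False by simp
qed

text \<open>A pair separated by \<open>S\<close> has strength at least \<open>t\<close> exactly if
  it lies within one class of level \<open>t\<close>, and the classes are disjoint; thus a level of
  a cut falls apart into cuts of classes.\<close>

lemma sum_level_pairs:
  fixes h :: "nat \<Rightarrow> nat \<Rightarrow> real"
  assumes S: "S \<subseteq> V"
  shows "(\<Sum>e\<in>{e\<in>S \<times> (V - S). t \<le> (case e of (u, v) \<Rightarrow> str u v)}. case e of (u, v) \<Rightarrow> h u v) =
    (\<Sum>C\<in>classes t. \<Sum>u\<in>C \<inter> S. \<Sum>v\<in>C - S. h u v)"
proof -
  have fin: "finite C" if "C \<in> classes t" for C using class_subset[OF that] by (rule finite_subset_V)
  have "{e\<in>S \<times> (V - S). t \<le> (case e of (u, v) \<Rightarrow> str u v)} = (\<Union>C\<in>classes t. (C \<inter> S) \<times> (C - S))"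
  proof (rule set_eqI, clarify)
    fix u v
    show "((u, v) \<in> {e\<in>S \<times> (V - S). t \<le> (case e of (u, v) \<Rightarrow> str u v)}) = ((u, v) \<in> (\<Union>C\<in>classes t. (C \<inter> S) \<times> (C - S)))"
    proof
      assume "(u, v) \<in> {e\<in>S \<times> (V - S). t \<le> (case e of (u, v) \<Rightarrow> str u v)}"
      then have "u \<in> S" "v \<in> V" "v \<notin> S" "t \<le> str u v" by auto
      moreover from this S have "level_class G V t u \<in> classes t" "u \<in> level_class G V t u" "v \<in> level_class G V t u"
        by (auto simp: classes_def level_class_def)
      ultimately show "(u, v) \<in> (\<Union>C\<in>classes t. (C \<inter> S) \<times> (C - S))" by blast
    next
      assume "(u, v) \<in> (\<Union>C\<in>classes t. (C \<inter> S) \<times> (C - S))"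
      then obtain C where C: "C \<in> classes t" "u \<in> C" "u \<in> S" "v \<in> C" "v \<notin> S" by auto
      then obtain w where w: "w \<in> V" "C = level_class G V t w" by (auto simp: classes_def)
      have vV: "v \<in> V" "u \<noteq> v" using C class_subset by auto
      have "t \<le> str u v"
        using level_class_pair[OF finite_V _ w(1), of G u t v] C w(2) vV G_nonneg by auto
      then show "(u, v) \<in> {e\<in>S \<times> (V - S). t \<le> (case e of (u, v) \<Rightarrow> str u v)}" using C vV by auto
    qed
  qed
  then have "(\<Sum>e\<in>{e\<in>S \<times> (V - S). t \<le> (case e of (u, v) \<Rightarrow> str u v)}. case e of (u, v) \<Rightarrow> h u v) =
     (\<Sum>e\<in>(\<Union>C\<in>classes t. (C \<inter> S) \<times> (C - S)). case e of (u, v) \<Rightarrow> h u v)" by simp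
  also have "\<dots> = (\<Sum>C\<in>classes t. \<Sum>e\<in>(C \<inter> S) \<times> (C - S). case e of (u, v) \<Rightarrow> h u v)"
  proof (rule sum.UNION_disjoint)
    show "finite (classes t)" by (simp add: classes_def)
    show "\<forall>C\<in>classes t. finite ((C \<inter> S) \<times> (C - S))" using fin by auto
    show "\<forall>C\<in>classes t. \<forall>C'\<in>classes t. C \<noteq> C' \<longrightarrow> (C \<inter> S) \<times> (C - S) \<inter> (C' \<inter> S) \<times> (C' - S) = {}"
      using classes_disjoint by blast
  qed
  also have "\<dots> = (\<Sum>C\<in>classes t. \<Sum>u\<in>C \<inter> S. \<Sum>v\<in>C - S. h u v)"
    by (simp add: sum.cartesian_product)
  finally show ?thesis .
qed

lemma reweighted_props:
  assumes xs: "xs \<in> set_pmf (replicate_pmf N sampler)"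
  shows "wgraph_on n (reweighted L Z xs)" "card (edges (reweighted L Z xs)) \<le> N"
    "u \<in> V \<Longrightarrow> v \<in> V \<Longrightarrow> u \<noteq> v \<Longrightarrow> str u v = 0 \<Longrightarrow> reweighted L Z xs u v = 0"
proof -
  have len: "length xs = N" and supp: "\<And>x. x \<in> set xs \<Longrightarrow> x \<in> set_pmf sampler"
    using xs by (auto simp: set_replicate_pmf)
  let ?H = "reweighted L Z xs"
  have pos: "\<exists>i. (i, u, v) \<in> set xs \<or> (i, v, u) \<in> set xs" if "?H u v \<noteq> 0" for u v
  proof (rule ccontr)
    assume no: "\<not> ?thesis"
    have "(\<Sum>(i, p, q)\<leftarrow>xs. scale L i * (of_bool (p = u \<and> q = v) + of_bool (p = v \<and> q = u))) = 0"
    proof -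
      have "(\<Sum>(i, p, q)\<leftarrow>xs. scale L i * (of_bool (p = u \<and> q = v) + of_bool (p = v \<and> q = u))) = (\<Sum>x\<leftarrow>xs. 0)"
      proof (intro arg_cong[where f = sum_list] map_cong refl)
        fix x assume "x \<in> set xs"
        moreover obtain i p q where x: "x = (i, p, q)" by (cases x) auto
        ultimately have "\<not> (p = u \<and> q = v)" "\<not> (p = v \<and> q = u)" using no by blast+
        then show "(case x of (i, p, q) \<Rightarrow> scale L i * (of_bool (p = u \<and> q = v) + of_bool (p = v \<and> q = u))) = 0"
          unfolding x prod.case by (simp only: of_bool_eq simp_thms add_0 mult_zero_right)
      qed
      then show ?thesis by simp
    qed
    with that show False by (simp add: reweighted_def)
  qed
  have nn: "0 \<le> ?H u v" for u v
    unfolding reweighted_def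
  proof (intro mult_nonneg_nonneg sum_list_nonneg)
    fix y assume "y \<in> set (map (\<lambda>(i, p, q). scale L i * (of_bool (p = u \<and> q = v) + of_bool (p = v \<and> q = u))) xs)"
    then obtain x where xs: "x \<in> set xs"
      and y: "y = (\<lambda>(i, p, q). scale L i * (of_bool (p = u \<and> q = v) + of_bool (p = v \<and> q = u))) x"
      by (metis (no_types, lifting) imageE set_map)
    obtain i p q where x: "x = (i, p, q)" by (cases x) auto
    have "0 < scale L i" using xs unfolding x by (rule sampler_support(5)[OF supp])
    then show "0 \<le> y" unfolding y x prod.case by (intro mult_nonneg_nonneg add_nonneg_nonneg) simp_all
  qed (use weight_pos in auto)
  have V: "u \<in> V \<and> v \<in> V \<and> u \<noteq> v \<and> 0 < str u v" if "?H u v \<noteq> 0" for u v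
  proof -
    obtain i where "(i, u, v) \<in> set xs \<or> (i, v, u) \<in> set xs" using pos[OF \<open>?H u v \<noteq> 0\<close>] by blast
    then show ?thesis
      using sampler_support[OF supp, of i u v] sampler_support[OF supp, of i v u] strength_commute[of G V u v] by auto
  qed
  show "wgraph_on n ?H"
    unfolding wgraph_on_def V_def[symmetric]
    using nn V reweighted_commute by blast
  show "card (edges ?H) \<le> N"
  proof -
    have "edges ?H \<subseteq> (\<lambda>(i, p, q). {p, q}) ` set xs"
    proof
      fix e assume "e \<in> edges ?H"
      then obtain u v where uv: "e = {u, v}" "?H u v \<noteq> 0" by (auto simp: edges_def)
      from pos[OF uv(2)] obtain i where "(i, u, v) \<in> set xs \<or> (i, v, u) \<in> set xs" by blast
      then show "e \<in> (\<lambda>(i, p, q). {p, q}) ` set xs" using uv(1) by (force simp: insert_commute)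
    qed
    then have "card (edges ?H) \<le> card ((\<lambda>(i, p, q). {p, q}) ` set xs)" by (intro card_mono) auto
    also have "\<dots> \<le> card (set xs)" by (intro card_image_le) simp
    also have "\<dots> \<le> N" using card_length[of xs] len by simp
    finally show ?thesis .
  qed
  show "?H u v = 0" if "u \<in> V" "v \<in> V" "u \<noteq> v" "str u v = 0"
    using V[of u v] that by auto
qed

lemma sum_class_reweighted:
  assumes N: "length xs = N" "0 < N" and S: "S \<subseteq> V" and C: "C \<subseteq> V" and t: "0 \<le> e"
    and dev: "C \<inter> S \<in> cuts C \<Longrightarrow> xs \<notin> deviating N e C (C \<inter> S)"
  shows "\<bar>(\<Sum>u\<in>C \<inter> S. \<Sum>v\<in>C - S. reweighted L Z xs u v / \<bar>str u v\<bar>) - cw sc (C \<inter> S) (C - S)\<bar>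
    \<le> e * cw sc (C \<inter> S) (C - S)"
proof (cases "C \<inter> S \<in> cuts C")
  case False
  then have "C \<inter> S = {} \<or> C \<inter> S = C" by (auto simp: cuts_def)
  then consider (1) "C \<inter> S = {}" | (2) "C - S = {}" by blast
  then show ?thesis
  proof cases
    case 1
    then show ?thesis by simp
  next
    case 2
    have "(\<Sum>u\<in>C \<inter> S. \<Sum>v\<in>C - S. reweighted L Z xs u v / \<bar>str u v\<bar>) = 0"
      unfolding 2 by simp
    then show ?thesis unfolding 2 by simp
  qed
next
  case True
  define A where "A = C \<inter> S"
  have CA: "C - S = C - A" by (auto simp: A_def)
  have fin: "finite A" "finite (C - A)" using finite_subset_V[OF C] by (auto simp: A_def)
  define W where "W = cw sc A (C - A)"
  define r where "r = 2 * real N / Z"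
  have r: "0 < r" using N weight_pos by (simp add: r_def)
  have "(\<Sum>u\<in>A. \<Sum>v\<in>C - A. reweighted L Z xs u v / \<bar>str u v\<bar>) = Z / (2 * real (length xs)) *
    (\<Sum>(i, p, q)\<leftarrow>xs. scale L i / \<bar>str p q\<bar> * (of_bool (p \<in> A \<and> q \<in> C - A) + of_bool (q \<in> A \<and> p \<in> C - A)))"
    using strength_commute[of G V] by (intro sum_reweighted fin) simp
  also have "(\<Sum>(i, p, q)\<leftarrow>xs. scale L i / \<bar>str p q\<bar> * (of_bool (p \<in> A \<and> q \<in> C - A) + of_bool (q \<in> A \<and> p \<in> C - A)))
     = (\<Sum>x\<leftarrow>xs. cut_statistic C A x)"
  proof (intro arg_cong[where f = sum_list] map_cong refl)
    fix x assume "x \<in> set xs"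
    obtain i p q where x: "x = (i, p, q)" by (cases x) auto
    have "of_bool (p \<in> A \<and> q \<in> C - A) + of_bool (q \<in> A \<and> p \<in> C - A) =
       (of_bool (p \<in> C \<and> q \<in> C \<and> (p \<in> A) \<noteq> (q \<in> A)) :: real)" by (auto simp: A_def)
    then show "(case x of (i, p, q) \<Rightarrow> scale L i / \<bar>str p q\<bar> * (of_bool (p \<in> A \<and> q \<in> C - A) + of_bool (q \<in> A \<and> p \<in> C - A)))
       = cut_statistic C A x" by (simp add: x cut_statistic_def)
  qed
  also have "Z / (2 * real (length xs)) = 1 / r" using N by (simp add: r_def)
  finally have X: "(\<Sum>u\<in>A. \<Sum>v\<in>C - A. reweighted L Z xs u v / \<bar>str u v\<bar>) = (\<Sum>x\<leftarrow>xs. cut_statistic C A x) / r"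
    by simp
  have "\<not> e * (r * W) \<le> \<bar>(\<Sum>x\<leftarrow>xs. cut_statistic C A x) - r * W\<bar>"
    using dev[OF True] by (simp add: deviating_def r_def W_def A_def[symmetric])
  then have "\<bar>(\<Sum>x\<leftarrow>xs. cut_statistic C A x) - r * W\<bar> / r \<le> e * (r * W) / r"
    using r by (intro divide_right_mono) auto
  also have "\<bar>(\<Sum>x\<leftarrow>xs. cut_statistic C A x) - r * W\<bar> / r = \<bar>((\<Sum>x\<leftarrow>xs. cut_statistic C A x) - r * W) / r\<bar>"
    using r by simp
  also have "((\<Sum>x\<leftarrow>xs. cut_statistic C A x) - r * W) / r = (\<Sum>x\<leftarrow>xs. cut_statistic C A x) / r - W"
    using r by (simp add: diff_divide_distrib)
  also have "e * (r * W) / r = e * W" using r by simp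
  finally show ?thesis unfolding CA A_def[symmetric] X W_def[symmetric] .
qed

text \<open>A cut weight is a sum of strength times scaled weight, for the graph and for the sample
  alike. By \<open>layer_cake_le\<close> it suffices to compare each level of the strength, and a
  level is a sum of class cuts, each accurate up to \<open>e\<close>.\<close>

lemma reweighted_cut:
  assumes xs: "xs \<in> set_pmf (replicate_pmf N sampler)" "xs \<notin> some_deviating N e"
    and N: "0 < N" and S: "S \<subseteq> V" and e: "0 \<le> e"
  shows "(1 - e) * F S \<le> cut_fun n (reweighted L Z xs) S \<and> cut_fun n (reweighted L Z xs) S \<le> (1 + e) * F S"
proof -
  define H where "H = reweighted L Z xs"
  define E where "E = S \<times> (V - S)"
  define k where "k = (\<lambda>(u, v). str u v)"
  define a where "a = (\<lambda>(u, v). H u v / \<bar>str u v\<bar>)"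
  define g where "g = (\<lambda>(u, v). sc u v)"
  have len: "length xs = N" using xs(1) by (simp add: set_replicate_pmf)
  have finS: "finite S" using S by (rule finite_subset_V)
  have finE: "finite E" using finS by (simp add: E_def)
  have EV: "u \<in> V \<and> v \<in> V \<and> u \<noteq> v" if "(u, v) \<in> E" for u v using that S by (auto simp: E_def)
  have kn: "0 \<le> k x" if "x \<in> E" for x using that EV str_nonneg by (cases x) (auto simp: k_def)
  have cut: "cut_fun n w S = (\<Sum>x\<in>E. case x of (u, v) \<Rightarrow> w u v)" for w
    by (simp add: cut_fun_def E_def V_def sum.cartesian_product)
  \<comment> \<open>Sampled pairs have positive strength, so where the division by strength is by
    zero the reweighted graph has no weight to lose.\<close>
  have ka: "(\<Sum>x\<in>E. k x * a x) = cut_fun n H S"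
    unfolding cut
  proof (rule sum.cong[OF refl])
    fix x assume xE: "x \<in> E"
    obtain u v where x: "x = (u, v)" by (cases x) auto
    with xE have uv: "u \<in> V" "v \<in> V" "u \<noteq> v" using EV by auto
    show "k x * a x = (case x of (u, v) \<Rightarrow> H u v)" unfolding x
      using str_nonneg[OF uv] reweighted_props(3)[OF xs(1) uv] by (cases "str u v = 0") (auto simp: k_def a_def H_def)
  qed
  have kg: "(\<Sum>x\<in>E. k x * g x) = F S"
    unfolding cut
  proof (rule sum.cong[OF refl])
    fix x assume xE: "x \<in> E"
    obtain u v where x: "x = (u, v)" by (cases x) auto
    with xE have uv: "u \<in> V" "v \<in> V" "u \<noteq> v" using EV by auto
    have "G u v \<le> str u v" using uv G_commute by (intro strength_ge_weight) auto
    then show "k x * g x = (case x of (u, v) \<Rightarrow> G u v)" unfolding x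
      using str_nonneg[OF uv] G_nonneg[of u v] by (cases "str u v = 0") (auto simp: k_def g_def scaled_def)
  qed
  have level: "\<bar>(\<Sum>x\<in>{x\<in>E. t \<le> k x}. a x) - (\<Sum>x\<in>{x\<in>E. t \<le> k x}. g x)\<bar> \<le> e * (\<Sum>x\<in>{x\<in>E. t \<le> k x}. g x)"
    if t: "t \<in> k ` E" "0 < t" for t
  proof -
    have thr: "t \<in> thresholds" using t EV by (auto simp: thresholds_def k_def image_iff)
    have A: "(\<Sum>x\<in>{x\<in>E. t \<le> k x}. a x) = (\<Sum>C\<in>classes t. \<Sum>u\<in>C \<inter> S. \<Sum>v\<in>C - S. H u v / \<bar>str u v\<bar>)"
      unfolding E_def k_def a_def by (rule sum_level_pairs[OF S])
    have B: "(\<Sum>x\<in>{x\<in>E. t \<le> k x}. g x) = (\<Sum>C\<in>classes t. cw sc (C \<inter> S) (C - S))"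
      unfolding E_def k_def g_def cw_def by (rule sum_level_pairs[OF S])
    have "\<bar>(\<Sum>C\<in>classes t. (\<Sum>u\<in>C \<inter> S. \<Sum>v\<in>C - S. H u v / \<bar>str u v\<bar>) - cw sc (C \<inter> S) (C - S))\<bar>
       \<le> (\<Sum>C\<in>classes t. \<bar>(\<Sum>u\<in>C \<inter> S. \<Sum>v\<in>C - S. H u v / \<bar>str u v\<bar>) - cw sc (C \<inter> S) (C - S)\<bar>)"
      by (rule sum_abs)
    also have "\<dots> \<le> (\<Sum>C\<in>classes t. e * cw sc (C \<inter> S) (C - S))"
    proof (rule sum_mono)
      fix C assume C: "C \<in> classes t"
      show "\<bar>(\<Sum>u\<in>C \<inter> S. \<Sum>v\<in>C - S. H u v / \<bar>str u v\<bar>) - cw sc (C \<inter> S) (C - S)\<bar> \<le> e * cw sc (C \<inter> S) (C - S)"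
        unfolding H_def
      proof (rule sum_class_reweighted[OF len N S class_subset[OF C] e])
        assume "C \<inter> S \<in> cuts C"
        then show "xs \<notin> deviating N e C (C \<inter> S)" using xs(2) thr C unfolding some_deviating_def by blast
      qed
    qed
    finally show ?thesis unfolding A B by (simp add: sum_subtractf sum_distrib_left)
  qed
  have "(\<Sum>x\<in>E. k x * a x) \<le> (\<Sum>x\<in>E. k x * ((1 + e) * g x))"
  proof (rule layer_cake_le[OF finE kn])
    fix t assume "t \<in> k ` E" "0 < t"
    from level[OF this] show "(\<Sum>x\<in>{x\<in>E. t \<le> k x}. a x) \<le> (\<Sum>x\<in>{x\<in>E. t \<le> k x}. (1 + e) * g x)"
      unfolding sum_distrib_left[symmetric] unfolding abs_le_iff distrib_right by simp
  qed
  also have "\<dots> = (1 + e) * F S" by (simp add: kg[symmetric] sum_distrib_left mult_ac)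
  finally have upper: "cut_fun n H S \<le> (1 + e) * F S" by (simp add: ka)
  have "(\<Sum>x\<in>E. k x * ((1 - e) * g x)) \<le> (\<Sum>x\<in>E. k x * a x)"
  proof (rule layer_cake_le[OF finE kn])
    fix t assume "t \<in> k ` E" "0 < t"
    from level[OF this] show "(\<Sum>x\<in>{x\<in>E. t \<le> k x}. (1 - e) * g x) \<le> (\<Sum>x\<in>{x\<in>E. t \<le> k x}. a x)"
      unfolding sum_distrib_left[symmetric] unfolding abs_le_iff left_diff_distrib by simp
  qed
  also have "(\<Sum>x\<in>E. k x * ((1 - e) * g x)) = (1 - e) * F S" by (simp add: kg[symmetric] sum_distrib_left mult_ac)
  finally have "(1 - e) * F S \<le> cut_fun n H S" by (simp add: ka)
  with upper show ?thesis by (simp add: H_def)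
qed

end

section \<open>The sparsification algorithm\<close>

definition group_queries :: "group list \<Rightarrow> nat set list" where
  "group_queries L = map (left_part L) [0..<length L] @ map (right_part L) [0..<length L] @
     map (\<lambda>i. left_part L i \<union> right_part L i) [0..<length L]"

definition sample_groups ::
  "nat set \<Rightarrow> nat \<Rightarrow> nat \<Rightarrow> group list \<Rightarrow> wgraph query_alg" where
  "sample_groups V b N L = bind_alg (ask_all V (group_queries L)) (\<lambda>T.
     let x = (\<lambda>i. cut_between T (left_part L i) (right_part L i) / scale L i) in
     bind_alg (repeat_alg N (sample_edge V b {..<length L} (left_part L) (right_part L) x))
       (\<lambda>xs. Return (reweighted L (sum x {..<length L}) xs)))"

text \<open>As no vertices are merged at the start, any positive scale satisfies the invariant. The
  total degree makes the initial \<open>D / kap\<close> at most 1, and 1 replaces it when there is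
  no weight.\<close>

definition sparsify :: "nat \<Rightarrow> nat \<Rightarrow> real \<Rightarrow> nat \<Rightarrow> wgraph query_alg" where
  "sparsify n b c N = bind_alg (ask_all {1..n} (map (\<lambda>v. {v}) (sorted_list_of_set {1..n}))) (\<lambda>T.
     let deg = (\<lambda>v. T {v}); D = sum deg {1..n} in
     bind_alg (contract {1..n} b c n (\<lambda>x. x) deg (if D \<le> 0 then 1 else D)) (sample_groups {1..n} b N))"

lemma queries_within_sample_groups: "queries_within V (sample_groups V b N L)"
  unfolding sample_groups_def Let_def
  by (intro queries_within_bind_alg queries_within_ask_all queries_within_repeat_alg queries_within_sample_edge) simp

lemma queries_within_sparsify: "queries_within {1..n} (sparsify n b c N)"
  unfolding sparsify_def Let_def
  by (intro queries_within_bind_alg queries_within_ask_all queries_within_contract queries_within_sample_groups)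

context query_graph
begin

definition sparsifiers :: "real \<Rightarrow> nat \<Rightarrow> wgraph set" where
  "sparsifiers e N = {H. wgraph_on n H \<and> card (edges H) \<le> N \<and>
     (\<forall>S\<subseteq>V. (1 - e) * F S \<le> cut_fun n H S \<and> cut_fun n H S \<le> (1 + e) * F S)}"

abbreviation "deg0 \<equiv> (\<lambda>v. if v \<in> V then F {v} else 0)"

lemma consistent_deg0: "consistent (\<lambda>x. x) deg0"
  by (auto simp: consistent_def cls_def intro!: arg_cong[where f = F])

definition kap0 :: real where
  "kap0 = (let D = sum deg0 V in if D \<le> 0 then 1 else D)"

lemma kap0_pos: "0 < kap0"
  by (simp add: kap0_def Let_def)

definition all_groups :: "nat \<Rightarrow> real \<Rightarrow> group list query_alg" where
  "all_groups b c = contract V b c n (\<lambda>x. x) deg0 kap0"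

lemma singleton_table:
  "(\<lambda>v. (\<lambda>S. if S \<in> set (map (\<lambda>v. {v}) (sorted_list_of_set V)) then F (S \<inter> V) else 0) {v}) = deg0"
  by (auto simp: fun_eq_iff)

lemma out_sparsify:
  "out F (sparsify n b c N) = bind_pmf (out F (all_groups b c)) (\<lambda>L. out F (sample_groups V b N L))"
  unfolding sparsify_def V_def[symmetric] out_bind_alg out_ask_all bind_return_pmf Let_def
    singleton_table all_groups_def kap0_def by (rule refl)

lemma potential_deg0: "1 \<le> n \<Longrightarrow> potential (\<lambda>x. x) deg0 \<le> 2 * cap * real n"
proof -
  assume n: "1 \<le> n"
  have "(\<Sum>a\<in>V. vertex_potential deg0 (sum deg0 V) a + cap) \<le> (\<Sum>a\<in>V. cap + cap)"
    by (intro sum_mono add_right_mono) (simp add: vertex_potential_def)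
  also have "\<dots> = 2 * cap * real n" by simp
  finally show ?thesis using cap_ge_1[OF n] unfolding potential_def image_ident Let_def by simp
qed

lemma outcome_all_groups:
  assumes "1 \<le> n" "0 \<le> c"
  shows "outcome F (all_groups b c)
    (\<lambda>L. valid_groups L \<and> real (length L) \<le> 2 * cap * real n \<and> group_weight L \<le> 4 + 512 * cap * real n)
    ((4 + 10 * real b * (c + 1)) * (2 * cap * real n))"
  unfolding all_groups_def
proof (rule outcome_weaken[OF outcome_contract[OF consistent_deg0 kap0_pos assms(2)]])
  have D: "4 * sum deg0 V / kap0 \<le> 4" by (simp add: kap0_def Let_def)
  show "valid_groups L \<and> real (length L) \<le> 2 * cap * real n \<and> group_weight L \<le> 4 + 512 * cap * real n"
    if "valid_groups L \<and> real (length L) \<le> potential (\<lambda>x. x) deg0 \<and>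
      group_weight L \<le> 4 * sum deg0 ((\<lambda>x. x) ` V) / kap0 + 256 * potential (\<lambda>x. x) deg0" for L
    using that D potential_deg0[OF assms(1)] unfolding image_ident by linarith
  show "(4 + 10 * real b * (c + 1)) * potential (\<lambda>x. x) deg0 \<le> (4 + 10 * real b * (c + 1)) * (2 * cap * real n)"
    using potential_deg0[OF assms(1)] assms(2) by (intro mult_left_mono) auto
qed

lemma outcome_sample_groups:
  "outcome F (sample_groups V b N L) (\<lambda>_. True) (3 * real (length L) + real N * (10 * real b))"
  unfolding sample_groups_def Let_def
  by (rule outcome_bind_alg[OF outcome_ask_all[where c = "3 * real (length L)"],
        where c' = "real N * (10 * real b)"],
      simp add: group_queries_def,
      rule outcome_bind_alg[OF outcome_repeat_alg[OF outcome_sample_edge]],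
      rule outcome_Return[where c = 0]) simp_all

lemma outcome_sparsify:
  assumes "1 \<le> n" "0 \<le> c"
  shows "outcome F (sparsify n b c N) (\<lambda>_. True)
    (real n + (7 + 10 * real b * (c + 1)) * (2 * cap * real n) + real N * (10 * real b))"
  unfolding sparsify_def V_def[symmetric]
proof (rule outcome_bind_alg[OF outcome_ask_all[where c = "real n"]])
  fix T assume T: "T = (\<lambda>S. if S \<in> set (map (\<lambda>v. {v}) (sorted_list_of_set V)) then F (S \<inter> V) else 0)"
  have deg: "(\<lambda>v. T {v}) = deg0" unfolding T by (rule singleton_table)
  show "outcome F (let deg = (\<lambda>v. T {v}); D = sum deg V in
     bind_alg (contract V b c n (\<lambda>x. x) deg (if D \<le> 0 then 1 else D)) (sample_groups V b N)) (\<lambda>_. True)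
     ((7 + 10 * real b * (c + 1)) * (2 * cap * real n) + real N * (10 * real b))"
    unfolding deg Let_def
  proof (rule outcome_bind_alg[OF outcome_all_groups[OF assms, unfolded all_groups_def kap0_def Let_def]])
    fix L assume L: "valid_groups L \<and> real (length L) \<le> 2 * cap * real n \<and> group_weight L \<le> 4 + 512 * cap * real n"
    show "outcome F (sample_groups V b N L) (\<lambda>_. True) (3 * (2 * cap * real n) + real N * (10 * real b))"
    proof (rule outcome_weaken[OF outcome_sample_groups])
      show "3 * real (length L) + real N * (10 * real b) \<le> 3 * (2 * cap * real n) + real N * (10 * real b)"
        using L by linarith
    qed simp
  qed (simp add: algebra_simps)
qed simp_all

lemma group_table:
  assumes "valid_groups L" "i < length L"
  shows "cut_between (\<lambda>S. if S \<in> set (group_queries L) then F (S \<inter> V) else 0) (left_part L i) (right_part L i)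
    = cw G (left_part L i) (right_part L i)"
proof (rule cut_table)
  obtain A B k where e: "L ! i = (A, B, k)" by (cases "L ! i") auto
  have "A \<subseteq> V \<and> B \<subseteq> V \<and> A \<inter> B = {} \<and> 0 < k"
    using assms nth_mem[OF assms(2)] unfolding valid_groups_def e by fastforce
  then show "left_part L i \<subseteq> V" "right_part L i \<subseteq> V" "left_part L i \<inter> right_part L i = {}"
    by (auto simp: left_part_def right_part_def e)
qed (use assms(2) in \<open>auto simp: group_queries_def\<close>)

lemma out_sample_groups:
  assumes "valid_groups L"
  shows "out F (sample_groups V b N L) = map_pmf (reweighted L (group_weight L))
    (replicate_pmf N (out F (sample_edge V b {..<length L} (left_part L) (right_part L)
       (\<lambda>i. cw G (left_part L i) (right_part L i) / scale L i))))"
proof -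
  let ?T = "\<lambda>S. if S \<in> set (group_queries L) then F (S \<inter> V) else 0"
  let ?x = "\<lambda>i. cut_between ?T (left_part L i) (right_part L i) / scale L i"
  let ?y = "\<lambda>i. cw G (left_part L i) (right_part L i) / scale L i"
  have eq: "?x i = ?y i" if "i \<in> {..<length L}" for i
    using group_table[OF assms] that by simp
  have 1: "sample_edge V b {..<length L} (left_part L) (right_part L) ?x =
      sample_edge V b {..<length L} (left_part L) (right_part L) ?y"
    by (rule sample_edge_cong) (rule eq)
  have "sum ?x {..<length L} = sum ?y {..<length L}" by (rule sum.cong[OF refl]) (rule eq)
  also have "\<dots> = group_weight L"
    unfolding group_weight_def sum_list_sum_nth
    by (auto simp: left_part_def right_part_def scale_def case_prod_unfold atLeast0LessThan)
  finally have 2: "sum ?x {..<length L} = group_weight L" .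
  show ?thesis
    unfolding sample_groups_def out_bind_alg out_ask_all bind_return_pmf Let_def 1 2 out_repeat_alg
    by (simp add: map_pmf_def)
qed

text \<open>Every edge lies in a group of positive scale, so weightless groups mean an edgeless
  graph. In this case edge sampling has no meaning, but the prefactor \<open>Z = 0\<close> still
  makes the output correct.\<close>

lemma group_weight_zero:
  assumes "valid_groups L" "good_groups (\<lambda>x. x) L" "group_weight L \<le> 0"
  shows "G u v = 0"
proof (rule ccontr)
  assume "G u v \<noteq> 0"
  then have G: "0 < G u v" using G_nonneg[of u v] by simp
  then have "u \<noteq> v" by auto
  with assms(2) G have c: "(\<Sum>(A, B, kap)\<leftarrow>L. of_bool (u \<in> A \<and> v \<in> B)) = (1::real)"
    by (auto simp: good_groups_def)
  have "\<exists>A B kap. (A, B, kap) \<in> set L \<and> u \<in> A \<and> v \<in> B"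
  proof (rule ccontr)
    assume no: "\<not> ?thesis"
    have "(\<Sum>(A, B, kap)\<leftarrow>L. of_bool (u \<in> A \<and> v \<in> B)) = (\<Sum>x\<leftarrow>L. 0::real)"
    proof (intro arg_cong[where f = sum_list] map_cong refl)
      fix x assume "x \<in> set L"
      moreover obtain A B k where x: "x = (A, B, k)" by (cases x) auto
      ultimately have "\<not> (u \<in> A \<and> v \<in> B)" using no by blast
      then show "(case x of (A, B, kap) \<Rightarrow> of_bool (u \<in> A \<and> v \<in> B)) = (0::real)" by (simp add: x)
    qed
    with c show False by simp
  qed
  then obtain A B k where m: "(A, B, k) \<in> set L" "u \<in> A" "v \<in> B" by blast
  have val: "A \<subseteq> V \<and> B \<subseteq> V \<and> A \<inter> B = {} \<and> 0 < k" if "(A, B, k) \<in> set L" for A B k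
    using assms(1) that unfolding valid_groups_def by fastforce
  have "G u v = cw G {u} {v}" by (simp add: cw_def)
  also have "\<dots> \<le> cw G A B" using m val[OF m(1)] finite_subset_V by (intro cw_mono G_nonneg) auto
  finally have "0 < cw G A B / k" using G val[OF m(1)] by simp
  also have "\<dots> \<le> group_weight L"
    unfolding group_weight_def
  proof (rule member_le_sum_list)
    show "cw G A B / k \<in> set (map (\<lambda>(A, B, kap). cw G A B / kap) L)" using m(1) by force
    fix y assume "y \<in> set (map (\<lambda>(A, B, kap). cw G A B / kap) L)"
    then obtain A B k where "(A, B, k) \<in> set L" "y = cw G A B / k" by auto
    then show "0 \<le> y" using val[of A B k] cw_nonneg[of G A B] G_nonneg by simp
  qed
  finally show False using assms(3) by simp
qed

text \<open>\<open>t\<close> is at most half of the exponent available per unit of cut weight, so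
  the condition on \<open>n * exp (- t)\<close> is the one under which the series over cuts is
  geometric.\<close>

lemma prob_sample_groups:
  assumes L: "valid_groups L" "good_groups (\<lambda>x. x) L" and b: "n < 2 ^ b" and N: "0 < N"
    and e: "0 < e" "e \<le> 1" and T: "2 * t \<le> e\<^sup>2 * real N / (2 * group_weight L) \<or> group_weight L \<le> 0"
    and t: "real n * exp (- t) \<le> 1 / 2"
  shows "measure_pmf.prob (out F (sample_groups V b N L)) (- sparsifiers e N) \<le> 8 * real n ^ 6 * exp (- 2 * t)"
proof (cases "group_weight L \<le> 0")
  case True
  have G0: "G u v = 0" for u v using group_weight_zero[OF L True] .
  have gw: "group_weight L = 0"
  proof -
    have "cw G A B = 0" for A B by (simp add: cw_def G0)
    then have "group_weight L = (\<Sum>x\<leftarrow>L. 0)"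
      unfolding group_weight_def by (intro arg_cong[where f = sum_list] map_cong refl) auto
    then show ?thesis by simp
  qed
  have "reweighted L 0 xs = (\<lambda>_ _. 0)" for xs by (simp add: reweighted_def fun_eq_iff)
  moreover have "(\<lambda>_ _. 0) \<in> sparsifiers e N"
    by (auto simp: sparsifiers_def wgraph_on_def edges_def cut_fun_def G0)
  ultimately have "measure_pmf.prob (out F (sample_groups V b N L)) (- sparsifiers e N) = 0"
    unfolding out_sample_groups[OF L(1)] gw by (simp add: measure_map_pmf vimage_def)
  then show ?thesis by simp
next
  case False
  interpret group_sampling n G L b
    by unfold_locales (use L b False in auto)
  have T': "2 * t \<le> e\<^sup>2 * real N / (2 * Z)" using T False by simp
  have out: "out F (sample_groups V b N L) = map_pmf (reweighted L Z) (replicate_pmf N sampler)"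
    unfolding out_sample_groups[OF L(1)] sampler_def rate_def[abs_def] ..
  have sub: "(reweighted L Z -` (- sparsifiers e N)) \<inter> set_pmf (replicate_pmf N sampler) \<subseteq> some_deviating N e"
  proof
    fix xs assume xs: "xs \<in> (reweighted L Z -` (- sparsifiers e N)) \<inter> set_pmf (replicate_pmf N sampler)"
    show "xs \<in> some_deviating N e"
    proof (rule ccontr)
      assume "xs \<notin> some_deviating N e"
      then have "reweighted L Z xs \<in> sparsifiers e N"
        unfolding sparsifiers_def using xs reweighted_props(1,2)[of xs N] reweighted_cut[of xs N e] N e by auto
      then show False using xs by simp
    qed
  qed
  have "measure_pmf.prob (out F (sample_groups V b N L)) (- sparsifiers e N) =
      measure_pmf.prob (replicate_pmf N sampler) (reweighted L Z -` (- sparsifiers e N))"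
    unfolding out by (rule measure_map_pmf)
  also have "\<dots> = measure_pmf.prob (replicate_pmf N sampler) ((reweighted L Z -` (- sparsifiers e N)) \<inter> set_pmf (replicate_pmf N sampler))"
    by (rule measure_Int_set_pmf[symmetric])
  also have "\<dots> \<le> measure_pmf.prob (replicate_pmf N sampler) (some_deviating N e)"
    using sub by (intro measure_pmf.finite_measure_mono) auto
  also have "\<dots> \<le> 8 * real n ^ 6 * exp (- (e\<^sup>2 * real N / (2 * Z)))"
  proof (rule prob_some_deviating)
    have "real n * exp (- (e\<^sup>2 * real N / (2 * Z)) / 2) \<le> real n * exp (- t)"
      using T' by (intro mult_left_mono) auto
    then show "real n * exp (- (e\<^sup>2 * real N / (2 * Z)) / 2) \<le> 1 / 2" using t by simp
  qed (use e in auto)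
  also have "\<dots> \<le> 8 * real n ^ 6 * exp (- 2 * t)" using T' by (intro mult_left_mono) auto
  finally show ?thesis .
qed

lemma prob_sparsify:
  assumes n: "1 \<le> n" and b: "n < 2 ^ b" and N: "0 < N" and e: "0 < e" "e \<le> 1"
    and c: "32 * ln (real n) \<le> c" "0 < c"
    and T: "4 * t * (4 + 512 * cap * real n) \<le> e\<^sup>2 * real N" and t: "real n * exp (- t) \<le> 1 / 2" "0 \<le> t"
  shows "measure_pmf.prob (out F (sparsify n b c N)) (- sparsifiers e N)
    \<le> real n * (2 * real n * exp (- c / 32)) + 8 * real n ^ 6 * exp (- 2 * t)"
  unfolding out_sparsify
proof (rule prob_bind_pmf_le)
  show "measure_pmf.prob (out F (all_groups b c)) {L. \<not> good_groups (\<lambda>x. x) L} \<le> real n * (2 * real n * exp (- c / 32))"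
    unfolding all_groups_def
    by (rule prob_contract_bad[OF consistent_deg0 _ kap0_pos _ b c]) (auto simp: strongly_merged_def)
  fix L assume L: "L \<in> set_pmf (out F (all_groups b c))" "L \<notin> {L. \<not> good_groups (\<lambda>x. x) L}"
  have val: "valid_groups L \<and> real (length L) \<le> 2 * cap * real n \<and> group_weight L \<le> 4 + 512 * cap * real n"
    using outcome_set_out[OF outcome_all_groups L(1)] n c(2) by simp
  show "measure_pmf.prob (out F (sample_groups V b N L)) (- sparsifiers e N) \<le> 8 * real n ^ 6 * exp (- 2 * t)"
  proof (rule prob_sample_groups[OF _ _ b N e _ t(1)])
    show "2 * t \<le> e\<^sup>2 * real N / (2 * group_weight L) \<or> group_weight L \<le> 0"
    proof (cases "group_weight L \<le> 0")
      case False
      have "4 * t * group_weight L \<le> 4 * t * (4 + 512 * cap * real n)" using val t(2) by (intro mult_left_mono) auto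
      also have "\<dots> \<le> e\<^sup>2 * real N" by (rule T)
      finally show ?thesis using False by (simp add: pos_le_divide_eq mult_ac)
    qed simp
  qed (use val L in auto)
qed simp

end

section \<open>Numerical constants\<close>

lemma ex_bits:
  fixes n :: nat
  assumes n: "3 \<le> n"
  obtains b where "n < 2 ^ b" "real b \<le> 3 * ln (real n)" "1 \<le> ln (real n)"
proof -
  have "exp 1 \<le> real n" using exp_le n by linarith
  then have L1: "1 \<le> ln (real n)" using n by (subst ln_ge_iff) auto
  obtain k where k: "2 ^ k \<le> n" "n < 2 ^ (k + 1)"
    using ex_power_ivl1[of 2 n] n by auto
  have "real (2 ^ k) \<le> real n" using k(1) by (rule of_nat_mono)
  then have "ln (2 ^ k) \<le> ln (real n)" using n by (subst ln_le_cancel_iff) simp_all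
  then have "real k * ln 2 \<le> ln (real n)" by (simp add: ln_realpow)
  moreover have "1 / 2 \<le> ln (2::real)"
    using ln_le_minus_one[of "1 / 2 :: real"] by (simp add: ln_div)
  then have "real k * (1 / 2) \<le> real k * ln 2" by (intro mult_left_mono) auto
  ultimately have "real (k + 1) \<le> 3 * ln (real n)" using L1 by simp
  then show thesis using that[of "k + 1"] k(2) L1 by blast
qed

context query_graph
begin

text \<open>\<open>ln (4 / 3) \<ge> 1 / 4\<close> and \<open>ln 4 \<le> 3\<close> bound
  \<open>cap\<close> by \<open>13 + 4 * ln n\<close>.\<close>

lemma cap_le: "1 \<le> ln (real n) \<Longrightarrow> cap \<le> 17 * ln (real n)"
proof -
  assume L: "1 \<le> ln (real n)"
  then have n: "0 < real n" by (cases "n = 0") auto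
  have "ln (4 / 3 :: real) = - ln (3 / 4)" by (simp add: ln_div)
  then have q: "1 / 4 \<le> ln (4 / 3 :: real)" using ln_le_minus_one[of "3 / 4 :: real"] by simp
  have "ln (4 * real n) = ln 4 + ln (real n)" using n by (simp add: ln_mult)
  then have num: "ln (4 * real n) \<le> 3 + ln (real n)" "0 \<le> ln (4 * real n)"
    using ln_le_minus_one[of "4 :: real"] L by auto
  have "ln (4 * real n) / ln (4 / 3) \<le> ln (4 * real n) / (1 / 4)"
    using q num by (intro divide_left_mono) auto
  then show ?thesis using num L by (simp add: cap_def log43_def)
qed

end

text \<open>\<open>c = 32 * d * ln n\<close> makes \<open>exp (- c / 32)\<close> equal to
  \<open>n powr (- d)\<close>. By \<open>cap_le\<close> the group weight is at most
  \<open>(4 + 512 * 17) * n * ln n\<close>, rounded up to 9000; the factor 4 of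
  \<open>prob_sparsify\<close> and \<open>t = d * ln n\<close> then give 36000. Both failure terms,
  with exponents \<open>2 - d\<close> and \<open>6 - 2 * d\<close>, are below the exponent
  \<open>5 - d\<close>.\<close>

lemma sparsify_correct:
  fixes d eps :: real and n N b :: nat
  assumes d: "5 < d" and eps: "0 < eps" "eps < 1 / 2" and n: "3 \<le> n" and G: "wgraph_on n G"
    and b: "n < 2 ^ b" and N: "N = nat \<lceil>36000 * d * real n * ln (real n) ^ 2 / eps\<^sup>2\<rceil>"
  shows "1 - 10 * real n powr (5 - d) \<le> measure_pmf.prob (out (cut_fun n G) (sparsify n b (32 * d * ln (real n)) N))
    {H. wgraph_on n H \<and> card (edges H) \<le> N \<and> (\<forall>S\<subseteq>{1..n}.
      (1 - eps) * cut_fun n G S \<le> cut_fun n H S \<and> cut_fun n H S \<le> (1 + eps) * cut_fun n G S)}"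
proof -
  interpret query_graph n G by unfold_locales (rule G)
  define l where "l = ln (real n)"
  have l1: "1 \<le> l" using n by (rule ex_bits) (simp add: l_def)
  define M where "M = 36000 * d * real n * l ^ 2 / eps\<^sup>2"
  have M0: "0 < M" using d n l1 eps by (simp add: M_def)
  then have N0: "0 < N" using N by (simp add: M_def l_def)
  have NM: "M \<le> real N" unfolding N M_def l_def by linarith
  have pn: "exp (- (d * l)) = real n powr (- d)" using n by (simp add: powr_def l_def)
  have "measure_pmf.prob (out F (sparsify n b (32 * d * l) N)) (- sparsifiers eps N)
    \<le> real n * (2 * real n * exp (- (32 * d * l) / 32)) + 8 * real n ^ 6 * exp (- 2 * (d * l))"
  proof (rule prob_sparsify[OF _ b N0 eps(1)])
    show "32 * ln (real n) \<le> 32 * d * l" using d l1 by (simp add: l_def)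
    show "0 < 32 * d * l" using d l1 by simp
    show "0 \<le> d * l" using d l1 by simp
    have "cap * real n \<le> 17 * l * real n" using cap_le l1 by (intro mult_right_mono) (auto simp: l_def)
    moreover have "1 \<le> l * real n" using l1 n mult_mono[of 1 l 1 "real n"] by simp
    ultimately have "4 + 512 * cap * real n \<le> 9000 * (l * real n)" by simp
    then have "4 * (d * l) * (4 + 512 * cap * real n) \<le> 4 * (d * l) * (9000 * (l * real n))"
      using d l1 by (intro mult_left_mono) auto
    also have "\<dots> = eps\<^sup>2 * M" using eps by (simp add: M_def power2_eq_square)
    also have "\<dots> \<le> eps\<^sup>2 * real N" using NM by (intro mult_left_mono) auto
    finally show "4 * (d * l) * (4 + 512 * cap * real n) \<le> eps\<^sup>2 * real N" .
    have "real n * exp (- (d * l)) = real n powr (1 - d)" unfolding pn using n by (simp add: powr_diff powr_minus divide_inverse)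
    also have "\<dots> \<le> real n powr (- 1)" using d n by (intro powr_mono) auto
    also have "\<dots> = 1 / real n" using n by (simp add: powr_minus divide_inverse)
    also have "\<dots> \<le> 1 / 2" using n by (intro divide_left_mono) auto
    finally show "real n * exp (- (d * l)) \<le> 1 / 2" .
  qed (use n eps in auto)
  also have "\<dots> = 2 * (real n ^ 2 * real n powr (- d)) + 8 * (real n ^ 6 * real n powr (- 2 * d))"
  proof -
    have "exp (- (32 * d * l) / 32) = real n powr (- d)" unfolding pn[symmetric] by simp
    moreover have "exp (- 2 * (d * l)) = real n powr (- 2 * d)" using n by (simp add: powr_def l_def)
    ultimately show ?thesis by (simp add: power2_eq_square)
  qed
  also have "real n ^ 2 * real n powr (- d) = real n powr (2 - d)"
    using n powr_add[of "real n" 2 "- d"] by (simp add: powr_numeral)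
  also have "real n ^ 6 * real n powr (- 2 * d) = real n powr (6 - 2 * d)"
    using n powr_add[of "real n" 6 "- 2 * d"] by (simp add: powr_numeral)
  also have "2 * real n powr (2 - d) + 8 * real n powr (6 - 2 * d) \<le> 2 * real n powr (5 - d) + 8 * real n powr (5 - d)"
    using d n by (intro add_mono mult_left_mono powr_mono) auto
  finally have bad: "measure_pmf.prob (out F (sparsify n b (32 * d * l) N)) (- sparsifiers eps N) \<le> 10 * real n powr (5 - d)"
    by simp
  have "measure_pmf.prob (out F (sparsify n b (32 * d * l) N)) (sparsifiers eps N)
      = 1 - measure_pmf.prob (out F (sparsify n b (32 * d * l) N)) (- sparsifiers eps N)"
    using measure_pmf.prob_compl[of "- sparsifiers eps N" "out F (sparsify n b (32 * d * l) N)"]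
    by (simp add: Compl_eq_Diff_UNIV[symmetric])
  with bad show ?thesis unfolding sparsifiers_def V_def l_def by linarith
qed

text \<open>The fourth power of the logarithm comes from the first stage: potential, number of
  samples per vertex and digits per sample give the cube, raised by one for the target form. The
  term with \<open>1 / eps\<^sup>2\<close> is the second stage, \<open>N\<close> samples of
  logarithmic cost.\<close>

lemma sparsify_queries:
  fixes d eps :: real and n N b :: nat
  assumes d: "5 < d" and eps: "0 < eps" and n: "3 \<le> n" and G: "wgraph_on n G"
    and b: "real b \<le> 3 * ln (real n)"
    and N: "N = nat \<lceil>36000 * d * real n * ln (real n) ^ 2 / eps\<^sup>2\<rceil>"
  shows "outcome (cut_fun n G) (sparsify n b (32 * d * ln (real n)) N) (\<lambda>_. True)
    ((1400000 * d) * (real n * ln (real n) ^ 3 * (ln (real n) + 1 / eps\<^sup>2)))"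
proof -
  interpret query_graph n G by unfold_locales (rule G)
  define l where "l = ln (real n)"
  define x where "x = real n"
  have l1: "1 \<le> l" using n by (rule ex_bits) (simp add: l_def)
  have x1: "1 \<le> x" using n by (simp add: x_def)
  define c where "c = 32 * d * l"
  have c0: "0 \<le> c" using d l1 by (simp add: c_def)
  define y where "y = 1 / eps\<^sup>2"
  have y0: "0 < y" using eps by (simp add: y_def)
  have cap: "0 \<le> cap" "cap \<le> 17 * l" using cap_ge_1 n cap_le l1 by (auto simp: l_def intro: order_trans)
  have p: "l \<le> l ^ 2" "l \<le> l ^ 3" "l \<le> l ^ 4" "1 \<le> l ^ 4" "l ^ 3 \<le> l ^ 4"
    using l1 power_increasing[of 1 2 l] power_increasing[of 1 3 l] power_increasing[of 1 4 l]
      power_increasing[of 3 4 l] one_le_power[of l 4] by auto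
  have bc: "7 + 10 * real b * (c + 1) \<le> (37 + 960 * d) * l ^ 2"
  proof -
    have "10 * real b * (c + 1) \<le> 30 * l * (c + 1)" using b c0 by (intro mult_right_mono) (auto simp: l_def)
    also have "\<dots> = 960 * d * l ^ 2 + 30 * l" by (simp add: c_def power2_eq_square algebra_simps)
    also have "\<dots> \<le> 960 * d * l ^ 2 + 30 * l ^ 2" using p(1) by simp
    finally show ?thesis using one_le_power[OF l1, of 2] by (simp add: algebra_simps)
  qed
  have first: "(7 + 10 * real b * (c + 1)) * (2 * cap * x) \<le> (1258 + 32640 * d) * (x * l ^ 4)"
  proof -
    have "(7 + 10 * real b * (c + 1)) * (2 * cap * x) \<le> ((37 + 960 * d) * l ^ 2) * (2 * (17 * l) * x)"
      using bc cap x1 l1 d c0 by (intro mult_mono) auto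
    also have "\<dots> = (1258 + 32640 * d) * (x * l ^ 3)" by (simp add: power2_eq_square power3_eq_cube algebra_simps)
    also have "\<dots> \<le> (1258 + 32640 * d) * (x * l ^ 4)" using p(5) x1 d by (intro mult_left_mono) auto
    finally show ?thesis .
  qed
  have second: "real N * (10 * real b) \<le> 1080000 * d * (x * l ^ 3 * y) + 30 * (x * l ^ 4)"
  proof -
    have "0 \<le> 36000 * d * x * l ^ 2 * y" using d x1 y0 by simp
    then have "real N \<le> 36000 * d * x * l ^ 2 * y + 1" unfolding N x_def l_def y_def by (simp add: of_nat_nat)
    then have "real N * (10 * real b) \<le> (36000 * d * x * l ^ 2 * y + 1) * (10 * (3 * l))"
      using b l1 \<open>0 \<le> 36000 * d * x * l ^ 2 * y\<close> by (intro mult_mono) (auto simp: l_def)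
    also have "\<dots> = 1080000 * d * (x * l ^ 3 * y) + 30 * l" by (simp add: power2_eq_square power3_eq_cube algebra_simps)
    also have "30 * l \<le> 30 * (x * l ^ 4)" using p(3) l1 x1 mult_mono[of 1 x l "l ^ 4"] by simp
    finally show ?thesis by simp
  qed
  have third: "x \<le> x * l ^ 4" using p(4) x1 mult_left_mono[of 1 "l ^ 4" x] by simp
  have "x + (7 + 10 * real b * (c + 1)) * (2 * cap * x) + real N * (10 * real b)
      \<le> (1289 + 32640 * d) * (x * l ^ 4) + 1080000 * d * (x * l ^ 3 * y)"
    using first second third by (simp add: algebra_simps)
  also have "\<dots> \<le> (1400000 * d) * (x * l ^ 4) + (1400000 * d) * (x * l ^ 3 * y)"
    using d x1 l1 y0 by (intro add_mono mult_right_mono) auto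
  also have "\<dots> = (1400000 * d) * (x * l ^ 3 * (l + y))" by (simp add: algebra_simps power_def numeral_eq_Suc)
  finally show ?thesis
    using outcome_weaken[OF outcome_sparsify[of c b N]] n c0 unfolding x_def y_def c_def l_def by auto
qed

lemma prob_run_eq_out:
  "measure_pmf.prob (run F a) {(H, q). P H} = measure_pmf.prob (out F a) {H. P H}"
  unfolding out_def measure_map_pmf by (simp add: vimage_def case_prod_unfold)

lemma zero_graph: "wgraph_on n (\<lambda>_ _. 0)" "edges (\<lambda>_ _. 0) = {}" "cut_fun n (\<lambda>_ _. 0) S = 0"
  by (auto simp: wgraph_on_def edges_def cut_fun_def)

lemma choice_on: "\<forall>n. P n \<longrightarrow> (\<exists>a. Q n a) \<Longrightarrow> \<exists>A. \<forall>n. P n \<longrightarrow> Q n (A n)"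
  by metis

theorem theorem4p13:
  fixes d :: real
  assumes "d > 5"
  shows "\<exists>(C1 :: real) (C2 :: real) (k :: nat). \<forall>\<epsilon> :: real. \<epsilon> > 0 \<longrightarrow>
    (\<exists>(K :: real) (A :: nat \<Rightarrow> wgraph query_alg). \<forall>n :: nat. n \<ge> 1 \<longrightarrow>
      queries_within {1..n} (A n) \<and>
      (\<forall>G. wgraph_on n G \<longrightarrow>
        (\<forall>(H, q) \<in> set_pmf (run (cut_fun n G) (A n)).
           real q \<le> C1 * (real n * ln (real n) ^ 3 * (ln (real n) + 1 / \<epsilon>\<^sup>2))) \<and>
        measure_pmf.prob (run (cut_fun n G) (A n))
          {(H, q). wgraph_on n H \<and>
             real (card (edges H)) \<le> K * (real n * ln (real n) ^ k) \<and>
             (\<forall>S \<subseteq> {1..n}. (1 - 2 * \<epsilon>) * cut_fun n G S \<le> cut_fun n H S \<and>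
                              cut_fun n H S \<le> (1 + 2 * \<epsilon>) * cut_fun n G S)}
          \<ge> 1 - C2 * real n powr (5 - d)))"
proof -
  define C1 where "C1 = 1400000 * d"
  \<comment> \<open>The second summand makes the claimed probability nonpositive for
    \<open>n \<le> 2\<close>, where \<open>ln n\<close> is too small for the estimates.\<close>
  define C2 where "C2 = 10 + 2 powr (d - 5)"
  let ?Q = "\<lambda>\<epsilon> K n a. queries_within {1..n} a \<and>
      (\<forall>G. wgraph_on n G \<longrightarrow>
        (\<forall>(H, q) \<in> set_pmf (run (cut_fun n G) a).
           real q \<le> C1 * (real n * ln (real n) ^ 3 * (ln (real n) + 1 / \<epsilon>\<^sup>2))) \<and>
        measure_pmf.prob (run (cut_fun n G) a)
          {(H, q). wgraph_on n H \<and>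
             real (card (edges H)) \<le> K * (real n * ln (real n) ^ 2) \<and>
             (\<forall>S \<subseteq> {1..n}. (1 - 2 * \<epsilon>) * cut_fun n G S \<le> cut_fun n H S \<and>
                              cut_fun n H S \<le> (1 + 2 * \<epsilon>) * cut_fun n G S)}
          \<ge> 1 - C2 * real n powr (5 - d))"
  \<comment> \<open>\<open>K\<close> has to be chosen before \<open>n\<close>, the algorithm after
    it; \<open>choice_on\<close> later gathers the algorithms into one family.\<close>
  have main: "\<exists>K. \<forall>n\<ge>1. \<exists>a. ?Q \<epsilon> K n a" if eps: "\<epsilon> > 0" for \<epsilon> :: real
  proof -
    define K where "K = 36000 * d / \<epsilon>\<^sup>2 + 1"
    have K0: "0 \<le> K" using assms by (simp add: K_def)
    have "\<exists>a. ?Q \<epsilon> K n a" if n1: "n \<ge> 1" for n :: nat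
    proof -
      have l0: "0 \<le> ln (real n)" using n1 by simp
      have qb: "0 \<le> C1 * (real n * ln (real n) ^ 3 * (ln (real n) + 1 / \<epsilon>\<^sup>2))"
        using assms l0 by (simp add: C1_def)
      show "\<exists>a. ?Q \<epsilon> K n a"
      proof (cases "\<epsilon> < 1 / 2 \<and> 3 \<le> n")
        case False
        have "?Q \<epsilon> K n (Return (\<lambda>_ _. 0))"
        proof (intro conjI allI impI)
          fix G assume G: "wgraph_on n G"
          interpret query_graph n G by unfold_locales (rule G)
          show "\<forall>(H, q) \<in> set_pmf (run F (Return (\<lambda>_ _. 0))).
             real q \<le> C1 * (real n * ln (real n) ^ 3 * (ln (real n) + 1 / \<epsilon>\<^sup>2))" using qb by simp
          let ?E = "{(H, q :: nat). wgraph_on n H \<and> real (card (edges H)) \<le> K * (real n * ln (real n) ^ 2) \<and>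
               (\<forall>S \<subseteq> {1..n}. (1 - 2 * \<epsilon>) * F S \<le> cut_fun n H S \<and> cut_fun n H S \<le> (1 + 2 * \<epsilon>) * F S)}"
          show "1 - C2 * real n powr (5 - d) \<le> measure_pmf.prob (run F (Return (\<lambda>_ _. 0))) ?E"
          proof (cases "\<epsilon> < 1 / 2")
            case True
            then have "n = 1 \<or> n = 2" using False n1 by auto
            then have "2 powr (5 - d) \<le> real n powr (5 - d)"
              using assms powr_mono2'[of "5 - d" "real n" 2] by auto
            then have "C2 * 2 powr (5 - d) \<le> C2 * real n powr (5 - d)"
              by (intro mult_left_mono) (auto simp: C2_def)
            moreover have "C2 * 2 powr (5 - d) = 10 * 2 powr (5 - d) + 1"
              by (simp add: C2_def distrib_right flip: powr_add)
            moreover have "0 \<le> 2 powr (5 - d)" by simp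
            ultimately have "1 - C2 * real n powr (5 - d) \<le> 0" by linarith
            then show ?thesis using measure_nonneg order_trans by blast
          next
            \<comment> \<open>From \<open>1 / 2\<close> on the lower factor is nonpositive, so the
              graph without edges qualifies and costs no query.\<close>
            case big: False
            have "(1 - 2 * \<epsilon>) * F S \<le> 0" "0 \<le> (1 + 2 * \<epsilon>) * F S" for S
              using big F_nonneg[of S] by (auto simp: mult_le_0_iff)
            then have "((\<lambda>_ _. 0), 0) \<in> ?E" using K0 l0 by (simp add: zero_graph)
            then have "measure_pmf.prob (run F (Return (\<lambda>_ _. 0))) ?E = 1" by simp
            moreover have "0 \<le> C2 * real n powr (5 - d)" by (simp add: C2_def)
            ultimately show ?thesis by linarith
          qed
        qed simp
        then show ?thesis by blast
      next
        case True
        then have eps2: "\<epsilon> < 1 / 2" and n3: "3 \<le> n" by auto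
        obtain b where b: "n < 2 ^ b" "real b \<le> 3 * ln (real n)" and l1: "1 \<le> ln (real n)"
          using n3 by (rule ex_bits)
        define N where "N = nat \<lceil>36000 * d * real n * ln (real n) ^ 2 / \<epsilon>\<^sup>2\<rceil>"
        have NK: "real N \<le> K * (real n * ln (real n) ^ 2)"
        proof -
          have "0 \<le> 36000 * d * real n * ln (real n) ^ 2 / \<epsilon>\<^sup>2" using assms by simp
          then have "real N \<le> 36000 * d * real n * ln (real n) ^ 2 / \<epsilon>\<^sup>2 + 1" unfolding N_def by (simp add: of_nat_nat)
          also have "1 \<le> real n * ln (real n) ^ 2"
            using n1 l1 one_le_power[of "ln (real n)" 2] mult_mono[of 1 "real n" 1 "ln (real n) ^ 2"] by simp
          finally show ?thesis by (simp add: K_def algebra_simps)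
        qed
        let ?a = "sparsify n b (32 * d * ln (real n)) N"
        have "?Q \<epsilon> K n ?a"
        proof (intro conjI allI impI)
          show "queries_within {1..n} ?a" by (rule queries_within_sparsify)
          fix G assume G: "wgraph_on n G"
          interpret query_graph n G by unfold_locales (rule G)
          show "\<forall>(H, q) \<in> set_pmf (run F ?a).
             real q \<le> C1 * (real n * ln (real n) ^ 3 * (ln (real n) + 1 / \<epsilon>\<^sup>2))"
            using sparsify_queries[OF assms eps n3 G b(2) N_def] by (simp add: outcome_def C1_def)
          have "1 - C2 * real n powr (5 - d) \<le> 1 - 10 * real n powr (5 - d)"
            by (simp add: C2_def distrib_right)
          also have "\<dots> \<le> measure_pmf.prob (out F ?a)
            {H. wgraph_on n H \<and> card (edges H) \<le> N \<and> (\<forall>S\<subseteq>{1..n}.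
                (1 - \<epsilon>) * F S \<le> cut_fun n H S \<and> cut_fun n H S \<le> (1 + \<epsilon>) * F S)}"
            by (rule sparsify_correct[OF assms eps eps2 n3 G b(1) N_def])
          also have "\<dots> \<le> measure_pmf.prob (out F ?a)
            {H. wgraph_on n H \<and> real (card (edges H)) \<le> K * (real n * ln (real n) ^ 2) \<and>
               (\<forall>S \<subseteq> {1..n}. (1 - 2 * \<epsilon>) * F S \<le> cut_fun n H S \<and> cut_fun n H S \<le> (1 + 2 * \<epsilon>) * F S)}"
          proof (rule measure_pmf.finite_measure_mono, rule Collect_mono, intro impI, elim conjE, intro conjI allI impI)
            fix H S assume H: "card (edges H) \<le> N" "S \<subseteq> {1..n}"
              "\<forall>S\<subseteq>{1..n}. (1 - \<epsilon>) * F S \<le> cut_fun n H S \<and> cut_fun n H S \<le> (1 + \<epsilon>) * F S"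
            have "0 \<le> \<epsilon> * F S" using eps F_nonneg by simp
            then show "(1 - 2 * \<epsilon>) * F S \<le> cut_fun n H S" "cut_fun n H S \<le> (1 + 2 * \<epsilon>) * F S"
              using H(3)[rule_format, OF H(2)] by (simp_all add: left_diff_distrib distrib_right mult.assoc)
          next
            fix H assume "card (edges H) \<le> N"
            then show "real (card (edges H)) \<le> K * (real n * ln (real n) ^ 2)" using NK by linarith
          qed auto
          finally show "measure_pmf.prob (run F ?a)
            {(H, q). wgraph_on n H \<and> real (card (edges H)) \<le> K * (real n * ln (real n) ^ 2) \<and>
               (\<forall>S \<subseteq> {1..n}. (1 - 2 * \<epsilon>) * F S \<le> cut_fun n H S \<and> cut_fun n H S \<le> (1 + 2 * \<epsilon>) * F S)}
            \<ge> 1 - C2 * real n powr (5 - d)" unfolding prob_run_eq_out .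
        qed
        then show ?thesis by blast
      qed
    qed
    then show ?thesis by (intro exI[of _ K] allI impI)
  qed
  have final: "\<exists>K A. \<forall>n\<ge>1. ?Q \<epsilon> K n (A n)" if eps: "\<epsilon> > 0" for \<epsilon> :: real
  proof -
    from main[OF eps] obtain K where K: "\<forall>n\<ge>1. \<exists>a. ?Q \<epsilon> K n a" by (elim exE)
    show ?thesis by (rule exI[of _ K], rule choice_on[OF K])
  qed
  show ?thesis
    by (rule exI[of _ C1], rule exI[of _ C2], rule exI[of _ 2], intro allI impI, rule final)
qed

end
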